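(* Assume that $\alpha,\beta \ge -1/2$. Given any $T > 0$, we have $$\mathcal{H}_t^{\alpha,\beta}(\theta,\varphi) \simeq \Big( t^2+ \theta^2+\varphi^2 \Big)^{-\alpha-1/2} \Big( t^2 + (\pi-\theta)^2 + (\pi-\varphi)^2 \Big)^{-\beta-1/2} \frac{t}{t^2+(\theta-\varphi)^2},$$ uniformly in $\theta, \varphi \in [0,\pi]$ and $0 < t \le T$, and $$\mathcal{H}_t^{\alpha,\beta}(\theta,\varphi) \simeq \exp\bigg( -t \frac{\alpha+\beta+1}{2} \bigg),$$ uniformly in $\theta,\varphi \in [0,\pi]$ and $t \ge T$.
   Context: For $\alpha,\beta>-1$ and $n=0,1,2,\ldots$, $P_n^{\alpha,\beta}$ is the classical Jacobi polynomial, $P_n^{\alpha,\beta}(x) = \frac{(-1)^n}{2^n n!} (1-x)^{-\alpha}(1+x)^{-\beta} \frac{d^n}{dx^n}[ (1-x)^{\alpha+n}(1+x)^{\beta+n}]$, and $h_n^{\alpha,\beta} = \int_{-1}^1 [P_n^{\alpha,\beta}(x)]^2 (1-x)^{\alpha}(1+x)^{\beta}\,dx$. The normalized trigonometric Jacobi polynomials are $\mathcal{P}_n^{\alpha,\beta}(\theta) = 2^{(\alpha+\beta+1)/2} (h_n^{\alpha,\beta})^{-1/2} P_n^{\alpha,\beta}(\cos\theta)$, $\theta\in[0,\pi]$. The Poisson-Jacobi kernel is $$\mathcal{H}_t^{\alpha,\beta}(\theta,\varphi) = \sum_{n=0}^{\infty} e^{-t\left|n+\frac{\alpha+\beta+1}{2}\right|}\mathcal{P}_n^{\alpha,\beta}(\theta)\mathcal{P}_n^{\alpha,\beta}(\varphi),\qquad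 \theta,\varphi\in[0,\pi],\ t>0.$$ The notation $X\simeq Y$ means that $C^{-1}Y\le X\le CY$ for a constant $C>0$ that is uniform over the indicated ranges of variables (it may depend on $\alpha,\beta,T$). *)

theory Defs
  imports "HOL-Analysis.Analysis" "HOL-Computational_Algebra.Polynomial"
begin

text \<open>
  The right-hand side of Rodrigues' formula. It is meaningful only for \<open>-1 < x < 1\<close>;
  at \<open>x = 1\<close> and \<open>x = -1\<close> the negative powers are singular.
\<close>

definition jacobi_rodrigues :: "nat \<Rightarrow> real \<Rightarrow> real \<Rightarrow> real \<Rightarrow> real" where
  "jacobi_rodrigues n \<alpha> \<beta> x =
     (-1) ^ n / (2 ^ n * fact n) * (1 - x) powr (- \<alpha>) * (1 + x) powr (- \<beta>) *
     (deriv ^^ n) (\<lambda>y. (1 - y) powr (\<alpha> + real n) * (1 + y) powr (\<beta> + real n)) x"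

text \<open>
  The Jacobi polynomial is the polynomial that agrees with Rodrigues' formula on the open
  interval, which fixes its values at the endpoints as well. It exists and is unique for all
  real parameters (\<open>ex1_jacobi_poly\<close> below).
\<close>

definition jacobi_poly :: "nat \<Rightarrow> real \<Rightarrow> real \<Rightarrow> real poly" where
  "jacobi_poly n \<alpha> \<beta> =
     (THE p. \<forall>x\<in>{-1<..<1}. poly p x = jacobi_rodrigues n \<alpha> \<beta> x)"

definition jacobi_h :: "nat \<Rightarrow> real \<Rightarrow> real \<Rightarrow> real" where
  "jacobi_h n \<alpha> \<beta> =
     (LINT x:{-1..1}|lborel.
        (poly (jacobi_poly n \<alpha> \<beta>) x)\<^sup>2 * (1 - x) powr \<alpha> * (1 + x) powr \<beta>)"

definition trig_jacobi :: "nat \<Rightarrow> real \<Rightarrow> real \<Rightarrow> real \<Rightarrow> real" where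
  "trig_jacobi n \<alpha> \<beta> \<theta> =
     2 powr ((\<alpha> + \<beta> + 1) / 2) * jacobi_h n \<alpha> \<beta> powr (- 1 / 2) *
     poly (jacobi_poly n \<alpha> \<beta>) (cos \<theta>)"

definition poisson_jacobi_kernel :: "real \<Rightarrow> real \<Rightarrow> real \<Rightarrow> real \<Rightarrow> real \<Rightarrow> real" where
  "poisson_jacobi_kernel \<alpha> \<beta> t \<theta> \<phi> =
     (\<Sum>n. exp (- t * \<bar>real n + (\<alpha> + \<beta> + 1) / 2\<bar>) *
           trig_jacobi n \<alpha> \<beta> \<theta> * trig_jacobi n \<alpha> \<beta> \<phi>)"

lemma deriv_pow_weight:
  fixes a b :: real
  shows "\<exists>q. \<forall>x\<in>{-1<..<1}. (deriv ^^ k) (\<lambda>y. (1 - y) powr a * (1 + y) powr b) x =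
           (1 - x) powr (a - real k) * (1 + x) powr (b - real k) * poly q x"
proof (induction k)
  case 0
  show ?case by (rule exI[of _ 1]) simp
next
  case (Suc k)
  define f where "f = (\<lambda>y::real. (1 - y) powr a * (1 + y) powr b)"
  from Suc obtain q where q: "\<And>x. x \<in> {-1<..<1} \<Longrightarrow> (deriv ^^ k) f x =
      (1 - x) powr (a - real k) * (1 + x) powr (b - real k) * poly q x"
    unfolding f_def by blast
  define r where "r = smult (- (a - real k)) ([:1, 1:] * q) + smult (b - real k) ([:1, -1:] * q)
      + [:1, -1:] * [:1, 1:] * pderiv q"
  have "(deriv ^^ Suc k) f x =
      (1 - x) powr (a - real (Suc k)) * (1 + x) powr (b - real (Suc k)) * poly r x"
    if x: "x \<in> {-1<..<1}" for x
  proof -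
    let ?g = "\<lambda>x. (1 - x) powr (a - real k) * (1 + x) powr (b - real k) * poly q x"
    have pos: "1 - x > 0" "1 + x > 0" using x by auto
    have ev: "eventually (\<lambda>y. (deriv ^^ k) f y = ?g y) (nhds x)"
      using eventually_nhds_in_open[of "{-1<..<1}" x] x
      by (auto elim!: eventually_mono simp: q)
    define U where "U = (1 - x) powr (a - real k - 1)"
    define V where "V = (1 + x) powr (b - real k - 1)"
    have U: "(1 - x) powr (a - real k) = U * (1 - x)"
      using pos by (simp add: U_def powr_diff)
    have V: "(1 + x) powr (b - real k) = V * (1 + x)"
      using pos by (simp add: V_def powr_diff)
    have "((\<lambda>x. (1 - x) powr (a - real k)) has_real_derivative - ((a - real k) * U)) (at x)"
      using DERIV_fun_powr[of "\<lambda>x. 1 - x" "-1" x "a - real k"] pos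
      unfolding U_def by (auto intro!: derivative_eq_intros)
    moreover have "((\<lambda>x. (1 + x) powr (b - real k)) has_real_derivative ((b - real k) * V)) (at x)"
      using DERIV_fun_powr[of "\<lambda>x. 1 + x" "1" x "b - real k"] pos
      unfolding V_def by (auto intro!: derivative_eq_intros)
    ultimately have "(?g has_real_derivative
        ((- ((a - real k) * U) * (1 + x) powr (b - real k) + ((b - real k) * V) * (1 - x) powr (a - real k)) * poly q x
         + poly (pderiv q) x * ((1 - x) powr (a - real k) * (1 + x) powr (b - real k)))) (at x)"
      by (intro DERIV_mult poly_DERIV)
    also have "(- ((a - real k) * U) * (1 + x) powr (b - real k) + ((b - real k) * V) * (1 - x) powr (a - real k)) * poly q x
         + poly (pderiv q) x * ((1 - x) powr (a - real k) * (1 + x) powr (b - real k)) = U * V * poly r x"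
      unfolding U V r_def by (simp add: algebra_simps)
    finally have "deriv ?g x = U * V * poly r x" by (rule DERIV_imp_deriv)
    moreover have "deriv ((deriv ^^ k) f) x = deriv ?g x"
      using ev by (rule deriv_cong_ev) simp
    ultimately show ?thesis
      by (simp add: U_def V_def algebra_simps)
  qed
  then show ?case unfolding f_def by blast
qed

lemma ex1_jacobi_poly:
  "\<exists>!p. \<forall>x\<in>{-1<..<1}. poly p x = jacobi_rodrigues n \<alpha> \<beta> x"
proof (rule ex_ex1I)
  from deriv_pow_weight[of n "\<alpha> + real n" "\<beta> + real n"] obtain q where
    q: "\<forall>x\<in>{-1<..<1}. (deriv ^^ n) (\<lambda>y. (1 - y) powr (\<alpha> + real n) * (1 + y) powr (\<beta> + real n)) x =
           (1 - x) powr \<alpha> * (1 + x) powr \<beta> * poly q x" by auto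
  show "\<exists>p. \<forall>x\<in>{-1<..<1}. poly p x = jacobi_rodrigues n \<alpha> \<beta> x"
  proof (intro exI ballI)
    fix x :: real assume x: "x \<in> {-1<..<1}"
    then show "poly (smult ((-1) ^ n / (2 ^ n * fact n)) q) x = jacobi_rodrigues n \<alpha> \<beta> x"
      using q by (simp add: jacobi_rodrigues_def powr_minus field_simps)
  qed
next
  fix p p' :: "real poly"
  assume *: "\<forall>x\<in>{-1<..<1}. poly p x = jacobi_rodrigues n \<alpha> \<beta> x"
    "\<forall>x\<in>{-1<..<1}. poly p' x = jacobi_rodrigues n \<alpha> \<beta> x"
  have "{-1<..<1::real} \<subseteq> {x. poly (p - p') x = 0}" using * by auto
  moreover have "infinite {-1<..<1::real}" by (simp add: infinite_Ioo)
  ultimately have "p - p' = 0"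
    using poly_roots_finite finite_subset by blast
  then show "p = p'" by simp
qed

lemma poly_jacobi_poly:
  "x \<in> {-1<..<1} \<Longrightarrow> poly (jacobi_poly n \<alpha> \<beta>) x = jacobi_rodrigues n \<alpha> \<beta> x"
  using theI'[OF ex1_jacobi_poly[of n \<alpha> \<beta>]] unfolding jacobi_poly_def by blast

end

theory Submission
  imports Defs "HOL-Complex_Analysis.Complex_Analysis"
begin

text \<open>
  Write \<open>\<lambda> = \<alpha> + \<beta> + 1\<close>, \<open>X = sin\<^sup>2 (\<theta> / 2)\<close>, \<open>Y = sin\<^sup>2 (\<phi> / 2)\<close>, \<open>x = sin (\<theta> / 2) sin (\<phi> / 2)\<close>,
  \<open>y = cos (\<theta> / 2) cos (\<phi> / 2)\<close>. Bailey's product formula expresses \<open>P\<^sub>M(cos \<theta>) P\<^sub>M(cos \<phi>)\<close>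
  through the monomials \<open>(X Y)\<^sup>m ((1 - X) (1 - Y))\<^sup>n\<close>, and summation over \<open>M\<close> turns
  the Poisson kernel into \<open>tanh (t / 2) (2 cosh (t / 2)) powr -\<lambda>\<close> times a double power series in
  \<open>(x / cosh (t / 2))\<^sup>2\<close> and \<open>(y / cosh (t / 2))\<^sup>2\<close> with positive coefficients. By Euler's integral for
  the Gamma function that series at \<open>\<xi>\<^sup>2, \<eta>\<^sup>2\<close> equals the integral over \<open>w > 0\<close> of
  \<open>exp (-w) w powr \<lambda>\<close> times two modified Bessel functions at \<open>\<xi> w\<close> and \<open>\<eta> w\<close>, each comparable to
  \<open>exp z (1 + z) powr -(\<alpha> + 1/2)\<close>, respectively with \<open>\<beta>\<close>. Hence it is comparable to
  \<open>(1 - \<eta>) powr -(\<alpha> + 1/2) (1 - \<xi>) powr -(\<beta> + 1/2) / (1 - \<xi> - \<eta>)\<close>, and both estimates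
  reduce to elementary bounds for cosine and hyperbolic cosine.
\<close>

section \<open>Rodrigues' formula and Bailey's product formula\<close>

text \<open>The terms of the expansion change sign and cancel away from the diagonal, so termwise
  estimates of Jacobi polynomials give no lower bound for the kernel. Resummation replaces them by
  nonnegative terms, which can be estimated from both sides factor by factor. The price is an
  exchange of summations: with r = exp (-t) the double series converges absolutely only for small r,
  and the resulting identity reaches all r in (0, 1) by analytic continuation. The geometry of the
  estimate lies in x + y = cos ((\<theta> - \<phi>) / 2). For \<xi> = x / cosh (t / 2) and \<eta> =
  y / cosh (t / 2), as t tends to 0, the quantity 1 - \<xi> - \<eta> degenerates only on the
  diagonal, 1 - \<eta> only at \<theta> = \<phi> = 0 and 1 - \<xi> only at \<theta> = \<phi> = pi;
  these are the three factors of the short-time bound. The range \<alpha>, \<beta> \<ge> -1/2 enters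
  through \<lambda> \<ge> 0, through the signs of the exponents \<alpha> + 1/2 and \<beta> + 1/2,
  and through the control of Jacobi polynomials by their values at the endpoints.\<close>

lemma gbinomial_Suc_mult: "real (Suc i) * (a gchoose Suc i) = (a - real i) * (a gchoose i)" for a :: real
  using gbinomial_absorb_comp[of a i] gbinomial_absorption[of i a] by simp

text \<open>Leibniz' rule with each repeated derivative divided by its factorial: the i-th
  derivative of (1 - y) powr p contributes (-1)^i (p gchoose i), so the binomial coefficients of the
  rule are absorbed into \<open>fact k\<close>.\<close>

lemma higher_deriv_powr_mult_powr:
  fixes p q x :: real
  assumes "x \<in> {-1<..<1}"
  shows "(deriv ^^ k) (\<lambda>y. (1 - y) powr p * (1 + y) powr q) x =
    fact k * (\<Sum>s\<le>k. (-1) ^ (k - s) * (p gchoose (k - s)) * (q gchoose s) *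
      (1 - x) powr (p - real (k - s)) * (1 + x) powr (q - real s))"
  using assms
proof (induction k arbitrary: x)
  case 0
  then show ?case by simp
next
  case (Suc k)
  define f where "f = (\<lambda>y::real. (1 - y) powr p * (1 + y) powr q)"
  define t where "t i j y = (-1) ^ i * (p gchoose i) * (q gchoose j) *
      (1 - y) powr (p - real i) * (1 + y) powr (q - real j)" for i j and y :: real
  have IH: "(deriv ^^ k) f y = fact k * (\<Sum>s\<le>k. t (k - s) s y)" if "y \<in> {-1<..<1}" for y
    using Suc.IH[OF that] by (simp add: f_def t_def)
  have pos: "1 - x > 0" "1 + x > 0" using Suc.prems by auto
  have dt: "(t i j has_real_derivative real (Suc i) * t (Suc i) j x + real (Suc j) * t i (Suc j) x) (at x)"
    for i j
  proof -
    have aux: "(k * u * v) * (- (A * U) * V + (B * W) * Z) = - k * (A * u) * v * U * V + k * u * (B * v) * Z * W"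
      for k u v A B U V W Z :: real
      by (simp add: algebra_simps)
    have "((\<lambda>x. (1 - x) powr (p - real i)) has_real_derivative - ((p - real i) * (1 - x) powr (p - real (Suc i)))) (at x)"
      using DERIV_fun_powr[of "\<lambda>x. 1 - x" "-1" x "p - real i"] pos
      by (auto intro!: derivative_eq_intros simp: algebra_simps)
    moreover have "((\<lambda>x. (1 + x) powr (q - real j)) has_real_derivative ((q - real j) * (1 + x) powr (q - real (Suc j)))) (at x)"
      using DERIV_fun_powr[of "\<lambda>x. 1 + x" "1" x "q - real j"] pos
      by (auto intro!: derivative_eq_intros simp: algebra_simps)
    ultimately have "((\<lambda>x. ((-1) ^ i * (p gchoose i) * (q gchoose j)) * ((1 - x) powr (p - real i) * (1 + x) powr (q - real j)))
      has_real_derivative ((-1) ^ i * (p gchoose i) * (q gchoose j)) *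
       (- ((p - real i) * (1 - x) powr (p - real (Suc i))) * (1 + x) powr (q - real j)
       + ((q - real j) * (1 + x) powr (q - real (Suc j))) * (1 - x) powr (p - real i))) (at x)"
      by (intro DERIV_cmult DERIV_mult)
    also have "(\<lambda>x. ((-1) ^ i * (p gchoose i) * (q gchoose j)) * ((1 - x) powr (p - real i) * (1 + x) powr (q - real j))) = t i j"
      by (auto simp: t_def mult.assoc)
    also have "((-1) ^ i * (p gchoose i) * (q gchoose j)) *
       (- ((p - real i) * (1 - x) powr (p - real (Suc i))) * (1 + x) powr (q - real j)
       + ((q - real j) * (1 + x) powr (q - real (Suc j))) * (1 - x) powr (p - real i))
       = - ((-1) ^ i) * ((p - real i) * (p gchoose i)) * (q gchoose j) * (1 - x) powr (p - real (Suc i)) * (1 + x) powr (q - real j)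
       + (-1) ^ i * (p gchoose i) * ((q - real j) * (q gchoose j)) * (1 - x) powr (p - real i) * (1 + x) powr (q - real (Suc j))"
      by (rule aux)
    also have "\<dots> = real (Suc i) * t (Suc i) j x + real (Suc j) * t i (Suc j) x"
      unfolding gbinomial_Suc_mult[symmetric] t_def by simp
    finally show ?thesis .
  qed
  have ev: "eventually (\<lambda>y. (deriv ^^ k) f y = fact k * (\<Sum>s\<le>k. t (k - s) s y)) (nhds x)"
    using eventually_nhds_in_open[of "{-1<..<1}" x] Suc.prems by (auto elim!: eventually_mono simp: IH)
  have "((\<lambda>y. fact k * (\<Sum>s\<le>k. t (k - s) s y)) has_real_derivative
     fact k * (\<Sum>s\<le>k. real (Suc (k - s)) * t (Suc (k - s)) s x + real (Suc s) * t (k - s) (Suc s) x)) (at x)"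
    by (intro DERIV_cmult DERIV_sum dt)
  \<comment> \<open>Each \<open>u s\<close> arises twice, with weight \<open>Suc k - s\<close> from
    the first factor and weight \<open>s\<close> from the second; the weights add up to
    \<open>Suc k\<close>, which completes \<open>fact (Suc k)\<close>.\<close>
  moreover have "(\<Sum>s\<le>k. real (Suc (k - s)) * t (Suc (k - s)) s x + real (Suc s) * t (k - s) (Suc s) x)
      = real (Suc k) * (\<Sum>s\<le>Suc k. t (Suc k - s) s x)"
  proof -
    define u where "u s = t (Suc k - s) s x" for s
    have "(\<Sum>s\<le>k. real (Suc (k - s)) * t (Suc (k - s)) s x) = (\<Sum>s\<le>k. (real (Suc k) - real s) * u s)"
      by (intro sum.cong) (auto simp: u_def Suc_diff_le of_nat_diff)
    also have "\<dots> = (\<Sum>s\<le>Suc k. (real (Suc k) - real s) * u s)" by simp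
    finally have 1: "(\<Sum>s\<le>k. real (Suc (k - s)) * t (Suc (k - s)) s x) = \<dots>" .
    have 2: "(\<Sum>s\<le>k. real (Suc s) * t (k - s) (Suc s) x) = (\<Sum>s\<le>Suc k. real s * u s)"
      by (subst sum.atMost_Suc_shift) (simp add: u_def)
    have "(\<Sum>s\<le>Suc k. (real (Suc k) - real s) * u s) + (\<Sum>s\<le>Suc k. real s * u s)
        = (\<Sum>s\<le>Suc k. real (Suc k) * u s)"
      by (subst sum.distrib[symmetric]) (simp add: algebra_simps)
    then show ?thesis unfolding sum.distrib 1 2
      by (simp only: u_def sum_distrib_left)
  qed
  ultimately have "deriv (\<lambda>y. fact k * (\<Sum>s\<le>k. t (k - s) s y)) x = fact (Suc k) * (\<Sum>s\<le>Suc k. t (Suc k - s) s x)"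
    by (intro DERIV_imp_deriv) (simp add: mult_ac)
  moreover have "deriv ((deriv ^^ k) f) x = deriv (\<lambda>y. fact k * (\<Sum>s\<le>k. t (k - s) s y)) x"
    using ev by (rule deriv_cong_ev) simp
  ultimately show ?case by (simp add: f_def t_def)
qed

text \<open>Here and below the variable is \<open>(1 - x) / 2\<close>, which is \<open>sin\<^sup>2 (\<theta> / 2)\<close> for \<open>x = cos \<theta>\<close>.\<close>

definition shifted_jacobi :: "nat \<Rightarrow> real \<Rightarrow> real \<Rightarrow> real poly" where
  "shifted_jacobi n \<alpha> \<beta> = (\<Sum>s\<le>n. smult ((-1) ^ s * ((\<alpha> + real n) gchoose (n - s)) * ((\<beta> + real n) gchoose s))
     ([:0, 1:] ^ s * [:1, -1:] ^ (n - s)))"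

text \<open>By Leibniz' rule the negative powers in Rodrigues' formula cancel on the open interval.
  Polynomials that agree at infinitely many points coincide, so the identity also covers the
  endpoints, where the formula itself is singular.\<close>

lemma poly_jacobi_poly_eq_shifted:
  "poly (jacobi_poly n \<alpha> \<beta>) x = poly (shifted_jacobi n \<alpha> \<beta>) ((1 - x) / 2)"
proof -
  define q where "q = pcompose (shifted_jacobi n \<alpha> \<beta>) [:1/2, -1/2:]"
  have q: "poly q x = poly (shifted_jacobi n \<alpha> \<beta>) ((1 - x) / 2)" for x
    by (simp add: q_def poly_pcompose diff_divide_distrib)
  have *: "poly q x = poly (jacobi_poly n \<alpha> \<beta>) x" if x: "x \<in> {-1<..<1}" for x
  proof -
    have pos: "1 - x > 0" "1 + x > 0" using x by auto
    have "poly (jacobi_poly n \<alpha> \<beta>) x = (-1) ^ n / (2 ^ n * fact n) * (1 - x) powr (- \<alpha>) * (1 + x) powr (- \<beta>) *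
       (fact n * (\<Sum>s\<le>n. (-1) ^ (n - s) * ((\<alpha> + real n) gchoose (n - s)) * ((\<beta> + real n) gchoose s) *
      (1 - x) powr (\<alpha> + real n - real (n - s)) * (1 + x) powr (\<beta> + real n - real s)))"
      by (simp add: poly_jacobi_poly[OF x] jacobi_rodrigues_def higher_deriv_powr_mult_powr[OF x])
    also have "\<dots> = (\<Sum>s\<le>n. ((-1) ^ n * (-1) ^ (n - s)) * ((\<alpha> + real n) gchoose (n - s)) * ((\<beta> + real n) gchoose s) *
       (((1 - x) powr (- \<alpha>) * (1 - x) powr (\<alpha> + real n - real (n - s))) *
        ((1 + x) powr (- \<beta>) * (1 + x) powr (\<beta> + real n - real s))) / 2 ^ n)"
      by (simp add: sum_distrib_left sum_distrib_right mult_ac)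
    also have "\<dots> = (\<Sum>s\<le>n. (-1) ^ s * ((\<alpha> + real n) gchoose (n - s)) * ((\<beta> + real n) gchoose s) *
        (((1 - x) / 2) ^ s * ((1 + x) / 2) ^ (n - s)))"
    proof (intro sum.cong refl)
      fix s assume "s \<in> {..n}"
      then have s: "s \<le> n" by simp
      have e1: "(-1::real) ^ n * (-1) ^ (n - s) = (-1) ^ s"
        using s by (simp add: minus_one_power_iff)
      have e2: "(1 - x) powr (- \<alpha>) * (1 - x) powr (\<alpha> + real n - real (n - s)) = (1 - x) ^ s"
        using pos s by (simp add: powr_add[symmetric] of_nat_diff powr_realpow)
      have e3: "(1 + x) powr (- \<beta>) * (1 + x) powr (\<beta> + real n - real s) = (1 + x) ^ (n - s)"
        using pos s by (simp add: powr_add[symmetric] powr_realpow[symmetric] of_nat_diff)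
      have e4: "(2::real) ^ n = 2 ^ s * 2 ^ (n - s)"
        using s by (simp add: power_add[symmetric])
      show "((-1) ^ n * (-1) ^ (n - s)) * ((\<alpha> + real n) gchoose (n - s)) * ((\<beta> + real n) gchoose s) *
       (((1 - x) powr (- \<alpha>) * (1 - x) powr (\<alpha> + real n - real (n - s))) *
        ((1 + x) powr (- \<beta>) * (1 + x) powr (\<beta> + real n - real s))) / 2 ^ n
        = (-1) ^ s * ((\<alpha> + real n) gchoose (n - s)) * ((\<beta> + real n) gchoose s) *
        (((1 - x) / 2) ^ s * ((1 + x) / 2) ^ (n - s))"
        unfolding e1 e2 e3 e4 by (simp add: power_divide)
    qed
    also have "\<dots> = poly (shifted_jacobi n \<alpha> \<beta>) ((1 - x) / 2)"
      unfolding shifted_jacobi_def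
      by (simp add: poly_sum) (intro sum.cong refl, simp add: field_simps)
    finally show ?thesis by (simp add: q)
  qed
  have "{-1<..<1::real} \<subseteq> {x. poly (q - jacobi_poly n \<alpha> \<beta>) x = 0}" using * by auto
  moreover have "infinite {-1<..<1::real}" by (simp add: infinite_Ioo)
  ultimately have "q - jacobi_poly n \<alpha> \<beta> = 0"
    using poly_roots_finite finite_subset by blast
  then show ?thesis using q by simp
qed

section \<open>The Jacobi differential operator in hypergeometric form\<close>

definition jacobi_op :: "real \<Rightarrow> real \<Rightarrow> real poly \<Rightarrow> real poly" where
  "jacobi_op \<alpha> \<beta> p = [:0, 1, -1:] * pderiv (pderiv p) + [:\<alpha> + 1, - (\<alpha> + \<beta> + 2):] * pderiv p"

lemma jacobi_op_add: "jacobi_op \<alpha> \<beta> (p + q) = jacobi_op \<alpha> \<beta> p + jacobi_op \<alpha> \<beta> q"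
  unfolding jacobi_op_def pderiv_add distrib_left by (simp only: add_ac)

lemma jacobi_op_smult: "jacobi_op \<alpha> \<beta> (smult c p) = smult c (jacobi_op \<alpha> \<beta> p)"
  unfolding jacobi_op_def pderiv_smult mult_smult_right smult_add_right ..

lemma jacobi_op_sum: "jacobi_op \<alpha> \<beta> (\<Sum>i\<in>A. f i) = (\<Sum>i\<in>A. jacobi_op \<alpha> \<beta> (f i))"
proof (induction A rule: infinite_finite_induct)
  case (insert x A)
  then show ?case by (simp add: jacobi_op_add)
qed (simp_all add: jacobi_op_def)

text \<open>The operator couples the coefficient k only with k + 1, so an eigenvalue equation is a
  two-term recurrence. This gives both the uniqueness of a polynomial eigenfunction with prescribed
  value at 0 and its explicit coefficients.\<close>

lemma coeff_jacobi_op: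
  "coeff (jacobi_op \<alpha> \<beta> p) k =
    (real k + 1) * (real k + \<alpha> + 1) * coeff p (Suc k) - real k * (real k + \<alpha> + \<beta> + 1) * coeff p k"
proof (cases k)
  case 0
  then show ?thesis by (simp add: jacobi_op_def coeff_pderiv mult_pCons_left)
next
  case (Suc j)
  then show ?thesis
    by (cases j) (simp_all add: jacobi_op_def coeff_pderiv mult_pCons_left algebra_simps)
qed

text \<open>The products X^m (1 - X)^n are the building blocks of both Rodrigues' sum and Bailey's
  sum. Each is sent to a combination of itself and two neighbours of lower degree. The truncated
  exponents \<open>m - 1\<close> and \<open>n - 1\<close> are harmless at 0, where their factor
  vanishes.\<close>

lemma jacobi_op_power_mult_power:
  "poly (jacobi_op \<alpha> \<beta> ([:0, 1:] ^ m * [:1, -1:] ^ n)) X =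
     real m * (real m + \<alpha>) * (X ^ (m - 1) * (1 - X) ^ n) + real n * (real n + \<beta>) * (X ^ m * (1 - X) ^ (n - 1))
     - real (m + n) * (real (m + n) + \<alpha> + \<beta> + 1) * (X ^ m * (1 - X) ^ n)"
proof -
  define A where "A = X ^ m"
  define B where "B = (1 - X) ^ n"
  define A1 where "A1 = real m * X ^ (m - 1)"
  define B1 where "B1 = - real n * (1 - X) ^ (n - 1)"
  define A2 where "A2 = real m * (real (m - 1) * X ^ (m - 1 - 1))"
  define B2 where "B2 = real n * (real (n - 1) * (1 - X) ^ (n - 1 - 1))"
  have a: "X * A1 = real m * A" "X * A2 = (real m - 1) * A1"
    unfolding A_def A1_def A2_def
    by (cases m; simp; rename_tac k; case_tac k; simp)+
  have b: "(1 - X) * B1 = - real n * B" "(1 - X) * B2 = - (real n - 1) * B1"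
    unfolding B_def B1_def B2_def
    by (cases n; simp; rename_tac k; case_tac k; simp add: algebra_simps)+
  have p1: "pderiv ([:0, 1:] ^ k) = smult (real k) ([:0, 1:] ^ (k - 1))" for k
    by (simp add: pderiv_power pderiv_pCons)
  have p2: "pderiv ([:1, -1:] ^ k) = smult (- real k) ([:1, -1:] ^ (k - 1))" for k
    by (simp add: pderiv_power pderiv_pCons flip: minus_pCons)
  have d1: "poly (pderiv ([:0, 1:] ^ m * [:1, -1:] ^ n)) X = A1 * B + A * B1"
    unfolding pderiv_mult p1 p2 A_def B_def A1_def B1_def by simp
  have d2: "poly (pderiv (pderiv ([:0, 1:] ^ m * [:1, -1:] ^ n))) X = A2 * B + 2 * A1 * B1 + A * B2"
    unfolding pderiv_mult p1 p2 pderiv_add pderiv_smult A_def B_def A1_def B1_def A2_def B2_def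
    by (simp add: algebra_simps)
  have "poly (jacobi_op \<alpha> \<beta> ([:0, 1:] ^ m * [:1, -1:] ^ n)) X =
    X * (1 - X) * (A2 * B + 2 * A1 * B1 + A * B2) + (\<alpha> + 1 - (\<alpha> + \<beta> + 2) * X) * (A1 * B + A * B1)"
    by (simp add: jacobi_op_def d1 d2 algebra_simps)
  also have "\<dots> = (1 - X) * (X * A2) * B + 2 * (X * A1) * ((1 - X) * B1) + X * A * ((1 - X) * B2)
     + (\<alpha> + 1) * (A1 * B + A * B1) - (\<alpha> + \<beta> + 2) * ((X * A1) * B + X * (A * B1))"
    by (simp add: algebra_simps)
  also have "\<dots> = (real m - 1) * (A1 - X * A1) * B - 2 * real m * real n * A * B - (real n - 1) * A * (X * B1)
     + (\<alpha> + 1) * (A1 * B + A * B1) - (\<alpha> + \<beta> + 2) * (real m * A * B + A * (X * B1))"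
    unfolding a b by (simp add: algebra_simps a(1)[unfolded mult.commute[of X]])
  also have "X * B1 = B1 + real n * B" using b(1) by (simp add: algebra_simps)
  also have "(real m - 1) * (A1 - X * A1) * B - 2 * real m * real n * A * B - (real n - 1) * A * (B1 + real n * B)
     + (\<alpha> + 1) * (A1 * B + A * B1) - (\<alpha> + \<beta> + 2) * (real m * A * B + A * (B1 + real n * B))
     = (real m + \<alpha>) * A1 * B - (real n + \<beta>) * A * B1 - real (m + n) * (real (m + n) + \<alpha> + \<beta> + 1) * (A * B)"
    unfolding a by (simp add: algebra_simps)
  finally show ?thesis by (simp add: A_def B_def A1_def B1_def algebra_simps)
qed

text \<open>\<open>\<alpha> > -1\<close> keeps the factor (k + 1) (k + \<alpha> + 1) of the
  recurrence away from zero, so the value at 0 determines every further coefficient.\<close>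

lemma jacobi_op_eigen_unique:
  assumes "\<alpha> > -1"
    and p: "jacobi_op \<alpha> \<beta> p = smult \<mu> p" and q: "jacobi_op \<alpha> \<beta> q = smult \<mu> q"
    and 0: "poly p 0 = poly q 0"
  shows "p = q"
proof (rule poly_eqI)
  fix k
  show "coeff p k = coeff q k"
  proof (induction k)
    case 0
    then show ?case using assms(4) by (simp add: poly_0_coeff_0)
  next
    case (Suc k)
    have nz: "(real k + 1) * (real k + \<alpha> + 1) \<noteq> 0" using assms(1) by simp
    have "(real k + 1) * (real k + \<alpha> + 1) * coeff r (Suc k) = (real k * (real k + \<alpha> + \<beta> + 1) + \<mu>) * coeff r k"
      if "jacobi_op \<alpha> \<beta> r = smult \<mu> r" for r
      using coeff_jacobi_op[of \<alpha> \<beta> r k] that by (simp add: algebra_simps)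
    from this[OF p] this[OF q] Suc nz show ?case by (metis mult_left_cancel)
  qed
qed

text \<open>All terms of Rodrigues' sum have total degree n, so the diagonal part of the operator
  already is the eigenvalue. The other parts cancel between neighbours: the part of term s + 1 that
  lowers the power of X is the negative of the part of term s that lowers the power of 1 -
  X.\<close>

lemma jacobi_op_shifted_jacobi:
  "jacobi_op \<alpha> \<beta> (shifted_jacobi n \<alpha> \<beta>) = smult (- (real n * (real n + \<alpha> + \<beta> + 1))) (shifted_jacobi n \<alpha> \<beta>)"
proof -
  define g where "g s = (-1) ^ s * ((\<alpha> + real n) gchoose (n - s)) * ((\<beta> + real n) gchoose s)" for s
  have "poly (jacobi_op \<alpha> \<beta> (shifted_jacobi n \<alpha> \<beta>)) X = poly (smult (- (real n * (real n + \<alpha> + \<beta> + 1))) (shifted_jacobi n \<alpha> \<beta>)) X" for X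
  proof -
    define u where "u s = g s * (real s * (real s + \<alpha>) * (X ^ (s - 1) * (1 - X) ^ (n - s)))" for s
    define v where "v s = g s * (real (n - s) * (real (n - s) + \<beta>) * (X ^ s * (1 - X) ^ (n - s - 1)))" for s
    define K where "K = real n * (real n + \<alpha> + \<beta> + 1)"
    define w where "w s = X ^ s * (1 - X) ^ (n - s)" for s
    have pJ: "poly (shifted_jacobi n \<alpha> \<beta>) X = (\<Sum>s\<le>n. g s * w s)"
      by (simp add: shifted_jacobi_def g_def w_def poly_sum)
    have "poly (jacobi_op \<alpha> \<beta> (shifted_jacobi n \<alpha> \<beta>)) X = (\<Sum>s\<le>n. u s + v s - K * (g s * w s))"
      unfolding shifted_jacobi_def g_def[symmetric] jacobi_op_sum jacobi_op_smult poly_sum poly_smult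
        jacobi_op_power_mult_power u_def v_def w_def K_def
      by (intro sum.cong refl) (simp add: algebra_simps)
    also have "\<dots> = (\<Sum>s\<le>n. u s) + (\<Sum>s\<le>n. v s) - K * poly (shifted_jacobi n \<alpha> \<beta>) X"
      unfolding pJ by (simp only: sum.distrib sum_subtractf sum_distrib_left)
    also have "(\<Sum>s\<le>n. u s) + (\<Sum>s\<le>n. v s) = 0"
    proof (cases n)
      case 0
      then show ?thesis by (simp add: u_def v_def)
    next
      case (Suc k)
      have "(\<Sum>s\<le>n. u s) = (\<Sum>s\<le>k. u (Suc s))"
        unfolding Suc sum.atMost_Suc_shift by (simp add: u_def)
      moreover have "(\<Sum>s\<le>n. v s) = (\<Sum>s\<le>k. v s)"
        unfolding Suc by (simp add: v_def Suc)
      moreover have "u (Suc s) + v s = 0" if "s \<le> k" for s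
      proof -
        have ns: "n - s = Suc (k - s)" using Suc that by simp
        have 1: "real (Suc s) * ((\<beta> + real n) gchoose Suc s) = (real (n - s) + \<beta>) * ((\<beta> + real n) gchoose s)"
          unfolding gbinomial_Suc_mult using that Suc by (simp add: of_nat_diff algebra_simps)
        have 2: "real (n - s) * ((\<alpha> + real n) gchoose (n - s)) = (real (Suc s) + \<alpha>) * ((\<alpha> + real n) gchoose (k - s))"
          unfolding ns gbinomial_Suc_mult using that Suc by (simp add: of_nat_diff algebra_simps)
        have "u (Suc s) = (-1) ^ Suc s * ((real (Suc s) + \<alpha>) * ((\<alpha> + real n) gchoose (k - s)))
             * (real (Suc s) * ((\<beta> + real n) gchoose Suc s)) * (X ^ s * (1 - X) ^ (k - s))"
          using Suc by (simp add: u_def g_def)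
        also have "\<dots> = - v s" unfolding 1 2[symmetric] v_def g_def by (simp add: ns)
        finally show ?thesis by simp
      qed
      ultimately show ?thesis by (simp add: sum.distrib[symmetric])
    qed
    finally show ?thesis by (simp add: K_def)
  qed
  then show ?thesis by (metis poly_eq_poly_eq_iff ext)
qed

lemma poly_shifted_jacobi_0: "poly (shifted_jacobi n \<alpha> \<beta>) 0 = pochhammer (\<alpha> + 1) n / fact n"
proof -
  have "poly (shifted_jacobi n \<alpha> \<beta>) 0 =
     (\<Sum>s\<le>n. if s = 0 then (\<alpha> + real n) gchoose n else 0)"
    unfolding shifted_jacobi_def poly_sum by (intro sum.cong) auto
  then show ?thesis by (simp add: gbinomial_pochhammer' algebra_simps)
qed

lemma poly_shifted_jacobi_1: "poly (shifted_jacobi n \<alpha> \<beta>) 1 = (-1) ^ n * pochhammer (\<beta> + 1) n / fact n"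
proof -
  have "poly (shifted_jacobi n \<alpha> \<beta>) 1 =
     (\<Sum>s\<le>n. if s = n then (-1) ^ n * ((\<beta> + real n) gchoose n) else 0)"
    unfolding shifted_jacobi_def poly_sum by (intro sum.cong) auto
  then show ?thesis by (simp add: gbinomial_pochhammer' algebra_simps)
qed

section \<open>Appell's double sum and Bailey's formula\<close>

definition bailey_coeff :: "real \<Rightarrow> real \<Rightarrow> nat \<Rightarrow> nat \<Rightarrow> real" where
  "bailey_coeff \<alpha> \<beta> m n = 1 / (pochhammer (\<alpha> + 1) m * pochhammer (\<beta> + 1) n * fact m * fact n)"

text \<open>\<open>bailey_coeff\<close> holds the denominators of Appell's function F4, whose
  numerators depend on m + n only. The factors removed here are exactly those that
  \<open>jacobi_op\<close> produces when it lowers a power of X or of 1 - X.\<close>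

lemma bailey_coeff_Suc:
  assumes "\<alpha> > -1" "\<beta> > -1"
  shows "bailey_coeff \<alpha> \<beta> (Suc m) n * (real (Suc m) * (real (Suc m) + \<alpha>)) = bailey_coeff \<alpha> \<beta> m n"
    and "bailey_coeff \<alpha> \<beta> m (Suc n) * (real (Suc n) * (real (Suc n) + \<beta>)) = bailey_coeff \<alpha> \<beta> m n"
proof -
  have "real (Suc m) * (real (Suc m) + \<alpha>) \<noteq> 0" "real (Suc n) * (real (Suc n) + \<beta>) \<noteq> 0"
    using assms by auto
  moreover have "bailey_coeff \<alpha> \<beta> (Suc m) n = bailey_coeff \<alpha> \<beta> m n / (real (Suc m) * (real (Suc m) + \<alpha>))"
    "bailey_coeff \<alpha> \<beta> m (Suc n) = bailey_coeff \<alpha> \<beta> m n / (real (Suc n) * (real (Suc n) + \<beta>))"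
    by (simp_all add: bailey_coeff_def pochhammer_Suc algebra_simps)
  ultimately show "bailey_coeff \<alpha> \<beta> (Suc m) n * (real (Suc m) * (real (Suc m) + \<alpha>)) = bailey_coeff \<alpha> \<beta> m n"
    and "bailey_coeff \<alpha> \<beta> m (Suc n) * (real (Suc n) * (real (Suc n) + \<beta>)) = bailey_coeff \<alpha> \<beta> m n"
    by auto
qed

text \<open>Bailey's product formula. Both sides, as polynomials in \<open>X\<close>, are eigenfunctions of
  the Jacobi operator for the same eigenvalue, hence proportional; the right-hand side is symmetric
  in \<open>X\<close> and \<open>Y\<close>, and at \<open>X = 0\<close>, \<open>Y = 1\<close> its sum collapses to the term \<open>1\<close>.\<close>

lemma shifted_jacobi_product:
  assumes "\<alpha> > -1" "\<beta> > -1"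
  shows "poly (shifted_jacobi M \<alpha> \<beta>) X * poly (shifted_jacobi M \<alpha> \<beta>) Y =
    poly (shifted_jacobi M \<alpha> \<beta>) 0 * poly (shifted_jacobi M \<alpha> \<beta>) 1 *
    (\<Sum>m\<le>M. \<Sum>n\<le>M. pochhammer (- real M) (m + n) * pochhammer (real M + \<alpha> + \<beta> + 1) (m + n) *
       bailey_coeff \<alpha> \<beta> m n * ((X * Y) ^ m * ((1 - X) * (1 - Y)) ^ n))"
proof -
  define J where "J = shifted_jacobi M \<alpha> \<beta>"
  define \<mu> where "\<mu> = real M * (real M + \<alpha> + \<beta> + 1)"
  define e where "e N = pochhammer (- real M) N * pochhammer (real M + \<alpha> + \<beta> + 1) N" for N
  define C where "C = bailey_coeff \<alpha> \<beta>"
  define Q where "Q Y = (\<Sum>m\<le>M. \<Sum>n\<le>M. smult (e (m + n) * C m n * (Y ^ m * (1 - Y) ^ n))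
     ([:0, 1:] ^ m * [:1, -1:] ^ n))" for Y :: real
  \<comment> \<open>The eigenvalue enters here: the factor from \<open>e N\<close> to
    \<open>e (Suc N)\<close> is \<open>- \<mu>\<close> plus the diagonal coefficient of
    \<open>jacobi_op\<close> at degree N, so subtracting the diagonal part leaves
    \<open>- \<mu>\<close>.\<close>
  have eSuc: "e (Suc N) = (real N * (real N + \<alpha> + \<beta> + 1) - \<mu>) * e N" for N
    by (simp add: e_def pochhammer_Suc \<mu>_def algebra_simps)
  \<comment> \<open>The square \<open>m, n \<le> M\<close> contains terms with m + n > M; they
    vanish, and so do the terms at index \<open>Suc M\<close> that the index shifts below bring
    in.\<close>
  have e0: "e N = 0" if "N > M" for N
    using that by (simp add: e_def pochhammer_of_nat_eq_0_lemma)
  have polyQ: "poly (Q Y) X = (\<Sum>m\<le>M. \<Sum>n\<le>M. e (m + n) * C m n * ((X * Y) ^ m * ((1 - X) * (1 - Y)) ^ n))" for X Y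
    unfolding Q_def poly_sum poly_smult by (intro sum.cong refl) (simp add: power_mult_distrib mult_ac)
  have sym: "poly (Q Y) X = poly (Q X) Y" for X Y
    unfolding polyQ by (simp add: mult.commute)
  have eig: "jacobi_op \<alpha> \<beta> (Q Y) = smult (- \<mu>) (Q Y)" for Y
  proof -
    have "poly (jacobi_op \<alpha> \<beta> (Q Y)) X = poly (smult (- \<mu>) (Q Y)) X" for X
    proof -
      define F where "F m n x = (x ^ m * (1 - x) ^ n)" for m n and x :: real
      \<comment> \<open>This is x + (1 - x) = 1. After the index shifts the two off-diagonal sums
        differ only by an extra factor Y or 1 - Y, so their sum carries no extra factor at
        all.\<close>
      have F1: "F (Suc m) n x + F m (Suc n) x = F m n x" for m n x
        by (simp add: F_def algebra_simps)
      have F1': "w * F (Suc m) n x * z + w * F m (Suc n) x * z = w * F m n x * z" for w z m n x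
        unfolding F1[of m n x, symmetric] by (simp only: algebra_simps)
      define u where "u m n = e (m + n) * (C m n * (real m * (real m + \<alpha>))) * F m n Y * F (m - 1) n X" for m n
      define v where "v m n = e (m + n) * (C m n * (real n * (real n + \<beta>))) * F m n Y * F m (n - 1) X" for m n
      have u: "(\<Sum>m\<le>M. u m n) = (\<Sum>m\<le>M. e (Suc (m + n)) * C m n * F (Suc m) n Y * F m n X)" for n
      proof -
        have "(\<Sum>m\<le>M. u m n) = (\<Sum>m\<le>Suc M. u m n)"
          by (simp add: u_def e0)
        also have "\<dots> = (\<Sum>m\<le>M. u (Suc m) n)"
          unfolding sum.atMost_Suc_shift by (simp add: u_def)
        also have "\<dots> = (\<Sum>m\<le>M. e (Suc (m + n)) * C m n * F (Suc m) n Y * F m n X)"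
          unfolding u_def C_def by (simp only: bailey_coeff_Suc[OF assms] add_Suc diff_Suc_1)
        finally show ?thesis .
      qed
      have v: "(\<Sum>n\<le>M. v m n) = (\<Sum>n\<le>M. e (Suc (m + n)) * C m n * F m (Suc n) Y * F m n X)" for m
      proof -
        have "(\<Sum>n\<le>M. v m n) = (\<Sum>n\<le>Suc M. v m n)"
          by (simp add: v_def e0)
        also have "\<dots> = (\<Sum>n\<le>M. v m (Suc n))"
          unfolding sum.atMost_Suc_shift by (simp add: v_def)
        also have "\<dots> = (\<Sum>n\<le>M. e (Suc (m + n)) * C m n * F m (Suc n) Y * F m n X)"
          unfolding v_def C_def by (simp only: bailey_coeff_Suc[OF assms] add_Suc_right diff_Suc_1)
        finally show ?thesis .
      qed
      have "poly (jacobi_op \<alpha> \<beta> (Q Y)) X = (\<Sum>m\<le>M. \<Sum>n\<le>M. u m n + v m n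
         - e (m + n) * C m n * (real (m + n) * (real (m + n) + \<alpha> + \<beta> + 1)) * F m n Y * F m n X)"
        unfolding Q_def jacobi_op_sum jacobi_op_smult poly_sum poly_smult
          jacobi_op_power_mult_power u_def v_def F_def
        by (intro sum.cong refl) (simp add: algebra_simps)
      also have "\<dots> = (\<Sum>m\<le>M. \<Sum>n\<le>M. u m n) + (\<Sum>m\<le>M. \<Sum>n\<le>M. v m n)
         - (\<Sum>m\<le>M. \<Sum>n\<le>M. e (m + n) * C m n * (real (m + n) * (real (m + n) + \<alpha> + \<beta> + 1)) * F m n Y * F m n X)"
        by (simp add: sum.distrib sum_subtractf)
      also have "(\<Sum>m\<le>M. \<Sum>n\<le>M. u m n) = (\<Sum>m\<le>M. \<Sum>n\<le>M. e (Suc (m + n)) * C m n * F (Suc m) n Y * F m n X)"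
        by (subst sum.swap, subst u, rule sum.swap)
      also have "(\<Sum>m\<le>M. \<Sum>n\<le>M. v m n) = (\<Sum>m\<le>M. \<Sum>n\<le>M. e (Suc (m + n)) * C m n * F m (Suc n) Y * F m n X)"
        by (subst v) simp
      also have "(\<Sum>m\<le>M. \<Sum>n\<le>M. e (Suc (m + n)) * C m n * F (Suc m) n Y * F m n X) +
        (\<Sum>m\<le>M. \<Sum>n\<le>M. e (Suc (m + n)) * C m n * F m (Suc n) Y * F m n X) =
        (\<Sum>m\<le>M. \<Sum>n\<le>M. e (Suc (m + n)) * C m n * F m n Y * F m n X)"
        unfolding sum.distrib[symmetric] by (intro sum.cong refl F1')
      also have "\<dots> - (\<Sum>m\<le>M. \<Sum>n\<le>M. e (m + n) * C m n * (real (m + n) * (real (m + n) + \<alpha> + \<beta> + 1)) * F m n Y * F m n X)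
        = (\<Sum>m\<le>M. \<Sum>n\<le>M. - \<mu> * (e (m + n) * C m n * (F m n Y * F m n X)))"
        unfolding sum_subtractf[symmetric] eSuc
        by (intro sum.cong refl) (simp only: algebra_simps)
      also have "\<dots> = - \<mu> * (\<Sum>m\<le>M. \<Sum>n\<le>M. e (m + n) * C m n * (F m n Y * F m n X))"
        by (simp only: sum_distrib_left)
      also have "\<dots> = poly (smult (- \<mu>) (Q Y)) X"
        unfolding poly_smult polyQ F_def by (simp add: power_mult_distrib mult_ac)
      finally show ?thesis .
    qed
    then show ?thesis by (metis poly_eq_poly_eq_iff ext)
  qed
  have eigJ: "jacobi_op \<alpha> \<beta> J = smult (- \<mu>) J"
    unfolding J_def \<mu>_def by (rule jacobi_op_shifted_jacobi)
  have proportional: "poly J 0 * poly (Q Y) X = poly (Q Y) 0 * poly J X" for X Y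
  proof -
    have "smult (poly J 0) (Q Y) = smult (poly (Q Y) 0) J"
      using assms(1)
    proof (rule jacobi_op_eigen_unique)
      show "jacobi_op \<alpha> \<beta> (smult (poly J 0) (Q Y)) = smult (- \<mu>) (smult (poly J 0) (Q Y))"
        unfolding jacobi_op_smult eig by (simp only: smult_smult mult.commute)
      show "jacobi_op \<alpha> \<beta> (smult (poly (Q Y) 0) J) = smult (- \<mu>) (smult (poly (Q Y) 0) J)"
        unfolding jacobi_op_smult eigJ by (simp only: smult_smult mult.commute)
    qed simp
    then show ?thesis by (metis poly_smult)
  qed
  have Q01: "poly (Q 1) 0 = 1"
  proof -
    have "poly (Q 1) 0 = (\<Sum>m\<le>M. \<Sum>n\<le>M. if n = 0 then (if m = 0 then 1 else 0) else 0)"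
      unfolding polyQ by (intro sum.cong refl) (auto simp: e_def C_def bailey_coeff_def)
    then show ?thesis by simp
  qed
  have J0: "poly J 0 \<noteq> 0"
    using assms pochhammer_pos[of "\<alpha> + 1" M] by (simp add: J_def poly_shifted_jacobi_0)
  \<comment> \<open>By symmetry \<open>poly (Q X) 0\<close> is itself a multiple of
    \<open>poly J X\<close>; the argument 1 then fixes the constant through
    \<open>Q01\<close>.\<close>
  have a: "poly J 0 * poly (Q X) 0 = poly (Q 0) 0 * poly J X" for X
    using proportional[of 0 X] sym[of X 0] by simp
  from a[of 1] have b: "poly J 0 = poly (Q 0) 0 * poly J 1" by (simp add: Q01)
  have "poly J 0 * (poly J 0 * poly J 1 * poly (Q Y) X) = poly J 1 * poly J X * (poly J 0 * poly (Q Y) 0)"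
    using proportional[of Y X] by (simp add: mult_ac)
  also have "\<dots> = (poly (Q 0) 0 * poly J 1) * (poly J X * poly J Y)"
    unfolding a by simp
  also have "\<dots> = poly J 0 * (poly J X * poly J Y)" unfolding b[symmetric] ..
  finally have "poly J 0 * poly J 1 * poly (Q Y) X = poly J X * poly J Y" using J0 by simp
  then show ?thesis unfolding polyQ e_def C_def J_def by simp
qed

section \<open>The norms of the Jacobi polynomials\<close>

lemma alternating_binomial_sum_Suc:
  fixes f :: "nat \<Rightarrow> real"
  shows "(\<Sum>s\<le>Suc n. (-1) ^ s * real (Suc n choose s) * f s) =
    (\<Sum>s\<le>n. (-1) ^ s * real (n choose s) * (f s - f (Suc s)))"
proof -
  have "(\<Sum>s\<le>Suc n. (-1) ^ s * real (Suc n choose s) * f s) =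
     f 0 + (\<Sum>s\<le>n. (-1) ^ Suc s * (real (n choose s) + real (n choose Suc s)) * f (Suc s))"
    by (subst sum.atMost_Suc_shift) simp
  also have "\<dots> = (f 0 + (\<Sum>s\<le>n. (-1) ^ Suc s * real (n choose Suc s) * f (Suc s)))
     - (\<Sum>s\<le>n. (-1) ^ s * real (n choose s) * f (Suc s))"
    by (simp add: sum.distrib sum_subtractf sum_negf algebra_simps)
  also have "f 0 + (\<Sum>s\<le>n. (-1) ^ Suc s * real (n choose Suc s) * f (Suc s)) =
     (\<Sum>s\<le>Suc n. (-1) ^ s * real (n choose s) * f s)"
    by (subst sum.atMost_Suc_shift) simp
  also have "\<dots> = (\<Sum>s\<le>n. (-1) ^ s * real (n choose s) * f s)" by simp
  finally show ?thesis by (simp add: sum_subtractf algebra_simps)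
qed

text \<open>The alternating sum is an n-th finite difference in s, and
  \<open>pochhammer (real s + a) k\<close> is a polynomial of degree k in s. Each difference lowers
  k by one, so nothing is left for k < n and a signed factorial for k = n. This is the source of the
  orthogonality of the Jacobi polynomials.\<close>

lemma alternating_binomial_sum_pochhammer:
  fixes a :: real
  assumes "k \<le> n"
  shows "(\<Sum>s\<le>n. (-1) ^ s * real (n choose s) * pochhammer (real s + a) k) =
    (if k = n then (-1) ^ n * fact n else 0)"
  using assms
proof (induction n arbitrary: k a)
  case 0
  then show ?case by simp
next
  case (Suc n)
  show ?case
  proof (cases k)
    case 0
    then show ?thesis by (subst alternating_binomial_sum_Suc) simp
  next
    case (Suc j)
    have "pochhammer (real s + a) k - pochhammer (real (Suc s) + a) k
        = - real (Suc j) * pochhammer (real s + (a + 1)) j" for s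
    proof -
      have "pochhammer (real s + a) k = (real s + a) * pochhammer (real s + (a + 1)) j"
        by (simp add: Suc pochhammer_rec add_ac)
      moreover have "pochhammer (real (Suc s) + a) k = (real s + a + 1 + real j) * pochhammer (real s + (a + 1)) j"
        by (simp add: Suc pochhammer_rec' add_ac)
      ultimately show ?thesis by (simp add: algebra_simps)
    qed
    then have "(\<Sum>s\<le>Suc n. (-1) ^ s * real (Suc n choose s) * pochhammer (real s + a) k) =
      - real (Suc j) * (\<Sum>s\<le>n. (-1) ^ s * real (n choose s) * pochhammer (real s + (a + 1)) j)"
      by (subst alternating_binomial_sum_Suc) (simp add: sum_distrib_left mult_ac del: of_nat_Suc)
    also have "\<dots> = (if k = Suc n then (-1) ^ Suc n * fact (Suc n) else 0)"
      using Suc Suc.IH[of j "a + 1"] Suc.prems by (auto simp: algebra_simps)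
    finally show ?thesis .
  qed
qed

lemma Gamma_pochhammer: "Gamma (x + real n) = pochhammer x n * Gamma x" if "x > 0" for x :: real
proof -
  have "x \<notin> \<int>\<^sub>\<le>\<^sub>0" using that by (auto elim!: nonpos_Ints_cases)
  moreover have "Gamma x > 0" using that by simp
  ultimately show ?thesis by (simp add: pochhammer_Gamma)
qed

lemma has_bochner_integral_Beta:
  fixes p q :: real
  assumes "p > -1" "q > -1"
  shows "has_bochner_integral lborel
     (\<lambda>x. indicator {0..1} x * (x ^ m * (1 - x) ^ n * (x powr p * (1 - x) powr q)))
     (Gamma (p + 1 + real m) * Gamma (q + 1 + real n) / Gamma (p + q + 2 + real (m + n)))"
proof -
  define P where "P = p + 1 + real m"
  define R where "R = q + 1 + real n"
  have pos: "P > 0" "R > 0" using assms by (auto simp: P_def R_def)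
  have i: "set_integrable lborel {0..1} (\<lambda>t. t powr (P - 1) * (1 - t) powr (R - 1))"
    using pos by (rule integrable_Beta)
  from has_integral_Beta_real[OF pos] set_borel_integral_eq_integral(2)[OF i]
  have "(LINT t:{0..1}|lborel. t powr (P - 1) * (1 - t) powr (R - 1)) = Beta P R"
    by (simp add: integral_unique)
  with i have "has_bochner_integral lborel (\<lambda>t. indicator {0..1} t * (t powr (P - 1) * (1 - t) powr (R - 1))) (Beta P R)"
    by (simp add: has_bochner_integral_iff set_integrable_def set_lebesgue_integral_def)
  also have "(\<lambda>t. indicator {0..1} t * (t powr (P - 1) * (1 - t) powr (R - 1))) =
     (\<lambda>x. indicator {0..1} x * (x ^ m * (1 - x) ^ n * (x powr p * (1 - x) powr q)))" (is "?f = ?g")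
  proof
    fix x :: real
    have e: "y powr (z + 1 + real j - 1) = y ^ j * y powr z" if "y > 0" for y z :: real and j
      using that by (simp add: powr_add powr_realpow)
    \<comment> \<open>At the endpoints both sides are 0 because \<open>0 powr _\<close> is 0,
      whatever the sign of the exponent.\<close>
    consider "x \<notin> {0..1}" | "x = 0" | "x = 1" | "0 < x" "x < 1" by fastforce
    then show "?f x = ?g x"
    proof cases
      case 4
      then show ?thesis unfolding P_def R_def by (simp only: e diff_gt_0_iff_gt) simp
    qed auto
  qed
  also have "Beta P R = Gamma (p + 1 + real m) * Gamma (q + 1 + real n) / Gamma (p + q + 2 + real (m + n))"
    by (simp add: Beta_def P_def R_def add_ac)
  finally show ?thesis .
qed

text \<open>Each term of Rodrigues' sum becomes a Beta integral whose exponents contribute n + k in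
  total, so the Gamma value in the denominator is the same for all s. The other factors combine to
  binomial coefficients and \<open>pochhammer (real s + (\<alpha> + 1)) k\<close>, that is, to a
  finite difference.\<close>

lemma has_bochner_integral_shifted_jacobi_power:
  fixes \<alpha> \<beta> :: real
  assumes ab: "\<alpha> > -1" "\<beta> > -1" and "k \<le> n"
  shows "has_bochner_integral lborel
     (\<lambda>x. indicator {0..1} x * (poly (shifted_jacobi n \<alpha> \<beta>) x * x ^ k * (x powr \<alpha> * (1 - x) powr \<beta>)))
     (if k = n then (-1) ^ n * Gamma (real n + \<alpha> + 1) * Gamma (real n + \<beta> + 1) / Gamma (2 * real n + \<alpha> + \<beta> + 2) else 0)"
proof -
  define g where "g s = (-1) ^ s * ((\<alpha> + real n) gchoose (n - s)) * ((\<beta> + real n) gchoose s)" for s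
  define K where "K = Gamma (real n + \<alpha> + 1) * Gamma (real n + \<beta> + 1) / (fact n * Gamma (real (n + k) + \<alpha> + \<beta> + 2))"
  have "has_bochner_integral lborel (\<lambda>x. \<Sum>s\<le>n. g s *
       (indicator {0..1} x * (x ^ (s + k) * (1 - x) ^ (n - s) * (x powr \<alpha> * (1 - x) powr \<beta>))))
     (\<Sum>s\<le>n. g s * (Gamma (\<alpha> + 1 + real (s + k)) * Gamma (\<beta> + 1 + real (n - s)) / Gamma (\<alpha> + \<beta> + 2 + real ((s + k) + (n - s)))))"
    using ab by (intro has_bochner_integral_sum has_bochner_integral_mult_right has_bochner_integral_Beta) auto
  also have "(\<lambda>x. \<Sum>s\<le>n. g s *
       (indicator {0..1} x * (x ^ (s + k) * (1 - x) ^ (n - s) * (x powr \<alpha> * (1 - x) powr \<beta>)))) =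
      (\<lambda>x. indicator {0..1} x * (poly (shifted_jacobi n \<alpha> \<beta>) x * x ^ k * (x powr \<alpha> * (1 - x) powr \<beta>)))"
    unfolding shifted_jacobi_def g_def
    by (simp add: poly_sum sum_distrib_left sum_distrib_right power_add mult_ac)
  also have "(\<Sum>s\<le>n. g s * (Gamma (\<alpha> + 1 + real (s + k)) * Gamma (\<beta> + 1 + real (n - s)) / Gamma (\<alpha> + \<beta> + 2 + real ((s + k) + (n - s)))))
     = (\<Sum>s\<le>n. K * ((-1) ^ s * real (n choose s) * pochhammer (real s + (\<alpha> + 1)) k))"
  proof (intro sum.cong refl)
    fix s assume "s \<in> {..n}"
    then have s: "s \<le> n" by simp
    have ga: "(\<alpha> + real n) gchoose (n - s) = Gamma (real n + \<alpha> + 1) / (Gamma (real s + \<alpha> + 1) * fact (n - s))"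
    proof -
      have "Gamma ((real s + \<alpha> + 1) + real (n - s)) = pochhammer (real s + \<alpha> + 1) (n - s) * Gamma (real s + \<alpha> + 1)"
        using ab by (intro Gamma_pochhammer) auto
      moreover have "Gamma (real s + \<alpha> + 1) > 0" using ab by (intro Gamma_real_pos) auto
      ultimately show ?thesis using s
        by (simp add: gbinomial_pochhammer' field_simps of_nat_diff)
    qed
    have gb: "(\<beta> + real n) gchoose s = Gamma (real n + \<beta> + 1) / (Gamma (\<beta> + 1 + real (n - s)) * fact s)"
    proof -
      have "Gamma ((\<beta> + 1 + real (n - s)) + real s) = pochhammer (\<beta> + 1 + real (n - s)) s * Gamma (\<beta> + 1 + real (n - s))"
        using ab by (intro Gamma_pochhammer) auto
      moreover have "Gamma (\<beta> + 1 + real (n - s)) > 0" using ab by (intro Gamma_real_pos) auto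
      ultimately show ?thesis using s
        by (simp add: gbinomial_pochhammer' field_simps of_nat_diff)
    qed
    have gc: "Gamma (\<alpha> + 1 + real (s + k)) = pochhammer (real s + (\<alpha> + 1)) k * Gamma (real s + \<alpha> + 1)"
      using Gamma_pochhammer[of "real s + (\<alpha> + 1)" k] ab by (simp add: add_ac)
    have nz: "Gamma (real s + \<alpha> + 1) \<noteq> 0" "Gamma (\<beta> + 1 + real (n - s)) \<noteq> 0"
      by (rule less_imp_neq[THEN not_sym], rule Gamma_real_pos, use ab in simp)+
    have e: "\<alpha> + \<beta> + 2 + real ((s + k) + (n - s)) = real (n + k) + \<alpha> + \<beta> + 2" using s by simp
    have c: "real (n choose s) = fact n / (fact s * fact (n - s))" using s by (simp add: binomial_fact)
    show "g s * (Gamma (\<alpha> + 1 + real (s + k)) * Gamma (\<beta> + 1 + real (n - s)) / Gamma (\<alpha> + \<beta> + 2 + real ((s + k) + (n - s))))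
       = K * ((-1) ^ s * real (n choose s) * pochhammer (real s + (\<alpha> + 1)) k)"
      unfolding g_def K_def ga gb gc c e using nz by (simp add: mult_ac)
  qed
  also have "\<dots> = K * (if k = n then (-1) ^ n * fact n else 0)"
    unfolding sum_distrib_left[symmetric] alternating_binomial_sum_pochhammer[OF \<open>k \<le> n\<close>] ..
  also have "\<dots> = (if k = n then (-1) ^ n * Gamma (real n + \<alpha> + 1) * Gamma (real n + \<beta> + 1) / Gamma (2 * real n + \<alpha> + \<beta> + 2) else 0)"
    by (simp add: K_def)
  finally show ?thesis .
qed

text \<open>The terminating hypergeometric representation. The recurrence from the eigenvalue
  equation has the factor (k - n) (n + k + \<alpha> + \<beta> + 1), so the coefficients are
  products. They vanish beyond n, and the n-th one enters the norm.\<close>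

lemma coeff_shifted_jacobi:
  assumes "\<alpha> > -1"
  shows "coeff (shifted_jacobi n \<alpha> \<beta>) k =
    pochhammer (\<alpha> + 1) n / fact n * pochhammer (- real n) k * pochhammer (real n + \<alpha> + \<beta> + 1) k / (pochhammer (\<alpha> + 1) k * fact k)"
proof (induction k)
  case 0
  then show ?case by (simp add: poly_0_coeff_0[symmetric] poly_shifted_jacobi_0)
next
  case (Suc k)
  let ?c = "coeff (shifted_jacobi n \<alpha> \<beta>)"
  have "(real k + 1) * (real k + \<alpha> + 1) * ?c (Suc k) =
     (real k * (real k + \<alpha> + \<beta> + 1) - real n * (real n + \<alpha> + \<beta> + 1)) * ?c k"
    using coeff_jacobi_op[of \<alpha> \<beta> "shifted_jacobi n \<alpha> \<beta>" k]
    unfolding jacobi_op_shifted_jacobi by (simp add: algebra_simps)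
  also have "real k * (real k + \<alpha> + \<beta> + 1) - real n * (real n + \<alpha> + \<beta> + 1)
     = (- real n + real k) * (real n + \<alpha> + \<beta> + 1 + real k)" by (simp add: algebra_simps)
  finally have D: "(real k + 1) * (real k + \<alpha> + 1) * ?c (Suc k) =
     (- real n + real k) * (real n + \<alpha> + \<beta> + 1 + real k) * ?c k" .
  have nz: "(real k + 1) * (real k + \<alpha> + 1) \<noteq> 0" using assms by auto
  have "?c (Suc k) = (- real n + real k) * (real n + \<alpha> + \<beta> + 1 + real k) * ?c k / ((real k + 1) * (real k + \<alpha> + 1))"
    using D nz by (metis nonzero_mult_div_cancel_left)
  then show ?case unfolding Suc.IH
    by (simp add: pochhammer_Suc add_ac mult_ac)
qed

lemma degree_shifted_jacobi_le:
  assumes "\<alpha> > -1"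
  shows "degree (shifted_jacobi n \<alpha> \<beta>) \<le> n"
  by (rule degree_le) (simp add: coeff_shifted_jacobi[OF assms] pochhammer_of_nat_eq_0_lemma)

text \<open>One of the two factors is expanded in powers; orthogonality leaves its leading
  coefficient times the n-th moment. The substitution x = 1 - 2 X accounts for the power of 2. The
  Pochhammer symbol is kept because a quotient of Gamma values would meet a pole for n = 0 and
  \<alpha> + \<beta> = -1.\<close>

lemma jacobi_h_eq:
  assumes ab: "\<alpha> > -1" "\<beta> > -1"
  shows "jacobi_h n \<alpha> \<beta> = 2 powr (\<alpha> + \<beta> + 1) * pochhammer (real n + \<alpha> + \<beta> + 1) n *
    Gamma (real n + \<alpha> + 1) * Gamma (real n + \<beta> + 1) / (fact n * Gamma (2 * real n + \<alpha> + \<beta> + 2))"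
proof -
  define J where "J = shifted_jacobi n \<alpha> \<beta>"
  define G where "G = Gamma (real n + \<alpha> + 1) * Gamma (real n + \<beta> + 1) / Gamma (2 * real n + \<alpha> + \<beta> + 2)"
  have lead: "coeff J n = (-1) ^ n * pochhammer (real n + \<alpha> + \<beta> + 1) n / fact n"
    using pochhammer_pos[of "\<alpha> + 1" n] ab
    by (simp add: J_def coeff_shifted_jacobi pochhammer_same)
  have "has_bochner_integral lborel
     (\<lambda>x. \<Sum>k\<le>n. coeff J k * (indicator {0..1} x * (poly J x * x ^ k * (x powr \<alpha> * (1 - x) powr \<beta>))))
     (\<Sum>k\<le>n. coeff J k * (if k = n then (-1) ^ n * Gamma (real n + \<alpha> + 1) * Gamma (real n + \<beta> + 1) / Gamma (2 * real n + \<alpha> + \<beta> + 2) else 0))"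
    unfolding J_def
    by (intro has_bochner_integral_sum has_bochner_integral_mult_right has_bochner_integral_shifted_jacobi_power ab) auto
  also have "(\<Sum>k\<le>n. coeff J k * (if k = n then (-1) ^ n * Gamma (real n + \<alpha> + 1) * Gamma (real n + \<beta> + 1) / Gamma (2 * real n + \<alpha> + \<beta> + 2) else 0))
     = (\<Sum>k\<le>n. if k = n then coeff J n * ((-1) ^ n * G) else 0)"
    by (intro sum.cong refl) (simp add: G_def)
  also have "\<dots> = pochhammer (real n + \<alpha> + \<beta> + 1) n / fact n * G"
    by (simp add: lead)
  also have "(\<lambda>x. \<Sum>k\<le>n. coeff J k * (indicator {0..1} x * (poly J x * x ^ k * (x powr \<alpha> * (1 - x) powr \<beta>))))
     = (\<lambda>x. indicator {0..1} x * ((poly J x)\<^sup>2 * (x powr \<alpha> * (1 - x) powr \<beta>)))"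
  proof
    fix x :: real
    have "poly J x = (\<Sum>k\<le>n. coeff J k * x ^ k)"
      unfolding poly_altdef J_def using degree_shifted_jacobi_le[OF ab(1), of n \<beta>]
      by (intro sum.mono_neutral_left) (auto simp: coeff_eq_0)
    then have "indicator {0..1} x * ((poly J x)\<^sup>2 * (x powr \<alpha> * (1 - x) powr \<beta>)) =
       indicator {0..1} x * (poly J x * (\<Sum>k\<le>n. coeff J k * x ^ k) * (x powr \<alpha> * (1 - x) powr \<beta>))"
      by (simp add: power2_eq_square)
    then show "(\<Sum>k\<le>n. coeff J k * (indicator {0..1} x * (poly J x * x ^ k * (x powr \<alpha> * (1 - x) powr \<beta>)))) =
       indicator {0..1} x * ((poly J x)\<^sup>2 * (x powr \<alpha> * (1 - x) powr \<beta>))"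
      by (simp add: sum_distrib_left sum_distrib_right mult_ac)
  qed
  finally have int: "(\<integral>x. indicator {0..1} x * ((poly J x)\<^sup>2 * (x powr \<alpha> * (1 - x) powr \<beta>)) \<partial>lborel) =
     pochhammer (real n + \<alpha> + \<beta> + 1) n / fact n * G"
    by (rule has_bochner_integral_integral_eq)
  have "jacobi_h n \<alpha> \<beta> = (\<integral>x. indicator {-1..1} x *
        ((poly J ((1 - x) / 2))\<^sup>2 * (1 - x) powr \<alpha> * (1 + x) powr \<beta>) \<partial>lborel)"
    unfolding jacobi_h_def set_lebesgue_integral_def poly_jacobi_poly_eq_shifted J_def by simp
  also have "\<dots> = 2 * (\<integral>x. indicator {-1..1} (1 + (-2) * x) *
        ((poly J ((1 - (1 + (-2) * x)) / 2))\<^sup>2 * (1 - (1 + (-2) * x)) powr \<alpha> * (1 + (1 + (-2) * x)) powr \<beta>) \<partial>lborel)"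
    by (subst lborel_integral_real_affine[of "-2" _ 1]) simp_all
  also have "(\<lambda>x. indicator {-1..1} (1 + (-2) * x) *
        ((poly J ((1 - (1 + (-2) * x)) / 2))\<^sup>2 * (1 - (1 + (-2) * x)) powr \<alpha> * (1 + (1 + (-2) * x)) powr \<beta>))
     = (\<lambda>x. 2 powr (\<alpha> + \<beta>) * (indicator {0..1} x * ((poly J x)\<^sup>2 * (x powr \<alpha> * (1 - x) powr \<beta>))))"
  proof
    fix x :: real
    show "indicator {-1..1} (1 + (-2) * x) *
        ((poly J ((1 - (1 + (-2) * x)) / 2))\<^sup>2 * (1 - (1 + (-2) * x)) powr \<alpha> * (1 + (1 + (-2) * x)) powr \<beta>)
      = 2 powr (\<alpha> + \<beta>) * (indicator {0..1} x * ((poly J x)\<^sup>2 * (x powr \<alpha> * (1 - x) powr \<beta>)))"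
    proof (cases "x \<in> {0..1}")
      case True
      have "(2 - 2 * x) powr \<beta> = 2 powr \<beta> * (1 - x) powr \<beta>"
        using powr_mult[of 2 "1 - x" \<beta>] by (simp add: algebra_simps)
      then show ?thesis using True by (simp add: powr_mult powr_add indicator_def)
    next
      case False
      then show ?thesis by (auto simp: indicator_def)
    qed
  qed
  also have "(\<integral>x. 2 powr (\<alpha> + \<beta>) * (indicator {0..1} x * ((poly J x)\<^sup>2 * (x powr \<alpha> * (1 - x) powr \<beta>))) \<partial>lborel)
     = 2 powr (\<alpha> + \<beta>) * (pochhammer (real n + \<alpha> + \<beta> + 1) n / fact n * G)"
    unfolding integral_mult_right_zero int ..
  finally show ?thesis by (simp add: G_def powr_add)
qed

section \<open>Convergence of the expansion\<close>

lemma shifted_jacobi_0 [simp]: "shifted_jacobi 0 \<alpha> \<beta> = 1"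
  by (simp add: shifted_jacobi_def one_pCons)

text \<open>The maximum of \<open>J\<^sup>2\<close> is controlled by \<open>n (n + \<alpha> + \<beta> + 1) J\<^sup>2 + X (1 - X) J'\<^sup>2\<close>. By the
  differential equation its derivative is \<open>J'\<^sup>2\<close> times an affine function of \<open>X\<close>, which
  goes from nonpositive to nonnegative values when \<open>\<alpha>, \<beta> \<ge> -1/2\<close>.\<close>

lemma shifted_jacobi_square_le:
  assumes ab: "\<alpha> \<ge> -1/2" "\<beta> \<ge> -1/2" and X: "X \<in> {0..1}"
  shows "(poly (shifted_jacobi n \<alpha> \<beta>) X)\<^sup>2 \<le>
    (poly (shifted_jacobi n \<alpha> \<beta>) 0)\<^sup>2 + (poly (shifted_jacobi n \<alpha> \<beta>) 1)\<^sup>2"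
proof (cases "n = 0")
  case True
  then show ?thesis by simp
next
  case False
  define J where "J = shifted_jacobi n \<alpha> \<beta>"
  define K where "K = real n * (real n + \<alpha> + \<beta> + 1)"
  have K: "K > 0" using False ab by (simp add: K_def)
  define f where "f x = K * (poly J x)\<^sup>2 + x * (1 - x) * (poly (pderiv J) x)\<^sup>2" for x
  define l where "l x = (\<alpha> + \<beta> + 1) * x - (\<alpha> + 1/2)" for x
  have ode: "x * (1 - x) * poly (pderiv (pderiv J)) x =
      - K * poly J x - (\<alpha> + 1 - (\<alpha> + \<beta> + 2) * x) * poly (pderiv J) x" for x
    using arg_cong[OF jacobi_op_shifted_jacobi[of \<alpha> \<beta> n], of "\<lambda>p. poly p x"]
    by (simp add: jacobi_op_def J_def K_def algebra_simps)
  have df: "(f has_real_derivative 2 * (poly (pderiv J) x)\<^sup>2 * l x) (at x)" for x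
  proof -
    define p p1 p2 where "p = poly J x" and "p1 = poly (pderiv J) x" and "p2 = poly (pderiv (pderiv J)) x"
    have "(f has_real_derivative (K * (2 * p * p1) + ((1 - 2 * x) * p1\<^sup>2 + x * (1 - x) * (2 * p1 * p2)))) (at x)"
      unfolding f_def p_def p1_def p2_def
      by (auto intro!: derivative_eq_intros simp: algebra_simps)
    also have "K * (2 * p * p1) + ((1 - 2 * x) * p1\<^sup>2 + x * (1 - x) * (2 * p1 * p2)) =
       K * (2 * p * p1) + ((1 - 2 * x) * p1\<^sup>2 + 2 * p1 * (x * (1 - x) * p2))" by simp
    also have "\<dots> = 2 * p1\<^sup>2 * l x"
      unfolding p2_def ode unfolding p_def[symmetric] p1_def[symmetric] l_def
      by (simp add: algebra_simps power2_eq_square)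
    finally show ?thesis by (simp add: p1_def)
  qed
  have l_mono: "l x \<le> l y" if "x \<le> y" for x y
    using that ab unfolding l_def by (intro diff_right_mono mult_left_mono) auto
  have le: "K * (poly J X)\<^sup>2 \<le> f X" using X by (simp add: f_def)
  have "f X \<le> f 1 \<or> f X \<le> f 0"
  proof (cases "l X \<ge> 0")
    case True
    have "f X \<le> f 1"
    proof (rule DERIV_nonneg_imp_nondecreasing[of X 1 f])
      fix x assume "X \<le> x" "x \<le> 1"
      with True l_mono[of X x] have "l x \<ge> 0" by simp
      then show "\<exists>y. (f has_real_derivative y) (at x) \<and> 0 \<le> y" by (intro exI[of _ "2 * (poly (pderiv J) x)\<^sup>2 * l x"] conjI df) simp
    qed (use X in auto)
    then show ?thesis ..
  next
    case False
    have "f X \<le> f 0"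
    proof (rule DERIV_nonpos_imp_nonincreasing[of 0 X f])
      fix x assume "0 \<le> x" "x \<le> X"
      with False l_mono[of x X] have "l x \<le> 0" by simp
      then show "\<exists>y. (f has_real_derivative y) (at x) \<and> y \<le> 0"
        by (intro exI[of _ "2 * (poly (pderiv J) x)\<^sup>2 * l x"] conjI df) (simp add: mult_nonneg_nonpos)
    qed (use X in auto)
    then show ?thesis ..
  qed
  moreover have "f 1 = K * (poly J 1)\<^sup>2" "f 0 = K * (poly J 0)\<^sup>2" by (simp_all add: f_def)
  moreover have "0 \<le> K * (poly J 1)\<^sup>2" "0 \<le> K * (poly J 0)\<^sup>2" using K by simp_all
  ultimately have "K * (poly J X)\<^sup>2 \<le> K * ((poly J 0)\<^sup>2 + (poly J 1)\<^sup>2)"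
    using le by (auto simp: distrib_left)
  then show ?thesis using K by (simp add: J_def)
qed

section \<open>Normalising weights and absolute convergence\<close>

definition jacobi_weight :: "nat \<Rightarrow> real \<Rightarrow> real \<Rightarrow> real" where
  "jacobi_weight n \<alpha> \<beta> = 2 powr (\<alpha> + \<beta> + 1) / jacobi_h n \<alpha> \<beta>"

text \<open>For n = 0 the base is 0 when \<alpha> = \<beta> = -1/2, but then the product is empty;
  for n > 0 the base is positive.\<close>

lemma pochhammer_weight_pos:
  fixes \<alpha> \<beta> :: real
  assumes "\<alpha> \<ge> -1/2" "\<beta> \<ge> -1/2"
  shows "pochhammer (real n + \<alpha> + \<beta> + 1) n > 0"
  by (cases n) (use assms in \<open>auto intro!: pochhammer_pos\<close>)

lemma jacobi_h_pos:
  assumes "\<alpha> \<ge> -1/2" "\<beta> \<ge> -1/2"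
  shows "jacobi_h n \<alpha> \<beta> > 0"
proof -
  have "\<alpha> > -1" "\<beta> > -1" using assms by auto
  then show ?thesis
    using pochhammer_weight_pos[OF assms, of n]
    by (auto simp: jacobi_h_eq intro!: mult_pos_pos divide_pos_pos Gamma_real_pos)
qed

lemma jacobi_weight_pos:
  assumes "\<alpha> \<ge> -1/2" "\<beta> \<ge> -1/2"
  shows "jacobi_weight n \<alpha> \<beta> > 0"
  using jacobi_h_pos[OF assms] by (simp add: jacobi_weight_def)

lemma trig_jacobi_mult:
  assumes "\<alpha> \<ge> -1/2" "\<beta> \<ge> -1/2"
  shows "trig_jacobi n \<alpha> \<beta> \<theta> * trig_jacobi n \<alpha> \<beta> \<phi> = jacobi_weight n \<alpha> \<beta> *
     (poly (shifted_jacobi n \<alpha> \<beta>) ((1 - cos \<theta>) / 2) * poly (shifted_jacobi n \<alpha> \<beta>) ((1 - cos \<phi>) / 2))"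
proof -
  define h where "h = jacobi_h n \<alpha> \<beta>"
  have h: "h > 0" using jacobi_h_pos[OF assms] by (simp add: h_def)
  have "(2 powr ((\<alpha> + \<beta> + 1) / 2) * h powr (- 1 / 2)) * (2 powr ((\<alpha> + \<beta> + 1) / 2) * h powr (- 1 / 2))
      = (2 powr ((\<alpha> + \<beta> + 1) / 2) * 2 powr ((\<alpha> + \<beta> + 1) / 2)) * (h powr (- 1 / 2) * h powr (- 1 / 2))"
    by (simp only: mult_ac)
  also have "\<dots> = jacobi_weight n \<alpha> \<beta>"
    unfolding powr_add[symmetric] jacobi_weight_def h_def[symmetric]
    using h field_sum_of_halves[of "\<alpha> + \<beta> + 1"] by (simp add: powr_minus divide_inverse[symmetric])
  finally show ?thesis
    unfolding trig_jacobi_def poly_jacobi_poly_eq_shifted h_def[symmetric] by (simp add: mult_ac)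
qed

lemma jacobi_weight_eq:
  assumes "\<alpha> > -1" "\<beta> > -1"
  shows "jacobi_weight n \<alpha> \<beta> = fact n * Gamma (2 * real n + \<alpha> + \<beta> + 2) /
    (pochhammer (real n + \<alpha> + \<beta> + 1) n * (pochhammer (\<alpha> + 1) n * Gamma (\<alpha> + 1)) * (pochhammer (\<beta> + 1) n * Gamma (\<beta> + 1)))"
  using Gamma_pochhammer[of "\<alpha> + 1" n] Gamma_pochhammer[of "\<beta> + 1" n] assms
  by (simp add: jacobi_weight_def jacobi_h_eq add_ac)

lemma tendsto_affine_ratio: "(\<lambda>n. (real n + a) / (real n + b)) \<longlonglongrightarrow> 1"
proof -
  have 1: "filterlim (\<lambda>n. real n + b) at_infinity sequentially"
    by (intro filterlim_at_top_imp_at_infinity filterlim_tendsto_add_at_top[OF tendsto_const, of _ _ b, unfolded add.commute[of b]]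
          filterlim_real_sequentially)
  then have "(\<lambda>n. 1 + (a - b) / (real n + b)) \<longlonglongrightarrow> 1 + 0"
    by (intro tendsto_add tendsto_const tendsto_divide_0[OF tendsto_const])
  moreover have "eventually (\<lambda>n. 1 + (a - b) / (real n + b) = (real n + a) / (real n + b)) sequentially"
    using filterlim_at_infinity_imp_eventually_ne[OF 1, of 0]
    by eventually_elim (simp add: field_simps)
  ultimately show ?thesis by (simp add: tendsto_cong)
qed

text \<open>Ratio test: consecutive terms have quotient r times factors (n + a) / (n + b) that tend
  to 1, and (1 + r) / 2 separates the limit r from 1. The closed form of \<open>t n\<close> is
  restricted to n > 0, where n + \<alpha> + \<beta> + 1 is positive and Gamma avoids its pole at
  0.\<close>

lemma summable_jacobi_weight_0:
  assumes ab: "\<alpha> \<ge> -1/2" "\<beta> \<ge> -1/2" and r: "0 \<le> r" "r < 1"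
  shows "summable (\<lambda>n. jacobi_weight n \<alpha> \<beta> * (poly (shifted_jacobi n \<alpha> \<beta>) 0)\<^sup>2 * r ^ n)"
proof -
  define lam where "lam = \<alpha> + \<beta> + 1"
  have lam_nonneg: "lam \<ge> 0" using ab by (simp add: lam_def)
  define q where "q n = (real n + (1 + lam/2)) / (real n + lam/2) * ((real n + lam) / (real n + 1)) *
     ((real n + (\<alpha> + 1)) / (real n + (\<beta> + 1)))" for n
  define t where "t n = jacobi_weight n \<alpha> \<beta> * (poly (shifted_jacobi n \<alpha> \<beta>) 0)\<^sup>2" for n
  define g where "g = Gamma (\<alpha> + 1) * Gamma (\<beta> + 1)"
  have g: "g > 0" using ab by (auto simp: g_def)
  have tpos: "t n \<ge> 0" for n using jacobi_weight_pos[OF ab, of n] by (simp add: t_def)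
  have t: "t n = (2 * real n + lam) * Gamma (real n + lam) * pochhammer (\<alpha> + 1) n / (fact n * pochhammer (\<beta> + 1) n * g)"
    if "n > 0" for n
  proof -
    have p: "pochhammer (\<alpha> + 1) n > 0" "pochhammer (\<beta> + 1) n > 0" "pochhammer (real n + lam) n > 0"
      using ab pochhammer_weight_pos[OF ab, of n] by (auto intro!: pochhammer_pos simp: lam_def add_ac)
    have n: "real n + lam > 0" using that lam_nonneg by simp
    have "Gamma (2 * real n + \<alpha> + \<beta> + 2) = (2 * real n + lam) * Gamma ((real n + lam) + real n)"
      using Gamma_pochhammer[of "2 * real n + lam" 1] n that by (simp add: lam_def add_ac)
    also have "\<dots> = (2 * real n + lam) * (pochhammer (real n + lam) n * Gamma (real n + lam))"
      unfolding Gamma_pochhammer[OF n] ..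
    finally have G: "Gamma (2 * real n + \<alpha> + \<beta> + 2) = (2 * real n + lam) * (pochhammer (real n + lam) n * Gamma (real n + lam))" .
    have e: "real n + \<alpha> + \<beta> + 1 = real n + lam" by (simp add: lam_def)
    have ab': "\<alpha> > -1" "\<beta> > -1" using ab by auto
    have alg: "F * (s * (P * G)) / (P * (A * u) * (B * v)) * (A / F)\<^sup>2 = s * G * A / (F * B * (u * v))"
      if "F > 0" "P > 0" "A > 0" "B > 0" "u > 0" "v > 0" for F s P G A B u v :: real
      using that by (simp add: power2_eq_square field_simps)
    show ?thesis
      unfolding t_def jacobi_weight_eq[OF ab'] poly_shifted_jacobi_0 G e
      unfolding g_def by (rule alg) (use p ab Gamma_real_pos[of "\<alpha> + 1"] Gamma_real_pos[of "\<beta> + 1"] in auto)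
  qed
  have tSuc: "t (Suc n) = q n * t n" if "n > 0" for n
  proof -
    have n: "real n + lam > 0" using that lam_nonneg by simp
    have p: "pochhammer (\<beta> + 1) n > 0" "real n + (\<beta> + 1) > 0" "real n + lam/2 > 0"
      using ab lam_nonneg that by (auto intro!: pochhammer_pos)
    have G: "Gamma (real (Suc n) + lam) = (real n + lam) * Gamma (real n + lam)"
      using Gamma_pochhammer[OF n, of 1] by (simp add: add_ac)
    have 2: "2 * real (Suc n) + lam = 2 * (real n + (1 + lam/2))" "2 * real n + lam = 2 * (real n + lam/2)" by simp_all
    show ?thesis
      unfolding t[OF that] t[OF zero_less_Suc] G pochhammer_Suc fact_Suc q_def 2
      using p g by (simp add: divide_simps) (simp add: algebra_simps)
  qed
  show ?thesis
  proof (cases "r = 0")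
    case True
    then show ?thesis by simp
  next
    case False
    with r have r0: "r > 0" by simp
    have "(\<lambda>n. q n * r) \<longlonglongrightarrow> (1 * 1 * 1) * r"
      unfolding q_def by (intro tendsto_intros tendsto_affine_ratio)
    then have "eventually (\<lambda>n. q n * r < (1 + r) / 2) sequentially"
      using r by (intro order_tendstoD(2)) auto
    then obtain N where N: "\<And>n. n \<ge> N \<Longrightarrow> q n * r < (1 + r) / 2"
      unfolding eventually_sequentially by blast
    have "summable (\<lambda>n. t n * r ^ n)"
    proof (rule summable_ratio_test[of "(1 + r) / 2" "max N 1"])
      fix n assume n: "max N 1 \<le> n"
      then have "t (Suc n) * r ^ Suc n = (q n * r) * (t n * r ^ n)" using tSuc[of n] by simp
      also have "\<dots> \<le> (1 + r) / 2 * (t n * r ^ n)"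
        using N[of n] n tpos[of n] r by (intro mult_right_mono) auto
      finally show "norm (t (Suc n) * r ^ Suc n) \<le> (1 + r) / 2 * norm (t n * r ^ n)"
        using tpos r by simp
    qed (use r in auto)
    then show ?thesis by (simp add: t_def)
  qed
qed

lemma jacobi_weight_commute:
  assumes "\<alpha> > -1" "\<beta> > -1"
  shows "jacobi_weight n \<alpha> \<beta> = jacobi_weight n \<beta> \<alpha>"
  using assms by (simp add: jacobi_weight_eq add_ac mult_ac)

text \<open>A product of two values is at most the mean of their squares, hence bounded by the
  squares at the two endpoints. The value at 1 is, up to sign, the value at 0 with \<alpha> and
  \<beta> exchanged, so one ratio test covers both.\<close>

lemma summable_jacobi_weight:
  assumes ab: "\<alpha> \<ge> -1/2" "\<beta> \<ge> -1/2" and X: "X \<in> {0..1}" and Y: "Y \<in> {0..1}" and r: "0 \<le> r" "r < 1"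
  shows "summable (\<lambda>n. \<bar>jacobi_weight n \<alpha> \<beta> *
    (poly (shifted_jacobi n \<alpha> \<beta>) X * poly (shifted_jacobi n \<alpha> \<beta>) Y)\<bar> * r ^ n)"
proof (rule summable_comparison_test'[where N = 0])
  have ab': "\<alpha> > -1" "\<beta> > -1" using ab by auto
  show "summable (\<lambda>n. jacobi_weight n \<alpha> \<beta> * (poly (shifted_jacobi n \<alpha> \<beta>) 0)\<^sup>2 * r ^ n +
     jacobi_weight n \<beta> \<alpha> * (poly (shifted_jacobi n \<beta> \<alpha>) 0)\<^sup>2 * r ^ n)"
    using ab r by (intro summable_add summable_jacobi_weight_0)
  fix n
  have "\<bar>poly (shifted_jacobi n \<alpha> \<beta>) X * poly (shifted_jacobi n \<alpha> \<beta>) Y\<bar> \<le>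
     ((poly (shifted_jacobi n \<alpha> \<beta>) X)\<^sup>2 + (poly (shifted_jacobi n \<alpha> \<beta>) Y)\<^sup>2) / 2"
    using sum_squares_bound[of "\<bar>poly (shifted_jacobi n \<alpha> \<beta>) X\<bar>" "\<bar>poly (shifted_jacobi n \<alpha> \<beta>) Y\<bar>"]
    by (simp add: abs_mult)
  also have "\<dots> \<le> (poly (shifted_jacobi n \<alpha> \<beta>) 0)\<^sup>2 + (poly (shifted_jacobi n \<alpha> \<beta>) 1)\<^sup>2"
    using shifted_jacobi_square_le[OF ab X, of n] shifted_jacobi_square_le[OF ab Y, of n] by simp
  also have "(poly (shifted_jacobi n \<alpha> \<beta>) 1)\<^sup>2 = (poly (shifted_jacobi n \<beta> \<alpha>) 0)\<^sup>2"
    by (simp add: poly_shifted_jacobi_0 poly_shifted_jacobi_1 power_mult_distrib power_divide flip: power_mult)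
  finally have "jacobi_weight n \<alpha> \<beta> * \<bar>poly (shifted_jacobi n \<alpha> \<beta>) X * poly (shifted_jacobi n \<alpha> \<beta>) Y\<bar> * r ^ n \<le>
    jacobi_weight n \<alpha> \<beta> * ((poly (shifted_jacobi n \<alpha> \<beta>) 0)\<^sup>2 + (poly (shifted_jacobi n \<beta> \<alpha>) 0)\<^sup>2) * r ^ n"
    using jacobi_weight_pos[OF ab, of n] r by (intro mult_right_mono mult_left_mono) auto
  then show "norm (\<bar>jacobi_weight n \<alpha> \<beta> * (poly (shifted_jacobi n \<alpha> \<beta>) X * poly (shifted_jacobi n \<alpha> \<beta>) Y)\<bar> * r ^ n)
    \<le> jacobi_weight n \<alpha> \<beta> * (poly (shifted_jacobi n \<alpha> \<beta>) 0)\<^sup>2 * r ^ n +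
     jacobi_weight n \<beta> \<alpha> * (poly (shifted_jacobi n \<beta> \<alpha>) 0)\<^sup>2 * r ^ n"
    unfolding jacobi_weight_commute[OF ab', of n, symmetric]
    using jacobi_weight_pos[OF ab, of n] r by (simp add: abs_mult algebra_simps)
qed

section \<open>The expansion in powers of the time variable\<close>

text \<open>The coefficients of \<open>(1 - r) (1 + r) powr - \<nu>\<close> as a power series in \<open>r\<close>.\<close>

definition poisson_binomial :: "real \<Rightarrow> nat \<Rightarrow> real" where
  "poisson_binomial \<nu> j = (- \<nu> gchoose j) - (if j = 0 then 0 else (- \<nu> gchoose (j - 1)))"

text \<open>This is what makes the sum over M tractable. The left-hand side is the M-dependent part
  of the weight and the endpoint values times the numerators of Bailey's sum; for fixed N = m + n it
  depends on M only through a power series coefficient of index M - N.\<close>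

lemma poisson_binomial_Gamma:
  fixes lam :: real
  assumes "lam \<ge> 0" "N \<le> M"
  shows "(-1) ^ M * Gamma (2 * real M + lam + 1) / (pochhammer (real M + lam) M * fact M) *
     (pochhammer (- real M) N * pochhammer (real M + lam) N) =
    Gamma (2 * real N + lam + 1) * poisson_binomial (2 * real N + lam + 1) (M - N)"
proof (cases "M = 0")
  case True
  then show ?thesis using assms by (simp add: poisson_binomial_def)
next
  case False
  define j where "j = M - N"
  have M: "M = N + j" using assms by (simp add: j_def)
  define \<nu> where "\<nu> = 2 * real N + lam + 1"
  have nu: "\<nu> > 0" using assms by (simp add: \<nu>_def)
  define A where "A = pochhammer (real M + lam) N"
  define B where "B = pochhammer (real M + real N + lam) j"
  have Mlam: "real M + lam > 0" using False assms by simp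
  have AB: "A > 0" "B > 0" unfolding A_def B_def using Mlam by (auto intro!: pochhammer_pos)
  have p1: "pochhammer (real M + lam) M = A * B"
    unfolding A_def B_def by (subst M(1)) (simp add: pochhammer_product' add_ac M)
  have p2: "pochhammer (- real M) N = (-1) ^ N * (fact M / fact j)"
  proof -
    have "fact M = pochhammer (1::real) (j + N)" by (simp add: M pochhammer_fact add.commute)
    also have "\<dots> = fact j * pochhammer (1 + real j) N"
      unfolding pochhammer_product' by (simp add: pochhammer_fact)
    finally show ?thesis using pochhammer_minus[of "real M" N] by (simp add: M add_ac)
  qed
  have G: "Gamma (2 * real M + lam + 1) = pochhammer \<nu> (2 * j) * Gamma \<nu>"
    using Gamma_pochhammer[OF nu, of "2 * j"] by (simp add: \<nu>_def M algebra_simps)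
  have sgn: "(-1::real) ^ M * (-1) ^ N = (-1) ^ j" by (simp add: M power_add)
  have "(-1) ^ M * Gamma (2 * real M + lam + 1) / (pochhammer (real M + lam) M * fact M) *
     (pochhammer (- real M) N * pochhammer (real M + lam) N) =
     ((-1) ^ M * (-1) ^ N) * (pochhammer \<nu> (2 * j) * Gamma \<nu>) / (B * fact j)"
    unfolding p1 p2 G A_def[symmetric] using AB by (simp add: field_simps)
  also have "\<dots> = Gamma \<nu> * ((-1) ^ j * pochhammer \<nu> (2 * j) / (B * fact j))"
    unfolding sgn by simp
  also have "(-1) ^ j * pochhammer \<nu> (2 * j) / (B * fact j) = poisson_binomial \<nu> j"
  proof (cases j)
    case 0
    then show ?thesis by (simp add: poisson_binomial_def B_def)
  next
    case (Suc i)
    \<comment> \<open>The middle j factors of this split are exactly \<open>B\<close>, since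
      \<open>\<nu> + real i = real M + real N + lam\<close>. The last factor \<nu> + i + j, split as
      (\<nu> + i) + j, yields the two binomial coefficients of
      \<open>poisson_binomial\<close>.\<close>
    have "pochhammer \<nu> (2 * j) = pochhammer \<nu> (i + Suc j)" using Suc by (simp add: mult_2)
    also have "\<dots> = pochhammer \<nu> i * (pochhammer (\<nu> + real i) j * (\<nu> + real i + real j))"
      unfolding pochhammer_product' pochhammer_Suc ..
    also have "\<nu> + real i = real M + real N + lam" by (simp add: M \<nu>_def Suc)
    finally have e: "pochhammer \<nu> (2 * j) = pochhammer \<nu> i * (B * (\<nu> + real i + real j))"
      unfolding B_def by (simp add: M \<nu>_def Suc)
    have "(-1) ^ j * pochhammer \<nu> (2 * j) / (B * fact j) = (-1) ^ j * pochhammer \<nu> i * (\<nu> + real i + real j) / fact j"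
      unfolding e using AB by simp
    also have "\<dots> = (-1) ^ j * (pochhammer \<nu> i * (\<nu> + real i)) / fact j - (-1) ^ i * pochhammer \<nu> i / fact i"
      unfolding Suc by (simp add: divide_simps) (simp add: algebra_simps)
    also have "\<dots> = poisson_binomial \<nu> j"
      unfolding poisson_binomial_def Suc by (simp add: gbinomial_pochhammer pochhammer_Suc)
    finally show ?thesis .
  qed
  finally show ?thesis by (simp add: \<nu>_def j_def)
qed

text \<open>The N-th term of the Cauchy product of two Bessel-type series, one in U with \<alpha>
  and one in V with \<beta>. The grouping by N = m + n fits Bailey's sum, whose remaining factors
  depend on m and n only through m + n.\<close>

definition bessel_product_coeff :: "real \<Rightarrow> real \<Rightarrow> real \<Rightarrow> real \<Rightarrow> nat \<Rightarrow> real" where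
  "bessel_product_coeff \<alpha> \<beta> U V N =
    (\<Sum>m\<le>N. (U ^ m / (fact m * Gamma (\<alpha> + 1 + real m))) * (V ^ (N - m) / (fact (N - m) * Gamma (\<beta> + 1 + real (N - m)))))"

text \<open>Bailey's sum is reordered by total degree, after the square of indices is cut down to
  the triangle outside of which the numerators vanish. The Gamma values at \<alpha> + 1 and \<beta>
  + 1 in the weight turn the Pochhammer denominators into Gamma denominators.\<close>

lemma jacobi_weight_mult_shifted_jacobi:
  assumes ab: "\<alpha> \<ge> -1/2" "\<beta> \<ge> -1/2"
  shows "jacobi_weight M \<alpha> \<beta> * (poly (shifted_jacobi M \<alpha> \<beta>) X * poly (shifted_jacobi M \<alpha> \<beta>) Y) =
    (\<Sum>N\<le>M. Gamma (2 * real N + \<alpha> + \<beta> + 2) * poisson_binomial (2 * real N + \<alpha> + \<beta> + 2) (M - N) *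
       bessel_product_coeff \<alpha> \<beta> (X * Y) ((1 - X) * (1 - Y)) N)"
proof -
  define lam where "lam = \<alpha> + \<beta> + 1"
  have lam: "lam \<ge> 0" using ab by (simp add: lam_def)
  have ab': "\<alpha> > -1" "\<beta> > -1" using ab by auto
  define U V where "U = X * Y" and "V = (1 - X) * (1 - Y)"
  define gg where "gg = Gamma (\<alpha> + 1) * Gamma (\<beta> + 1)"
  define e where "e N = (-1) ^ M * Gamma (2 * real M + lam + 1) / (pochhammer (real M + lam) M * fact M) *
     (pochhammer (- real M) N * pochhammer (real M + lam) N)" for N
  define t where "t m n = (U ^ m / (fact m * Gamma (\<alpha> + 1 + real m))) * (V ^ n / (fact n * Gamma (\<beta> + 1 + real n)))" for m n
  have e0: "e N = 0" if "N > M" for N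
    using that by (simp add: e_def pochhammer_of_nat_eq_0_lemma)
  have pos: "pochhammer (\<alpha> + 1) n > 0" "pochhammer (\<beta> + 1) n > 0" for n
    using ab' by (auto intro!: pochhammer_pos)
  have posG: "Gamma (\<alpha> + 1) > 0" "Gamma (\<beta> + 1) > 0" using ab' by auto
  have t: "bailey_coeff \<alpha> \<beta> m n * (U ^ m * V ^ n) = gg * t m n" for m n
    using Gamma_pochhammer[of "\<alpha> + 1" m] Gamma_pochhammer[of "\<beta> + 1" n] ab' posG[THEN less_imp_neq, THEN not_sym]
    by (simp add: bailey_coeff_def t_def gg_def)
  have w: "jacobi_weight M \<alpha> \<beta> * (poly (shifted_jacobi M \<alpha> \<beta>) 0 * poly (shifted_jacobi M \<alpha> \<beta>) 1)
     = (-1) ^ M * Gamma (2 * real M + lam + 1) / (pochhammer (real M + lam) M * fact M) / gg"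
  proof -
    have alg: "F * G / (P * (A * u) * (B * v)) * (A / F * (s * B / F)) = s * G / (P * F) / (u * v)"
      if "F > 0" "P > 0" "A > 0" "B > 0" "u > 0" "v > 0" for F s P G A B u v :: real
      using that by (simp add: field_simps)
    have l: "2 * real M + lam + 1 = 2 * real M + \<alpha> + \<beta> + 2" "real M + lam = real M + \<alpha> + \<beta> + 1"
      by (simp_all add: lam_def)
    show ?thesis
      unfolding jacobi_weight_eq[OF ab'] poly_shifted_jacobi_0 poly_shifted_jacobi_1 gg_def l
      by (rule alg) (use pos posG pochhammer_weight_pos[OF ab, of M] in auto)
  qed
  have gg: "gg > 0" using posG by (simp add: gg_def)
  have "jacobi_weight M \<alpha> \<beta> * (poly (shifted_jacobi M \<alpha> \<beta>) X * poly (shifted_jacobi M \<alpha> \<beta>) Y) =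
    (jacobi_weight M \<alpha> \<beta> * (poly (shifted_jacobi M \<alpha> \<beta>) 0 * poly (shifted_jacobi M \<alpha> \<beta>) 1)) *
    (\<Sum>m\<le>M. \<Sum>n\<le>M. pochhammer (- real M) (m + n) * pochhammer (real M + lam) (m + n) * (gg * t m n))"
    unfolding shifted_jacobi_product[OF ab', of M X Y] t[symmetric] U_def V_def
    by (simp add: lam_def mult_ac add_ac)
  also have "\<dots> = (\<Sum>m\<le>M. \<Sum>n\<le>M. e (m + n) * t m n)"
    unfolding w e_def sum_distrib_left using gg by (intro sum.cong refl) simp
  also have "\<dots> = (\<Sum>(m,n)\<in>{..M}\<times>{..M}. e (m + n) * t m n)"
    by (simp add: sum.cartesian_product)
  also have "\<dots> = (\<Sum>(m,n)\<in>{(m,n). m + n \<le> M}. e (m + n) * t m n)"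
    by (rule sum.mono_neutral_right) (auto intro!: e0)
  also have "\<dots> = (\<Sum>N\<le>M. \<Sum>m\<le>N. e N * t m (N - m))"
    unfolding sum.triangle_reindex_eq by (intro sum.cong refl) simp
  also have "\<dots> = (\<Sum>N\<le>M. e N * bessel_product_coeff \<alpha> \<beta> U V N)"
    by (simp add: bessel_product_coeff_def t_def sum_distrib_left)
  also have "\<dots> = (\<Sum>N\<le>M. Gamma (2 * real N + lam + 1) * poisson_binomial (2 * real N + lam + 1) (M - N) * bessel_product_coeff \<alpha> \<beta> U V N)"
    unfolding e_def using lam by (intro sum.cong refl, subst poisson_binomial_Gamma) auto
  finally show ?thesis by (simp add: lam_def U_def V_def add_ac)
qed

lemma bessel_product_coeff_nonneg:
  assumes "\<alpha> > -1" "\<beta> > -1" "U \<ge> 0" "V \<ge> 0"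
  shows "bessel_product_coeff \<alpha> \<beta> U V N \<ge> 0"
  unfolding bessel_product_coeff_def
  by (intro sum_nonneg mult_nonneg_nonneg divide_nonneg_nonneg zero_le_power assms fact_ge_zero Gamma_real_nonneg)
     (use assms in auto)

section \<open>Bounds for modified Bessel functions\<close>

definition bessel_coeff :: "real \<Rightarrow> nat \<Rightarrow> real" where
  "bessel_coeff \<alpha> m = 1 / (4 ^ m * fact m * Gamma (\<alpha> + 1 + real m))"

text \<open>\<open>bessel_series \<alpha> z\<close> is \<open>(z/2) powr -\<alpha>\<close> times the modified Bessel function of the first kind of order \<open>\<alpha>\<close>.\<close>

definition bessel_series :: "real \<Rightarrow> real \<Rightarrow> real" where
  "bessel_series \<alpha> z = (\<Sum>m. bessel_coeff \<alpha> m * z ^ (2 * m))"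

text \<open>Euler's limit for the Gamma function makes the quotient of the two sides converge to a
  positive number; being positive throughout, it is bounded above and away from 0. The parameter 1/2
  belongs to \<alpha> = -1/2, where the Bessel series is a multiple of cosh.\<close>

lemma pochhammer_ratio_bounds:
  fixes a :: real
  assumes "a \<ge> 0"
  obtains K where "K > 0"
    "\<And>m. pochhammer (1/2) m * (2 * real m + 1) powr a \<le> K * pochhammer (1/2 + a) m"
    "\<And>m. pochhammer (1/2 + a) m \<le> K * (pochhammer (1/2) m * (2 * real m + 1) powr a)"
proof -
  define s where "s m = pochhammer (1/2) m * (2 * real m + 1) powr a / pochhammer (1/2 + a) m" for m
  have spos: "s m > 0" for m
    using assms by (auto simp: s_def intro!: mult_pos_pos divide_pos_pos pochhammer_pos)
  have "(\<lambda>m. Gamma_series (1/2 + a) m / Gamma_series (1/2) m * ((2 + 3 / real m) powr a))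
     \<longlonglongrightarrow> Gamma (1/2 + a) / Gamma (1/2) * ((2 + 0) powr a)"
    using assms Gamma_one_half_real
    by (intro tendsto_intros Gamma_series_LIMSEQ lim_const_over_n) auto
  moreover have "eventually (\<lambda>m. Gamma_series (1/2 + a) m / Gamma_series (1/2) m * ((2 + 3 / real m) powr a) = s (Suc m)) sequentially"
    using eventually_gt_at_top[of 0]
  proof eventually_elim
    case (elim m)
    have p: "pochhammer (1/2 + a) (Suc m) > 0" "pochhammer (1/2::real) (Suc m) > 0"
      using assms by (intro pochhammer_pos; simp)+
    have "2 * real (Suc m) + 1 = real m * (2 + 3 / real m)" using elim by (simp add: field_simps)
    then have "(2 * real (Suc m) + 1) powr a = real m powr a * (2 + 3 / real m) powr a"
      using elim by (simp add: powr_mult)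
    moreover have "exp ((1/2 + a) * ln (real m)) = exp (1/2 * ln (real m)) * real m powr a"
      using elim by (simp add: powr_def exp_add[symmetric] algebra_simps)
    ultimately show ?case using p
      by (simp add: s_def Gamma_series_def field_simps)
  qed
  ultimately have "(\<lambda>m. s (Suc m)) \<longlonglongrightarrow> Gamma (1/2 + a) / Gamma (1/2) * (2 powr a)"
    by (simp add: tendsto_cong)
  then have lim: "s \<longlonglongrightarrow> Gamma (1/2 + a) / Gamma (1/2) * (2 powr a)" (is "_ \<longlonglongrightarrow> ?l")
    by (rule LIMSEQ_imp_Suc)
  have l: "?l > 0" using assms by (intro mult_pos_pos divide_pos_pos Gamma_real_pos) auto
  have "Bseq s" using lim by (intro convergent_imp_Bseq convergentI)
  then obtain K1 where K1: "K1 > 0" "\<And>m. norm (s m) \<le> K1" by (auto elim: BseqE)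
  have "Bseq (\<lambda>m. inverse (s m))"
    by (rule convergent_imp_Bseq, rule convergentI, rule tendsto_inverse[OF lim]) (use l in linarith)
  then obtain K2 where K2: "K2 > 0" "\<And>m. norm (inverse (s m)) \<le> K2" by (auto elim: BseqE)
  show ?thesis
  proof (rule that[of "max K1 K2"])
    show "max K1 K2 > 0" using K1 by simp
    fix m
    have p: "pochhammer (1/2 + a) m > 0" "pochhammer (1/2::real) m * (2 * real m + 1) powr a > 0"
      using assms by (auto intro!: pochhammer_pos mult_pos_pos)
    have "s m \<le> max K1 K2" using K1(2)[of m] by auto
    then show "pochhammer (1/2) m * (2 * real m + 1) powr a \<le> max K1 K2 * pochhammer (1/2 + a) m"
      using p by (simp add: s_def pos_divide_le_eq)
    have "inverse (s m) \<le> max K1 K2" using K2(2)[of m] spos[of m] by auto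
    then show "pochhammer (1/2 + a) m \<le> max K1 K2 * (pochhammer (1/2) m * (2 * real m + 1) powr a)"
      using p by (simp add: s_def pos_divide_le_eq)
  qed
qed

text \<open>The duplication formula turns \<open>4 ^ m * fact m * pochhammer (1/2) m\<close> into
  \<open>fact (2 * m)\<close>, so the coefficients are compared with those of cosh. Here and in
  later lemmas two constants are added so that one constant serves both directions.\<close>

lemma bessel_coeff_bounds:
  assumes "\<alpha> \<ge> -1/2"
  obtains K where "K > 0"
    "\<And>m. bessel_coeff \<alpha> m \<le> K * ((2 * real m + 1) powr - (\<alpha> + 1/2) / fact (2 * m))"
    "\<And>m. (2 * real m + 1) powr - (\<alpha> + 1/2) / fact (2 * m) \<le> K * bessel_coeff \<alpha> m"
proof -
  define a where "a = \<alpha> + 1/2"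
  have a: "a \<ge> 0" using assms by (simp add: a_def)
  obtain K where K: "K > 0"
    "\<And>m. pochhammer (1/2) m * (2 * real m + 1) powr a \<le> K * pochhammer (1/2 + a) m"
    "\<And>m. pochhammer (1/2 + a) m \<le> K * (pochhammer (1/2) m * (2 * real m + 1) powr a)"
    using pochhammer_ratio_bounds[OF a] by blast
  define g where "g = Gamma (\<alpha> + 1)"
  have g: "g > 0" using assms by (simp add: g_def)
  have *: "bessel_coeff \<alpha> m = 1 / (4 ^ m * fact m * (pochhammer (1/2 + a) m * g))"
    "(2 * real m + 1) powr - (\<alpha> + 1/2) / fact (2 * m) = 1 / (4 ^ m * fact m * (pochhammer (1/2) m * (2 * real m + 1) powr a))" for m
  proof -
    have e: "1/2 + a = \<alpha> + 1" "\<alpha> + 1/2 = a" "(2::real) ^ (2 * m) = 4 ^ m"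
      by (simp_all add: a_def power_mult)
    show "bessel_coeff \<alpha> m = 1 / (4 ^ m * fact m * (pochhammer (1/2 + a) m * g))"
      unfolding e bessel_coeff_def g_def using Gamma_pochhammer[of "\<alpha> + 1" m] assms by simp
    show "(2 * real m + 1) powr - (\<alpha> + 1/2) / fact (2 * m) = 1 / (4 ^ m * fact m * (pochhammer (1/2) m * (2 * real m + 1) powr a))"
      unfolding e fact_double by (simp add: powr_minus field_simps)
  qed
  show ?thesis
  proof (rule that[of "K / g + K * g"])
    show "K / g + K * g > 0" using K(1) g by (simp add: add_pos_pos)
    fix m
    define p q where "p = pochhammer (1/2 + a) m" and "q = pochhammer (1/2) m * (2 * real m + 1) powr a"
    have pq: "p > 0" "q > 0" using a by (auto simp: p_def q_def intro!: pochhammer_pos mult_pos_pos)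
    have le: "q \<le> K * p" "p \<le> K * q" using K(2,3)[of m] by (auto simp: p_def q_def)
    have f: "(4::real) ^ m * fact m > 0" by simp
    have "1 / (4 ^ m * fact m * (p * g)) \<le> K / g * (1 / (4 ^ m * fact m * q))"
      using le(1) pq g f K(1) by (simp add: field_simps)
    also have "\<dots> \<le> (K / g + K * g) * (1 / (4 ^ m * fact m * q))"
      using pq g f K(1) by (intro mult_right_mono) auto
    finally show "bessel_coeff \<alpha> m \<le> (K / g + K * g) * ((2 * real m + 1) powr - (\<alpha> + 1/2) / fact (2 * m))"
      unfolding * p_def q_def .
    have "1 / (4 ^ m * fact m * q) \<le> K * g * (1 / (4 ^ m * fact m * (p * g)))"
      using le(2) pq g f K(1) by (simp add: field_simps)
    also have "\<dots> \<le> (K / g + K * g) * (1 / (4 ^ m * fact m * (p * g)))"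
      using pq g f K(1) by (intro mult_right_mono) auto
    finally show "(2 * real m + 1) powr - (\<alpha> + 1/2) / fact (2 * m) \<le> (K / g + K * g) * bessel_coeff \<alpha> m"
      unfolding * p_def q_def .
  qed
qed

section \<open>Even power series weighted by powers of 2 m + 1\<close>

lemma cosh_even_series: "(\<lambda>m. z ^ (2 * m) / fact (2 * m)) sums cosh z" for z :: real
proof -
  have "(\<lambda>n. if even n then z ^ n /\<^sub>R fact n else 0) sums cosh z" by (rule cosh_converges)
  then have "(\<lambda>m. (\<lambda>n. if even n then z ^ n /\<^sub>R fact n else 0) (2 * m)) sums cosh z"
    by (subst sums_mono_reindex) (auto simp: strict_mono_def elim!: evenE)
  then show ?thesis by (simp add: divide_inverse mult.commute)
qed

lemma sinh_odd_series: "(\<lambda>m. z ^ (2 * m + 1) / fact (2 * m + 1)) sums sinh z" for z :: real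
proof -
  have "(\<lambda>n. if even n then 0 else z ^ n /\<^sub>R fact n) sums sinh z" by (rule sinh_converges)
  then have "(\<lambda>m. (\<lambda>n. if even n then 0 else z ^ n /\<^sub>R fact n) (2 * m + 1)) sums sinh z"
    by (subst sums_mono_reindex) (auto simp: strict_mono_def elim!: oddE)
  then show ?thesis by (simp add: divide_inverse mult.commute)
qed

text \<open>Termwise this is the derivative of z cosh z. It gives the mean of 2 m + 1 under the
  weights of cosh, which Jensen's inequality calls for.\<close>

lemma even_series_weighted: "(\<lambda>m. z ^ (2 * m) / fact (2 * m) * (2 * real m + 1)) sums (cosh z + z * sinh z)" for z :: real
proof -
  have "(\<lambda>m. z * (z ^ (2 * m + 1) / fact (2 * m + 1))) sums (z * sinh z)"
    by (intro sums_mult sinh_odd_series)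
  also define f where "f m = z ^ (2 * m) / fact (2 * m) * (2 * real m)" for m
  have "(\<lambda>m. z * (z ^ (2 * m + 1) / fact (2 * m + 1))) = (\<lambda>m. f (Suc m))"
    by (rule ext) (simp add: f_def divide_simps)
  finally have "f sums (z * sinh z)"
    unfolding sums_Suc_iff by (simp add: f_def)
  from sums_add[OF cosh_even_series[of z] this] show ?thesis by (simp add: f_def algebra_simps add_divide_distrib)
qed

lemma bessel_coeff_nonneg:
  assumes "\<alpha> \<ge> -1/2"
  shows "bessel_coeff \<alpha> m \<ge> 0"
  unfolding bessel_coeff_def using assms
  by (intro divide_nonneg_nonneg mult_nonneg_nonneg Gamma_real_nonneg) auto

lemma summable_bessel_coeff:
  assumes "\<alpha> \<ge> -1/2"
  shows "summable (\<lambda>m. bessel_coeff \<alpha> m * z ^ (2 * m))"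
proof -
  obtain K where K: "K > 0"
    "\<And>m. bessel_coeff \<alpha> m \<le> K * ((2 * real m + 1) powr - (\<alpha> + 1/2) / fact (2 * m))"
    using bessel_coeff_bounds[OF assms] by metis
  show ?thesis
  proof (rule summable_comparison_test'[where N = 0])
    show "summable (\<lambda>m. K * (z ^ (2 * m) / fact (2 * m)))"
      using cosh_even_series[of z] by (intro summable_mult) (simp add: sums_iff)
    fix m
    have z: "z ^ (2 * m) \<ge> 0" by (simp add: power_mult)
    have "bessel_coeff \<alpha> m \<le> K * (1 / fact (2 * m))"
      using powr_mono[of "- (\<alpha> + 1/2)" 0 "2 * real m + 1"] assms K(1)
      by (intro order_trans[OF K(2)] mult_left_mono divide_right_mono) auto
    then have "bessel_coeff \<alpha> m * z ^ (2 * m) \<le> K * (1 / fact (2 * m)) * z ^ (2 * m)"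
      using z by (rule mult_right_mono)
    then show "norm (bessel_coeff \<alpha> m * z ^ (2 * m)) \<le> K * (z ^ (2 * m) / fact (2 * m))"
      using bessel_coeff_nonneg[OF assms] z by (simp add: abs_mult)
  qed
qed

text \<open>Jensen's inequality for the convex function \<open>x powr - a\<close>: under the weights
  \<open>z ^ (2 m) / (2 m)!\<close> the mean of \<open>2 m + 1\<close> is at most \<open>1 + z\<close>.\<close>

lemma even_series_powr_ge:
  fixes z a :: real
  assumes "z \<ge> 0" "a \<ge> 0" and s: "summable (\<lambda>m. z ^ (2 * m) / fact (2 * m) * (2 * real m + 1) powr - a)"
  shows "exp z / 2 * (1 + z) powr - a \<le> (\<Sum>m. z ^ (2 * m) / fact (2 * m) * (2 * real m + 1) powr - a)"
proof -
  define P where "P = (1 + z) powr - a"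
  define f where "f m = z ^ (2 * m) / fact (2 * m)" for m
  have f: "f m \<ge> 0" for m using assms by (simp add: f_def)
  \<comment> \<open>The tangent of x powr -a at x = 1, evaluated at x = (2 m + 1) / (1 + z); the
    lower bound is affine in 2 m + 1 and can be summed exactly.\<close>
  have pt: "P * (1 + a - a / (1 + z) * (2 * real m + 1)) \<le> (2 * real m + 1) powr - a" for m
  proof -
    define x where "x = (2 * real m + 1) / (1 + z)"
    have x: "x > 0" using assms by (simp add: x_def add_nonneg_pos)
    have "1 + a - a * x \<le> 1 + - a * ln x"
      using mult_left_mono[OF ln_le_minus_one[OF x] assms(2)] by (simp add: algebra_simps)
    also have "\<dots> \<le> x powr - a"
      using x exp_ge_add_one_self[of "- a * ln x"] by (simp add: powr_def)
    finally have "P * (1 + a - a * x) \<le> P * x powr - a"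
      by (intro mult_left_mono) (auto simp: P_def)
    also have "P * x powr - a = (2 * real m + 1) powr - a"
      using assms by (simp add: P_def x_def powr_mult[symmetric])
    finally show ?thesis by (simp add: x_def)
  qed
  have "(\<lambda>m. P * (1 + a) * f m - P * (a / (1 + z)) * (f m * (2 * real m + 1))) sums
     (P * (1 + a) * cosh z - P * (a / (1 + z)) * (cosh z + z * sinh z))"
    unfolding f_def by (intro sums_diff sums_mult cosh_even_series even_series_weighted)
  moreover have "P * (1 + a) * f m - P * (a / (1 + z)) * (f m * (2 * real m + 1)) \<le> f m * (2 * real m + 1) powr - a" for m
    using mult_left_mono[OF pt[of m] f[of m]] by (simp add: algebra_simps)
  ultimately have "P * (1 + a) * cosh z - P * (a / (1 + z)) * (cosh z + z * sinh z) \<le> (\<Sum>m. f m * (2 * real m + 1) powr - a)"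
    using s unfolding f_def[symmetric] by (intro sums_le[OF _ _ summable_sums]) auto
  moreover have "P * cosh z \<le> P * (1 + a) * cosh z - P * (a / (1 + z)) * (cosh z + z * sinh z)"
  proof -
    have "cosh z + z * sinh z \<le> (1 + z) * cosh z"
      using assms sinh_le_cosh_real[of z] by (simp add: distrib_right mult_left_mono)
    then have "P * (a / (1 + z)) * (cosh z + z * sinh z) \<le> P * (a / (1 + z)) * ((1 + z) * cosh z)"
      using assms by (intro mult_left_mono) (auto simp: P_def)
    also have "\<dots> = P * a * cosh z" using assms by simp
    finally show ?thesis by (simp add: algebra_simps)
  qed
  moreover have "exp z / 2 * P \<le> P * cosh z"
    using mult_right_mono[of "exp z / 2" "cosh z" P] by (simp add: P_def cosh_field_def mult.commute)
  ultimately show ?thesis unfolding f_def P_def by linarith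
qed

text \<open>For j \<ge> 1 the factor i + j is at most j (i + 1). A division by (i + 1)^k can thus be
  traded for a shift of the exponential series by k.\<close>

lemma fact_add_le: "fact (i + k) \<le> fact k * (real i + 1) ^ k * fact i"
proof (induction k)
  case (Suc k)
  have "fact (i + Suc k) = (real i + real k + 1) * fact (i + k)" by (simp add: algebra_simps)
  also have "\<dots> \<le> ((real k + 1) * (real i + 1)) * (fact k * (real i + 1) ^ k * fact i)"
    by (intro mult_mono Suc.IH) (auto simp: algebra_simps)
  finally show ?case by (simp add: algebra_simps)
qed simp

text \<open>Convexity gives no upper bound, so the exponent is rounded up to an integer k: with x =
  (1 + z) / (i + 1), x powr a is at most 1 + x^k, and the division by (i + 1)^k shifts the
  exponential series. The pointwise estimate covers all indices i and is restricted to even ones at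
  the end.\<close>

lemma even_series_powr_le:
  fixes a :: real
  assumes "a \<ge> 0"
  obtains K where "K > 0" "\<And>z. z \<ge> 0 \<Longrightarrow> summable (\<lambda>m. z ^ (2 * m) / fact (2 * m) * (2 * real m + 1) powr - a)"
    "\<And>z. z \<ge> 0 \<Longrightarrow> (\<Sum>m. z ^ (2 * m) / fact (2 * m) * (2 * real m + 1) powr - a) \<le> K * (exp z * (1 + z) powr - a)"
proof -
  define k where "k = nat \<lceil>a\<rceil>"
  have k: "a \<le> real k" using assms by (simp add: k_def)
  \<comment> \<open>The summand 1 comes from \<open>x powr a \<le> 1 + x ^ k\<close>,
    \<open>2 ^ k\<close> from the case \<open>z \<le> 1\<close>, and \<open>2 ^ k * fact k\<close>
    from the case z > 1.\<close>
  define K :: real where "K = 1 + 2 ^ k * (1 + fact k)"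
  have main: "summable (\<lambda>m. z ^ (2 * m) / fact (2 * m) * (2 * real m + 1) powr - a) \<and>
    (\<Sum>m. z ^ (2 * m) / fact (2 * m) * (2 * real m + 1) powr - a) \<le> K * (exp z * (1 + z) powr - a)" if z: "z \<ge> 0" for z
  proof -
    define g where "g i = (1 + z) powr - a * ((1 + 2 ^ k) * (z ^ i / fact i) + 2 ^ k * fact k * (z ^ (i + k) / fact (i + k)))" for i
    have g0: "g i \<ge> 0" for i using z by (simp add: g_def)
    have expz: "(\<lambda>i. z ^ i / fact i) sums exp z"
      using exp_converges[of z] by (simp add: divide_inverse mult.commute)
    have sumk: "summable (\<lambda>i. z ^ (i + k) / fact (i + k))"
      using expz by (intro summable_ignore_initial_segment) (simp add: sums_iff)
    have sumk_le: "(\<Sum>i. z ^ (i + k) / fact (i + k)) \<le> exp z"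
    proof -
      have "exp z = (\<Sum>i. z ^ (i + k) / fact (i + k)) + (\<Sum>i<k. z ^ i / fact i)"
        using suminf_split_initial_segment[of "\<lambda>i. z ^ i / fact i" k] expz by (simp add: sums_iff)
      moreover have "(\<Sum>i<k. z ^ i / fact i) \<ge> 0" using z by (intro sum_nonneg) auto
      ultimately show ?thesis by simp
    qed
    have sg: "g sums ((1 + z) powr - a * ((1 + 2 ^ k) * exp z + 2 ^ k * fact k * (\<Sum>i. z ^ (i + k) / fact (i + k))))"
      unfolding g_def by (intro sums_mult sums_add expz summable_sums[OF sumk])
    have pt: "z ^ i / fact i * (real i + 1) powr - a \<le> g i" for i
    proof -
      define x where "x = (1 + z) / (real i + 1)"
      have x: "x > 0" using z by (simp add: x_def add_pos_nonneg)
      have "x powr a \<le> 1 + x ^ k"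
      proof (cases "x \<le> 1")
        case True
        then have "x powr a \<le> 1" using x assms by (intro powr_le1) auto
        then show ?thesis using x by (smt (verit) zero_le_power)
      next
        case False
        then have "x powr a \<le> x powr real k" using k by (intro powr_mono) auto
        then show ?thesis using x by (simp add: powr_realpow)
      qed
      moreover have "(real i + 1) powr - a = (1 + z) powr - a * x powr a"
        using z x_def x by (simp add: x_def powr_divide powr_minus field_simps)
      \<comment> \<open>For \<open>z \<le> 1\<close> one has x \<le> 2. For z > 1 one has 1 + z
        \<le> 2 z, and the factor z^k is absorbed by the shift of the series.\<close>
      moreover have "z ^ i / fact i * x ^ k \<le> 2 ^ k * (z ^ i / fact i) + 2 ^ k * fact k * (z ^ (i + k) / fact (i + k))"
      proof (cases "z \<le> 1")
        case True
        have "x \<le> 2" using True z by (simp add: x_def field_simps)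
        then have "x ^ k \<le> 2 ^ k" using x by (intro power_mono) auto
        then have "z ^ i / fact i * x ^ k \<le> z ^ i / fact i * 2 ^ k"
          using z by (intro mult_left_mono) auto
        then show ?thesis using z by (simp add: mult.commute add_increasing2)
      next
        case False
        have "x ^ k \<le> (2 * z / (real i + 1)) ^ k" using x False
          by (intro power_mono) (auto simp: x_def divide_right_mono)
        also have "\<dots> = 2 ^ k * z ^ k / (real i + 1) ^ k" by (simp add: power_divide power_mult_distrib)
        finally have "z ^ i / fact i * x ^ k \<le> z ^ i / fact i * (2 ^ k * z ^ k / (real i + 1) ^ k)"
          using z by (intro mult_left_mono) auto
        also have "\<dots> = 2 ^ k * z ^ (i + k) * (1 / (fact i * (real i + 1) ^ k))"
          by (simp add: power_add)
        also have "\<dots> \<le> 2 ^ k * z ^ (i + k) * (fact k / fact (i + k))"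
          using fact_add_le[of i k] z by (intro mult_left_mono) (auto simp: field_simps)
        finally show ?thesis using z by (simp add: mult_ac add_increasing)
      qed
      ultimately show ?thesis
      proof -
        assume 1: "x powr a \<le> 1 + x ^ k" and 2: "(real i + 1) powr - a = (1 + z) powr - a * x powr a"
          and 3: "z ^ i / fact i * x ^ k \<le> 2 ^ k * (z ^ i / fact i) + 2 ^ k * fact k * (z ^ (i + k) / fact (i + k))"
        have "z ^ i / fact i * (real i + 1) powr - a = (1 + z) powr - a * (z ^ i / fact i * x powr a)"
          unfolding 2 by simp
        also have "\<dots> \<le> (1 + z) powr - a * (z ^ i / fact i * (1 + x ^ k))"
          using 1 z by (intro mult_left_mono) auto
        also have "z ^ i / fact i * (1 + x ^ k) = z ^ i / fact i + z ^ i / fact i * x ^ k" by (simp add: distrib_left)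
        also have "(1 + z) powr - a * \<dots> \<le> g i"
          unfolding g_def using 3 z by (intro mult_left_mono) (auto simp: algebra_simps)
        finally show ?thesis .
      qed
    qed
    \<comment> \<open>The even-indexed terms are dominated by the sums over consecutive pairs, whose
      total is the full series of \<open>g\<close>.\<close>
    have sg': "summable (\<lambda>m. g (2 * m))"
    proof (rule summable_comparison_test'[where N = 0])
      show "summable (\<lambda>m. \<Sum>i\<in>{m * 2..<m * 2 + 2}. g i)"
        using sums_group[OF sg, of 2] by (simp add: sums_iff)
      fix m show "norm (g (2 * m)) \<le> (\<Sum>i\<in>{m * 2..<m * 2 + 2}. g i)"
        using g0 by (simp add: numeral_2_eq_2 mult.commute)
    qed
    have "(\<Sum>m. g (2 * m)) \<le> (\<Sum>m. \<Sum>i\<in>{m * 2..<m * 2 + 2}. g i)"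
    proof (rule suminf_le)
      show "summable (\<lambda>m. \<Sum>i\<in>{m * 2..<m * 2 + 2}. g i)"
        using sums_group[OF sg, of 2] by (simp add: sums_iff)
      show "g (2 * m) \<le> (\<Sum>i\<in>{m * 2..<m * 2 + 2}. g i)" for m
        using g0 by (simp add: numeral_2_eq_2 mult.commute)
    qed (rule sg')
    also have "\<dots> = (1 + z) powr - a * ((1 + 2 ^ k) * exp z + 2 ^ k * fact k * (\<Sum>i. z ^ (i + k) / fact (i + k)))"
      using sums_group[OF sg, of 2] by (simp add: sums_iff)
    also have "\<dots> \<le> (1 + z) powr - a * ((1 + 2 ^ k) * exp z + 2 ^ k * fact k * exp z)"
      using sumk_le by (intro mult_left_mono add_left_mono) auto
    also have "\<dots> = K * (exp z * (1 + z) powr - a)" by (simp add: K_def algebra_simps)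
    finally have g_le: "(\<Sum>m. g (2 * m)) \<le> K * (exp z * (1 + z) powr - a)" .
    have pt': "z ^ (2 * m) / fact (2 * m) * (2 * real m + 1) powr - a \<le> g (2 * m)" for m
      using pt[of "2 * m"] by simp
    have s: "summable (\<lambda>m. z ^ (2 * m) / fact (2 * m) * (2 * real m + 1) powr - a)"
      using sg' by (rule summable_comparison_test'[where N = 0]) (use pt' z in auto)
    moreover have "(\<Sum>m. z ^ (2 * m) / fact (2 * m) * (2 * real m + 1) powr - a) \<le> (\<Sum>m. g (2 * m))"
      by (intro suminf_le pt' s sg')
    ultimately show ?thesis using g_le by simp
  qed
  show ?thesis by (rule that[of K]) (use main in \<open>auto simp: K_def add_pos_nonneg\<close>)
qed

lemma bessel_series_bounds:
  assumes "\<alpha> \<ge> -1/2"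
  obtains K where "K > 0"
    "\<And>z. z \<ge> 0 \<Longrightarrow> bessel_series \<alpha> z \<le> K * (exp z * (1 + z) powr - (\<alpha> + 1/2))"
    "\<And>z. z \<ge> 0 \<Longrightarrow> exp z * (1 + z) powr - (\<alpha> + 1/2) \<le> K * bessel_series \<alpha> z"
proof -
  define a where "a = \<alpha> + 1/2"
  have a: "a \<ge> 0" using assms by (simp add: a_def)
  obtain K1 where K1: "K1 > 0"
    "\<And>m. bessel_coeff \<alpha> m \<le> K1 * ((2 * real m + 1) powr - a / fact (2 * m))"
    "\<And>m. (2 * real m + 1) powr - a / fact (2 * m) \<le> K1 * bessel_coeff \<alpha> m"
    using bessel_coeff_bounds[OF assms] unfolding a_def by metis
  obtain K2 where K2: "K2 > 0" "\<And>z. z \<ge> 0 \<Longrightarrow> summable (\<lambda>m. z ^ (2 * m) / fact (2 * m) * (2 * real m + 1) powr - a)"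
    "\<And>z. z \<ge> 0 \<Longrightarrow> (\<Sum>m. z ^ (2 * m) / fact (2 * m) * (2 * real m + 1) powr - a) \<le> K2 * (exp z * (1 + z) powr - a)"
    by (rule even_series_powr_le[OF a]) (rule that; assumption)
  show ?thesis
  proof (rule that[of "K1 * K2 + 2 * K1"])
    show "K1 * K2 + 2 * K1 > 0" using K1(1) K2(1) by (simp add: add_pos_pos)
  next
    fix z :: real assume z: "z \<ge> 0"
    define E where "E = exp z * (1 + z) powr - a"
    have E: "E \<ge> 0" by (simp add: E_def)
    define S where "S = (\<Sum>m. z ^ (2 * m) / fact (2 * m) * (2 * real m + 1) powr - a)"
    have "bessel_series \<alpha> z \<le> (\<Sum>m. K1 * (z ^ (2 * m) / fact (2 * m) * (2 * real m + 1) powr - a))"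
      unfolding bessel_series_def
    proof (intro suminf_le summable_bessel_coeff assms summable_mult K2 z)
      fix m show "bessel_coeff \<alpha> m * z ^ (2 * m) \<le> K1 * (z ^ (2 * m) / fact (2 * m) * (2 * real m + 1) powr - a)"
        using mult_right_mono[OF K1(2)[of m], of "z ^ (2 * m)"] z by (simp add: mult_ac)
    qed
    also have "\<dots> = K1 * S" unfolding S_def by (intro suminf_mult K2 z)
    also have "\<dots> \<le> K1 * (K2 * E)" using K2(3)[OF z] K1(1) by (intro mult_left_mono) (auto simp: S_def E_def)
    also have "\<dots> \<le> (K1 * K2 + 2 * K1) * E" using E K1(1) by (simp add: algebra_simps)
    finally show "bessel_series \<alpha> z \<le> (K1 * K2 + 2 * K1) * (exp z * (1 + z) powr - (\<alpha> + 1/2))"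
      by (simp only: E_def a_def)
    have "E \<le> 2 * S" using even_series_powr_ge[OF z a K2(2)[OF z]] by (simp add: E_def S_def)
    also have "S \<le> (\<Sum>m. K1 * (bessel_coeff \<alpha> m * z ^ (2 * m)))"
      unfolding S_def
    proof (intro suminf_le summable_bessel_coeff assms summable_mult K2 z)
      fix m show "z ^ (2 * m) / fact (2 * m) * (2 * real m + 1) powr - a \<le> K1 * (bessel_coeff \<alpha> m * z ^ (2 * m))"
        using mult_right_mono[OF K1(3)[of m], of "z ^ (2 * m)"] z by (simp add: mult_ac)
    qed
    also have "\<dots> = K1 * bessel_series \<alpha> z"
      unfolding bessel_series_def by (intro suminf_mult summable_bessel_coeff assms)
    finally have 1: "E \<le> 2 * K1 * bessel_series \<alpha> z" by simp
    with E K1(1) have "bessel_series \<alpha> z \<ge> 0" by (smt (verit) mult_pos_neg)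
    then have "2 * K1 * bessel_series \<alpha> z \<le> (K1 * K2 + 2 * K1) * bessel_series \<alpha> z"
      using K1(1) K2(1) by (intro mult_right_mono) auto
    with 1 show "exp z * (1 + z) powr - (\<alpha> + 1/2) \<le> (K1 * K2 + 2 * K1) * bessel_series \<alpha> z"
      by (simp only: E_def a_def)
  qed
qed

section \<open>Bounds for the positive double series\<close>

lemma bessel_product_coeff_scale:
  "bessel_product_coeff \<alpha> \<beta> (z * U) (z * V) N = z ^ N * bessel_product_coeff \<alpha> \<beta> U V N"
  unfolding bessel_product_coeff_def sum_distrib_left
proof (intro sum.cong refl)
  fix m assume "m \<in> {..N}"
  then have "z ^ N = z ^ m * z ^ (N - m)" by (simp add: power_add[symmetric])
  then show "(z * U) ^ m / (fact m * Gamma (\<alpha> + 1 + real m)) * ((z * V) ^ (N - m) / (fact (N - m) * Gamma (\<beta> + 1 + real (N - m))))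
    = z ^ N * (U ^ m / (fact m * Gamma (\<alpha> + 1 + real m)) * (V ^ (N - m) / (fact (N - m) * Gamma (\<beta> + 1 + real (N - m)))))"
    by (simp add: power_mult_distrib)
qed

lemma bessel_series_product:
  assumes ab: "\<alpha> \<ge> -1/2" "\<beta> \<ge> -1/2"
  shows "(\<lambda>N. w ^ (2 * N) * (bessel_product_coeff \<alpha> \<beta> (\<xi>\<^sup>2) (\<eta>\<^sup>2) N / 4 ^ N))
    sums (bessel_series \<alpha> (\<xi> * w) * bessel_series \<beta> (\<eta> * w))"
proof -
  define a where "a m = bessel_coeff \<alpha> m * (\<xi> * w) ^ (2 * m)" for m
  define b where "b m = bessel_coeff \<beta> m * (\<eta> * w) ^ (2 * m)" for m
  have na: "norm (a m) = a m" "norm (b m) = b m" for m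
    unfolding a_def b_def using bessel_coeff_nonneg[OF ab(1)] bessel_coeff_nonneg[OF ab(2)]
    by (simp_all add: abs_mult power_mult)
  have "(\<lambda>N. \<Sum>m\<le>N. a m * b (N - m)) sums ((\<Sum>m. a m) * (\<Sum>m. b m))"
    by (rule Cauchy_product_sums; simp only: na; simp only: a_def b_def; rule summable_bessel_coeff; rule ab)
  also have "(\<lambda>N. \<Sum>m\<le>N. a m * b (N - m)) = (\<lambda>N. w ^ (2 * N) * (bessel_product_coeff \<alpha> \<beta> (\<xi>\<^sup>2) (\<eta>\<^sup>2) N / 4 ^ N))"
  proof
    fix N
    have "w ^ (2 * N) * (bessel_product_coeff \<alpha> \<beta> (\<xi>\<^sup>2) (\<eta>\<^sup>2) N / 4 ^ N) = bessel_product_coeff \<alpha> \<beta> (w\<^sup>2 / 4 * \<xi>\<^sup>2) (w\<^sup>2 / 4 * \<eta>\<^sup>2) N"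
      unfolding bessel_product_coeff_scale by (simp add: power_divide power_mult)
    also have "\<dots> = (\<Sum>m\<le>N. a m * b (N - m))"
      unfolding bessel_product_coeff_def a_def b_def bessel_coeff_def
      by (simp add: power_mult power_mult_distrib power_divide power2_eq_square mult_ac)
    finally show "(\<Sum>m\<le>N. a m * b (N - m)) = w ^ (2 * N) * (bessel_product_coeff \<alpha> \<beta> (\<xi>\<^sup>2) (\<eta>\<^sup>2) N / 4 ^ N)" ..
  qed
  finally show ?thesis by (simp add: a_def b_def bessel_series_def)
qed

text \<open>The Gamma value is the moment that Euler's integral supplies for the power w^(2 N). The
  factor 4^N matches the quarters in the Bessel coefficients and makes 4 r / (1 + r)^2, which is 1 /
  cosh^2 (t / 2) for r = exp (-t), the variable of the summed kernel.\<close>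

definition kernel_coeff :: "real \<Rightarrow> real \<Rightarrow> real \<Rightarrow> real \<Rightarrow> nat \<Rightarrow> real" where
  "kernel_coeff \<alpha> \<beta> U V N = Gamma (2 * real N + \<alpha> + \<beta> + 2) / 4 ^ N * bessel_product_coeff \<alpha> \<beta> U V N"

lemma kernel_coeff_nonneg:
  assumes "\<alpha> \<ge> -1/2" "\<beta> \<ge> -1/2" "U \<ge> 0" "V \<ge> 0"
  shows "kernel_coeff \<alpha> \<beta> U V N \<ge> 0"
  unfolding kernel_coeff_def using assms
  by (intro mult_nonneg_nonneg divide_nonneg_nonneg bessel_product_coeff_nonneg Gamma_real_nonneg) auto

lemma kernel_coeff_scale: "kernel_coeff \<alpha> \<beta> (z * U) (z * V) N = kernel_coeff \<alpha> \<beta> U V N * z ^ N"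
  by (simp add: kernel_coeff_def bessel_product_coeff_scale)

text \<open>Euler's integral for each term, then an exchange of sum and integral for nonnegative
  functions. In \<open>ennreal\<close> this is possible before convergence is known; summability is
  read off later from a bound for the integral.\<close>

lemma suminf_kernel_coeff_eq_nn_integral:
  assumes ab: "\<alpha> \<ge> -1/2" "\<beta> \<ge> -1/2"
  shows "(\<Sum>N. ennreal (kernel_coeff \<alpha> \<beta> (\<xi>\<^sup>2) (\<eta>\<^sup>2) N)) =
    (\<integral>\<^sup>+w. ennreal (w powr (\<alpha> + \<beta> + 1) / exp w * (bessel_series \<alpha> (\<xi> * w) * bessel_series \<beta> (\<eta> * w))) * indicator {0..} w \<partial>lborel)"
proof -
  define c where "c N = bessel_product_coeff \<alpha> \<beta> (\<xi>\<^sup>2) (\<eta>\<^sup>2) N / 4 ^ N" for N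
  have c: "c N \<ge> 0" for N
    using bessel_product_coeff_nonneg[of \<alpha> \<beta> "\<xi>\<^sup>2" "\<eta>\<^sup>2" N] ab by (simp add: c_def)
  define f where "f N w = w powr (2 * real N + \<alpha> + \<beta> + 2 - 1) / exp w * c N" for N w
  have int: "(\<integral>\<^sup>+w. ennreal (f N w) * indicator {0..} w \<partial>lborel) = ennreal (kernel_coeff \<alpha> \<beta> (\<xi>\<^sup>2) (\<eta>\<^sup>2) N)" for N
  proof -
    have "(f N has_integral Gamma (2 * real N + \<alpha> + \<beta> + 2) * c N) {0..}"
      unfolding f_def by (intro has_integral_mult_left Gamma_integral_real) (use ab in auto)
    from nn_integral_has_integral_lebesgue'[OF _ this] have "(\<integral>\<^sup>+w. ennreal (f N w) * indicator {0..} w \<partial>lborel)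
       = ennreal (Gamma (2 * real N + \<alpha> + \<beta> + 2) * c N)"
      by (simp add: f_def c)
    then show ?thesis by (simp add: kernel_coeff_def c_def)
  qed
  have pt: "(\<Sum>N. ennreal (f N w) * indicator {0..} w) =
    ennreal (w powr (\<alpha> + \<beta> + 1) / exp w * (bessel_series \<alpha> (\<xi> * w) * bessel_series \<beta> (\<eta> * w))) * indicator {0..} w" for w
  proof (cases "w \<ge> 0")
    case True
    have "(\<lambda>N. w powr (\<alpha> + \<beta> + 1) / exp w * (w ^ (2 * N) * c N)) sums
      (w powr (\<alpha> + \<beta> + 1) / exp w * (bessel_series \<alpha> (\<xi> * w) * bessel_series \<beta> (\<eta> * w)))"
      unfolding c_def by (intro sums_mult bessel_series_product ab)
    also have "(\<lambda>N. w powr (\<alpha> + \<beta> + 1) / exp w * (w ^ (2 * N) * c N)) = (\<lambda>N. f N w)"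
    proof
      fix N
      have "w powr (2 * real N + \<alpha> + \<beta> + 2 - 1) = w ^ (2 * N) * w powr (\<alpha> + \<beta> + 1)"
      proof (cases "w = 0")
        case False
        then have "w powr (real (2 * N) + (\<alpha> + \<beta> + 1)) = w ^ (2 * N) * w powr (\<alpha> + \<beta> + 1)"
          using True unfolding powr_add by (subst powr_realpow) auto
        then show ?thesis by (simp add: add_ac)
      qed simp
      then show "w powr (\<alpha> + \<beta> + 1) / exp w * (w ^ (2 * N) * c N) = f N w"
        by (simp add: f_def)
    qed
    finally have "(\<Sum>N. ennreal (f N w)) = ennreal (w powr (\<alpha> + \<beta> + 1) / exp w * (bessel_series \<alpha> (\<xi> * w) * bessel_series \<beta> (\<eta> * w)))"
      by (intro suminf_ennreal_eq) (auto simp: f_def c)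
    then show ?thesis using True by simp
  qed simp
  have [measurable]: "f N \<in> borel_measurable lborel" for N
    unfolding f_def by measurable
  have "(\<Sum>N. ennreal (kernel_coeff \<alpha> \<beta> (\<xi>\<^sup>2) (\<eta>\<^sup>2) N)) = (\<Sum>N. \<integral>\<^sup>+w. ennreal (f N w) * indicator {0..} w \<partial>lborel)"
    by (simp only: int)
  also have "\<dots> = (\<integral>\<^sup>+w. (\<Sum>N. ennreal (f N w) * indicator {0..} w) \<partial>lborel)"
    by (intro nn_integral_suminf[symmetric]) measurable
  finally show ?thesis by (simp only: pt)
qed

text \<open>This is the majorant for the upper bound: a power of max 1 (\<epsilon> w) is at most the
  sum of the two powers. Writing \<open>powr 0\<close> for 1 keeps both summands in the form of
  Euler's integrand.\<close>

lemma nn_integral_exp_powr_scaled: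
  fixes p \<epsilon> :: real
  assumes "p \<ge> 0" "\<epsilon> > 0"
  shows "(\<integral>\<^sup>+w. ennreal (((\<epsilon> * w) powr 0 + (\<epsilon> * w) powr p) / exp (\<epsilon> * w)) * indicator {0..} w \<partial>lborel)
    = ennreal ((1 + Gamma (p + 1)) / \<epsilon>)"
proof -
  define F where "F v = (v powr 0 + v powr p) / exp v" for v :: real
  have "((\<lambda>v. v powr (1 - 1) / exp v + v powr (p + 1 - 1) / exp v) has_integral Gamma 1 + Gamma (p + 1)) {0..}"
    by (intro has_integral_add Gamma_integral_real) (use assms in auto)
  also have "(\<lambda>v. v powr (1 - 1) / exp v + v powr (p + 1 - 1) / exp v) = F"
    by (auto simp: F_def add_divide_distrib)
  finally have "(\<integral>\<^sup>+v. ennreal (F v) * indicator {0..} v \<partial>lborel) = ennreal (1 + Gamma (p + 1))"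
    by (intro nn_integral_has_integral_lebesgue') (auto simp: F_def)
  moreover have "(\<integral>\<^sup>+v. ennreal (F v) * indicator {0..} v \<partial>lborel) =
     ennreal \<epsilon> * (\<integral>\<^sup>+w. ennreal (F (0 + \<epsilon> * w)) * indicator {0..} (0 + \<epsilon> * w) \<partial>lborel)"
    using assms by (subst nn_integral_real_affine[of _ \<epsilon> 0]) (simp_all add: F_def)
  moreover have "indicator {0..} (0 + \<epsilon> * w) = (indicator {0..} w :: ennreal)" for w
    using assms by (auto simp: indicator_def zero_le_mult_iff)
  ultimately have e: "ennreal \<epsilon> * (\<integral>\<^sup>+w. ennreal (F (\<epsilon> * w)) * indicator {0..} w \<partial>lborel) = ennreal (1 + Gamma (p + 1))"
    by simp
  have "(\<integral>\<^sup>+w. ennreal (F (\<epsilon> * w)) * indicator {0..} w \<partial>lborel) =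
     ennreal (1 / \<epsilon>) * (ennreal \<epsilon> * (\<integral>\<^sup>+w. ennreal (F (\<epsilon> * w)) * indicator {0..} w \<partial>lborel))"
    using assms by (simp add: mult.assoc[symmetric] ennreal_mult[symmetric])
  also have "\<dots> = ennreal ((1 + Gamma (p + 1)) / \<epsilon>)"
    unfolding e using assms by (subst ennreal_mult[symmetric]) (auto intro!: add_nonneg_nonneg Gamma_real_nonneg)
  finally show ?thesis by (simp add: F_def)
qed

lemma powr_divide_eq_mult: "(x / y) powr a = x powr a * y powr - a" if "x \<ge> 0" "y > 0" for x y a :: real
  using that by (simp add: powr_divide powr_minus_divide)

text \<open>w / (1 + \<xi> w) increases with w and equals 1 / (\<epsilon> + \<xi>) at w = 1 /
  \<epsilon>, the scale on which exp (- \<epsilon> w) decays. Beyond this point it exceeds that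
  value at most by the factor \<epsilon> w.\<close>

lemma powr_ratio_le:
  fixes w \<xi> \<epsilon> a :: real
  assumes "w > 0" "\<xi> \<ge> 0" "\<epsilon> > 0" "a \<ge> 0"
  shows "w powr a * (1 + \<xi> * w) powr - a \<le> max 1 (\<epsilon> * w) powr a * (\<epsilon> + \<xi>) powr - a"
proof -
  have pos: "1 + \<xi> * w > 0" "\<epsilon> + \<xi> > 0" using assms by (auto simp: add_pos_nonneg)
  have "w * (\<epsilon> + \<xi>) \<le> max 1 (\<epsilon> * w) * 1 + max 1 (\<epsilon> * w) * (\<xi> * w)"
  proof -
    have "1 * (\<xi> * w) \<le> max 1 (\<epsilon> * w) * (\<xi> * w)" using assms by (intro mult_right_mono) auto
    then show ?thesis by (simp add: algebra_simps)
  qed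
  then have "w / (1 + \<xi> * w) \<le> max 1 (\<epsilon> * w) / (\<epsilon> + \<xi>)"
    using pos by (simp add: divide_simps algebra_simps)
  then have "(w / (1 + \<xi> * w)) powr a \<le> (max 1 (\<epsilon> * w) / (\<epsilon> + \<xi>)) powr a"
    using assms pos by (intro powr_mono2) auto
  moreover have "(w / (1 + \<xi> * w)) powr a = w powr a * (1 + \<xi> * w) powr - a"
    "(max 1 (\<epsilon> * w) / (\<epsilon> + \<xi>)) powr a = max 1 (\<epsilon> * w) powr a * (\<epsilon> + \<xi>) powr - a"
    using assms pos by (auto intro!: powr_divide_eq_mult)
  ultimately show ?thesis by simp
qed

lemma powr_ratio_ge:
  fixes w \<xi> \<epsilon> a :: real
  assumes "w \<ge> 1 / \<epsilon>" "\<xi> \<ge> 0" "\<epsilon> > 0" "a \<ge> 0"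
  shows "(\<epsilon> + \<xi>) powr - a \<le> w powr a * (1 + \<xi> * w) powr - a"
proof -
  have w: "w > 0" using assms by (meson divide_pos_pos less_le_trans zero_less_one)
  have pos: "1 + \<xi> * w > 0" "\<epsilon> + \<xi> > 0" using assms w by (auto simp: add_pos_nonneg)
  have "\<epsilon> * w \<ge> 1" using assms by (simp add: field_simps)
  then have "1 / (\<epsilon> + \<xi>) \<le> w / (1 + \<xi> * w)"
    using pos by (simp add: divide_simps algebra_simps)
  then have "(1 / (\<epsilon> + \<xi>)) powr a \<le> (w / (1 + \<xi> * w)) powr a"
    using assms pos by (intro powr_mono2) auto
  moreover have "(w / (1 + \<xi> * w)) powr a = w powr a * (1 + \<xi> * w) powr - a"
    "(1 / (\<epsilon> + \<xi>)) powr a = (\<epsilon> + \<xi>) powr - a"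
    using w pos powr_divide_eq_mult[of 1 "\<epsilon> + \<xi>" a] by (auto intro!: powr_divide_eq_mult)
  ultimately show ?thesis by simp
qed

text \<open>With \<open>\<epsilon> = 1 - \<xi> - \<eta>\<close> the exponentials leave exp (-
  \<epsilon> w), so w of order 1 / \<epsilon> dominates. There (w / (1 + \<xi> w)) powr (\<alpha> +
  1/2) is comparable to (\<epsilon> + \<xi>) powr -(\<alpha> + 1/2), and \<epsilon> + \<xi> = 1 -
  \<eta>: this is why the exponent with \<alpha> goes with \<eta>.\<close>

lemma kernel_coeff_sum_bounds:
  assumes ab: "\<alpha> \<ge> -1/2" "\<beta> \<ge> -1/2"
  obtains K where "K > 0"
    "\<And>\<xi> \<eta>. \<xi> \<ge> 0 \<Longrightarrow> \<eta> \<ge> 0 \<Longrightarrow> \<xi> + \<eta> < 1 \<Longrightarrow> summable (kernel_coeff \<alpha> \<beta> (\<xi>\<^sup>2) (\<eta>\<^sup>2))"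
    "\<And>\<xi> \<eta>. \<xi> \<ge> 0 \<Longrightarrow> \<eta> \<ge> 0 \<Longrightarrow> \<xi> + \<eta> < 1 \<Longrightarrow> (\<Sum>N. kernel_coeff \<alpha> \<beta> (\<xi>\<^sup>2) (\<eta>\<^sup>2) N) \<le>
       K * ((1 - \<eta>) powr - (\<alpha> + 1/2) * (1 - \<xi>) powr - (\<beta> + 1/2) / (1 - \<xi> - \<eta>))"
    "\<And>\<xi> \<eta>. \<xi> \<ge> 0 \<Longrightarrow> \<eta> \<ge> 0 \<Longrightarrow> \<xi> + \<eta> < 1 \<Longrightarrow>
       (1 - \<eta>) powr - (\<alpha> + 1/2) * (1 - \<xi>) powr - (\<beta> + 1/2) / (1 - \<xi> - \<eta>) \<le>
       K * (\<Sum>N. kernel_coeff \<alpha> \<beta> (\<xi>\<^sup>2) (\<eta>\<^sup>2) N)"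
proof -
  define a b where "a = \<alpha> + 1/2" and "b = \<beta> + 1/2"
  have a: "a \<ge> 0" and b: "b \<ge> 0" using ab by (auto simp: a_def b_def)
  obtain Ka where Ka: "Ka > 0"
    "\<And>z. z \<ge> 0 \<Longrightarrow> bessel_series \<alpha> z \<le> Ka * (exp z * (1 + z) powr - a)"
    "\<And>z. z \<ge> 0 \<Longrightarrow> exp z * (1 + z) powr - a \<le> Ka * bessel_series \<alpha> z"
    using bessel_series_bounds[OF ab(1)] unfolding a_def by metis
  obtain Kb where Kb: "Kb > 0"
    "\<And>z. z \<ge> 0 \<Longrightarrow> bessel_series \<beta> z \<le> Kb * (exp z * (1 + z) powr - b)"
    "\<And>z. z \<ge> 0 \<Longrightarrow> exp z * (1 + z) powr - b \<le> Kb * bessel_series \<beta> z"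
    using bessel_series_bounds[OF ab(2)] unfolding b_def by metis
  define K0 where "K0 = Ka * Kb"
  have K0: "K0 > 0" using Ka(1) Kb(1) by (simp add: K0_def)
  define G where "G = 1 + Gamma (a + b + 1)"
  have "Gamma (a + b + 1) > 0" using a b by (intro Gamma_real_pos) auto
  then have G: "G > 0" by (simp add: G_def)
  \<comment> \<open>\<open>K0 * G\<close> is the upper constant, with \<open>G\<close> from the
    majorant integral; \<open>K0 * exp 2\<close> is the lower one, from exp (- \<epsilon> w) on the
    window used below.\<close>
  define K where "K = K0 * G + K0 * exp 2"
  have K: "K > 0" using K0 G by (simp add: K_def add_pos_pos)
  have main: "summable (kernel_coeff \<alpha> \<beta> (\<xi>\<^sup>2) (\<eta>\<^sup>2)) \<and>
      (\<Sum>N. kernel_coeff \<alpha> \<beta> (\<xi>\<^sup>2) (\<eta>\<^sup>2) N) \<le> K * ((1 - \<eta>) powr - a * (1 - \<xi>) powr - b / (1 - \<xi> - \<eta>)) \<and>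
      (1 - \<eta>) powr - a * (1 - \<xi>) powr - b / (1 - \<xi> - \<eta>) \<le> K * (\<Sum>N. kernel_coeff \<alpha> \<beta> (\<xi>\<^sup>2) (\<eta>\<^sup>2) N)"
    if xe: "\<xi> \<ge> 0" "\<eta> \<ge> 0" "\<xi> + \<eta> < 1" for \<xi> \<eta>
  proof -
    define \<epsilon> where "\<epsilon> = 1 - \<xi> - \<eta>"
    have eps: "\<epsilon> > 0" using xe by (simp add: \<epsilon>_def)
    define Y where "Y = (\<epsilon> + \<xi>) powr - a * (\<epsilon> + \<eta>) powr - b"
    have Y: "Y \<ge> 0" by (simp add: Y_def)
    define h where "h w = w powr (\<alpha> + \<beta> + 1) / exp w * (bessel_series \<alpha> (\<xi> * w) * bessel_series \<beta> (\<eta> * w))" for w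
    define H where "H w = (w powr a * (1 + \<xi> * w) powr - a) * (w powr b * (1 + \<eta> * w) powr - b) / exp (\<epsilon> * w)" for w
    have ab1: "\<alpha> + \<beta> + 1 = a + b" by (simp add: a_def b_def)
    have Heq: "w powr (\<alpha> + \<beta> + 1) / exp w * ((exp (\<xi> * w) * (1 + \<xi> * w) powr - a) * (exp (\<eta> * w) * (1 + \<eta> * w) powr - b)) = H w" for w
    proof -
      have "exp w = exp (\<xi> * w) * exp (\<eta> * w) * exp (\<epsilon> * w)"
        by (simp add: exp_add[symmetric] \<epsilon>_def algebra_simps)
      then show ?thesis unfolding H_def ab1 powr_add by simp
    qed
    have h_le: "h w \<le> K0 * H w" and h_ge: "H w \<le> K0 * h w" if w: "w \<ge> 0" for w
    proof -
      have zz: "\<xi> * w \<ge> 0" "\<eta> * w \<ge> 0" using xe w by auto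
      have nn: "exp z * (1 + z) powr - c \<ge> 0" for z c :: real by simp
      have nb: "bessel_series \<alpha> (\<xi> * w) \<ge> 0" "bessel_series \<beta> (\<eta> * w) \<ge> 0"
        using order_trans[OF nn Ka(3)[OF zz(1)]] order_trans[OF nn Kb(3)[OF zz(2)]] Ka(1) Kb(1)
        by (simp_all add: zero_le_mult_iff)
      have "h w \<le> w powr (\<alpha> + \<beta> + 1) / exp w * ((Ka * (exp (\<xi> * w) * (1 + \<xi> * w) powr - a)) * (Kb * (exp (\<eta> * w) * (1 + \<eta> * w) powr - b)))"
        unfolding h_def using Ka Kb zz nb by (intro mult_left_mono mult_mono) auto
      also have "\<dots> = K0 * H w" unfolding Heq[of w, symmetric] K0_def by simp
      finally show "h w \<le> K0 * H w" .
      have "H w \<le> w powr (\<alpha> + \<beta> + 1) / exp w * ((Ka * bessel_series \<alpha> (\<xi> * w)) * (Kb * bessel_series \<beta> (\<eta> * w)))"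
        unfolding Heq[of w, symmetric]
        by (rule mult_left_mono[OF mult_mono[OF Ka(3)[OF zz(1)] Kb(3)[OF zz(2)]]]) (use Ka(1) Kb(1) nb in auto)
      also have "\<dots> = K0 * h w" unfolding h_def K0_def by simp
      finally show "H w \<le> K0 * h w" .
    qed
    define S where "S = (\<integral>\<^sup>+w. ennreal (h w) * indicator {0..} w \<partial>lborel)"
    have S: "(\<Sum>N. ennreal (kernel_coeff \<alpha> \<beta> (\<xi>\<^sup>2) (\<eta>\<^sup>2) N)) = S"
      unfolding S_def h_def by (rule suminf_kernel_coeff_eq_nn_integral[OF ab])
    have H_le: "H w \<le> Y * (((\<epsilon> * w) powr 0 + (\<epsilon> * w) powr (a + b)) / exp (\<epsilon> * w))" if w: "w > 0" for w
    proof -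
      have "(w powr a * (1 + \<xi> * w) powr - a) * (w powr b * (1 + \<eta> * w) powr - b) \<le>
         (max 1 (\<epsilon> * w) powr a * (\<epsilon> + \<xi>) powr - a) * (max 1 (\<epsilon> * w) powr b * (\<epsilon> + \<eta>) powr - b)"
        using xe eps w a b by (intro mult_mono powr_ratio_le) auto
      also have "\<dots> = Y * max 1 (\<epsilon> * w) powr (a + b)" by (simp add: Y_def powr_add)
      also have "\<dots> \<le> Y * ((\<epsilon> * w) powr 0 + (\<epsilon> * w) powr (a + b))"
        using eps w Y by (intro mult_left_mono) (auto simp: max_def)
      finally show ?thesis unfolding H_def by (simp add: divide_right_mono)
    qed
    have "S \<le> (\<integral>\<^sup>+w. ennreal (K0 * Y) * (ennreal (((\<epsilon> * w) powr 0 + (\<epsilon> * w) powr (a + b)) / exp (\<epsilon> * w)) * indicator {0..} w) \<partial>lborel)"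
      unfolding S_def
    proof (intro nn_integral_mono)
      fix w :: real
      define v where "v = ((\<epsilon> * w) powr 0 + (\<epsilon> * w) powr (a + b)) / exp (\<epsilon> * w)"
      have v: "v \<ge> 0" by (simp add: v_def)
      have "h w \<le> K0 * Y * v" if w: "w \<ge> 0"
      proof (cases "w = 0")
        case True
        then show ?thesis using K0 Y v by (simp add: h_def)
      next
        case False
        with w have "K0 * H w \<le> K0 * (Y * v)" using H_le[of w] K0 by (intro mult_left_mono) (auto simp: v_def)
        with h_le[OF w] show ?thesis by simp
      qed
      then have "ennreal (h w) \<le> ennreal (K0 * Y) * ennreal v" if w: "w \<ge> 0"
        using w K0 Y v by (subst ennreal_mult[symmetric]) (auto intro!: ennreal_leI)
      then show "ennreal (h w) * indicator {0..} w \<le> ennreal (K0 * Y) * (ennreal (((\<epsilon> * w) powr 0 + (\<epsilon> * w) powr (a + b)) / exp (\<epsilon> * w)) * indicator {0..} w)"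
        unfolding v_def[symmetric] by (auto simp: indicator_def)
    qed
    also have "\<dots> = ennreal (K0 * Y) * ennreal (G / \<epsilon>)"
      by (subst nn_integral_cmult) (measurable, simp only: nn_integral_exp_powr_scaled[OF add_nonneg_nonneg[OF a b] eps] G_def)
    also have "\<dots> = ennreal (K0 * G * (Y / \<epsilon>))"
      using K0 Y G eps by (simp add: ennreal_mult[symmetric] mult_ac)
    finally have S_le: "S \<le> ennreal (K0 * G * (Y / \<epsilon>))" .
    \<comment> \<open>For the lower bound the integral is restricted to the window from 1 /
      \<epsilon> to 2 / \<epsilon>, of length 1 / \<epsilon>, where exp (- \<epsilon> w) is at least
      exp (-2).\<close>
    have "ennreal (exp (-2) / K0 * Y) * emeasure lborel {1 / \<epsilon>..2 / \<epsilon>} \<le> S"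
    proof -
      have "ennreal (exp (-2) / K0 * Y) * emeasure lborel {1 / \<epsilon>..2 / \<epsilon>} =
         (\<integral>\<^sup>+w. ennreal (exp (-2) / K0 * Y) * indicator {1 / \<epsilon>..2 / \<epsilon>} w \<partial>lborel)"
        by (simp add: nn_integral_cmult_indicator)
      also have "\<dots> \<le> S" unfolding S_def
      proof (intro nn_integral_mono)
        fix w :: real
        have "exp (-2) / K0 * Y \<le> h w" if w: "1 / \<epsilon> \<le> w" "w \<le> 2 / \<epsilon>"
        proof -
          have w0: "w \<ge> 0" using eps w(1) by (meson divide_nonneg_pos order_trans zero_le_one)
          have "\<epsilon> * w \<le> 2" using w(2) eps by (simp add: field_simps)
          then have "exp (-2) \<le> 1 / exp (\<epsilon> * w)" by (simp add: exp_minus field_simps)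
          moreover have "Y \<le> (w powr a * (1 + \<xi> * w) powr - a) * (w powr b * (1 + \<eta> * w) powr - b)"
            unfolding Y_def using w xe eps a b by (intro mult_mono powr_ratio_ge) auto
          ultimately have "exp (-2) * Y \<le> (1 / exp (\<epsilon> * w)) * ((w powr a * (1 + \<xi> * w) powr - a) * (w powr b * (1 + \<eta> * w) powr - b))"
            using Y by (intro mult_mono) auto
          also have "\<dots> = H w" by (simp add: H_def)
          also have "\<dots> \<le> K0 * h w" by (rule h_ge[OF w0])
          finally show ?thesis using K0 by (simp add: field_simps)
        qed
        moreover have "w \<ge> 0" if "1 / \<epsilon> \<le> w" using eps that by (meson divide_nonneg_pos order_trans zero_le_one)
        ultimately show "ennreal (exp (-2) / K0 * Y) * indicator {1 / \<epsilon>..2 / \<epsilon>} w \<le> ennreal (h w) * indicator {0..} w"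
          by (auto simp: indicator_def intro!: ennreal_leI)
      qed
      finally show ?thesis .
    qed
    moreover have "emeasure lborel {1 / \<epsilon>..2 / \<epsilon>} = ennreal (1 / \<epsilon>)"
      using eps by (subst emeasure_lborel_Icc) (auto simp: divide_right_mono diff_divide_distrib[symmetric])
    ultimately have S_ge: "ennreal (exp (-2) / K0 * Y * (1 / \<epsilon>)) \<le> S"
      using K0 Y eps by (simp add: ennreal_mult[symmetric])
    have nn: "kernel_coeff \<alpha> \<beta> (\<xi>\<^sup>2) (\<eta>\<^sup>2) N \<ge> 0" for N using ab by (intro kernel_coeff_nonneg) auto
    have sm: "summable (kernel_coeff \<alpha> \<beta> (\<xi>\<^sup>2) (\<eta>\<^sup>2))"
      using S S_le by (intro summable_suminf_not_top nn) (auto simp: top_unique)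
    then have S': "S = ennreal (\<Sum>N. kernel_coeff \<alpha> \<beta> (\<xi>\<^sup>2) (\<eta>\<^sup>2) N)"
      unfolding S[symmetric] using nn by (intro suminf_ennreal2) auto
    have Ss: "(\<Sum>N. kernel_coeff \<alpha> \<beta> (\<xi>\<^sup>2) (\<eta>\<^sup>2) N) \<ge> 0" using sm nn by (intro suminf_nonneg)
    have Ye: "Y / \<epsilon> \<ge> 0" using Y eps by simp
    have up: "(\<Sum>N. kernel_coeff \<alpha> \<beta> (\<xi>\<^sup>2) (\<eta>\<^sup>2) N) \<le> K0 * G * (Y / \<epsilon>)"
      using S_le unfolding S' by (subst (asm) ennreal_le_iff) (use K0 G Ye in \<open>intro mult_nonneg_nonneg; simp\<close>)
    also have "\<dots> \<le> K * (Y / \<epsilon>)" using K0 Ye unfolding K_def by (intro mult_right_mono) auto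
    finally have U: "(\<Sum>N. kernel_coeff \<alpha> \<beta> (\<xi>\<^sup>2) (\<eta>\<^sup>2) N) \<le> K * (Y / \<epsilon>)" .
    have "exp (-2) / K0 * (Y / \<epsilon>) \<le> (\<Sum>N. kernel_coeff \<alpha> \<beta> (\<xi>\<^sup>2) (\<eta>\<^sup>2) N)"
      using S_ge Ss unfolding S' by (subst (asm) ennreal_le_iff) auto
    then have "Y / \<epsilon> \<le> K0 * exp 2 * (\<Sum>N. kernel_coeff \<alpha> \<beta> (\<xi>\<^sup>2) (\<eta>\<^sup>2) N)"
      using K0 eps by (simp add: exp_minus field_simps)
    also have "\<dots> \<le> K * (\<Sum>N. kernel_coeff \<alpha> \<beta> (\<xi>\<^sup>2) (\<eta>\<^sup>2) N)"
      using Ss K0 G unfolding K_def by (intro mult_right_mono) auto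
    finally have L: "Y / \<epsilon> \<le> K * (\<Sum>N. kernel_coeff \<alpha> \<beta> (\<xi>\<^sup>2) (\<eta>\<^sup>2) N)" .
    have "\<epsilon> + \<xi> = 1 - \<eta>" "\<epsilon> + \<eta> = 1 - \<xi>" by (simp_all add: \<epsilon>_def)
    then have "Y / \<epsilon> = (1 - \<eta>) powr - a * (1 - \<xi>) powr - b / (1 - \<xi> - \<eta>)"
      unfolding Y_def by (simp add: \<epsilon>_def)
    with U L sm show ?thesis by simp
  qed
  show ?thesis
    by (rule that[of K]) (use K main in \<open>auto simp: a_def b_def\<close>)
qed

section \<open>Summation of the kernel\<close>

lemma poisson_binomial_sums:
  assumes "\<bar>r\<bar> < 1"
  shows "(\<lambda>j. poisson_binomial \<nu> j * r ^ j) sums ((1 - r) * (1 + r) powr - \<nu>)"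
proof -
  define g where "g j = (if j = 0 then 0 else (- \<nu> gchoose (j - 1))) * r ^ j" for j
  have 1: "(\<lambda>j. (- \<nu> gchoose j) * r ^ j) sums (1 + r) powr - \<nu>"
    using assms by (rule gen_binomial_real)
  have "(\<lambda>j. g (Suc j)) sums (r * (1 + r) powr - \<nu>)"
    using sums_mult[OF 1, of r] by (simp add: g_def mult_ac)
  then have "g sums (r * (1 + r) powr - \<nu>)"
    unfolding sums_Suc_iff by (simp add: g_def)
  from sums_diff[OF 1 this] show ?thesis
    by (simp add: poisson_binomial_def g_def algebra_simps)
qed

text \<open>The binomial coefficients of - \<nu> alternate in sign, so absolute values amount to
  replacing r by - r in the binomial series. The resulting 1 - r in place of 1 + r is what ties the
  absolute convergence argument for the double series to small r.\<close>

lemma poisson_binomial_abs_sums: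
  assumes "0 \<le> r" "r < 1" "\<nu> > 0"
  shows "summable (\<lambda>j. \<bar>poisson_binomial \<nu> j\<bar> * r ^ j)"
    and "(\<Sum>j. \<bar>poisson_binomial \<nu> j\<bar> * r ^ j) \<le> (1 + r) * (1 - r) powr - \<nu>"
proof -
  define c where "c j = \<bar>- \<nu> gchoose j\<bar>" for j
  define g where "g j = (if j = 0 then 0 else c (j - 1)) * r ^ j" for j
  have c: "c j * r ^ j = (- \<nu> gchoose j) * (- r) ^ j" for j
  proof -
    have p: "pochhammer \<nu> j \<ge> 0" using assms by (intro pochhammer_nonneg)
    have "(- \<nu> gchoose j) * (- r) ^ j = ((-1) ^ j * (-1) ^ j) * (pochhammer \<nu> j / fact j) * r ^ j"
      unfolding gbinomial_pochhammer power_minus[of r] by simp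
    also have "(-1::real) ^ j * (-1) ^ j = 1" by (simp flip: power_mult_distrib)
    also have "1 * (pochhammer \<nu> j / fact j) = c j"
      using p by (simp add: c_def gbinomial_pochhammer abs_mult)
    finally show ?thesis ..
  qed
  have 1: "(\<lambda>j. c j * r ^ j) sums (1 - r) powr - \<nu>"
    unfolding c using gen_binomial_real[of "- r" "- \<nu>"] assms by simp
  have "(\<lambda>j. g (Suc j)) sums (r * (1 - r) powr - \<nu>)"
    using sums_mult[OF 1, of r] by (simp add: g_def mult_ac)
  then have 2: "g sums (r * (1 - r) powr - \<nu>)"
    unfolding sums_Suc_iff by (simp add: g_def)
  have s: "(\<lambda>j. c j * r ^ j + g j) sums ((1 + r) * (1 - r) powr - \<nu>)"
    using sums_add[OF 1 2] by (simp add: algebra_simps)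
  have le: "\<bar>poisson_binomial \<nu> j\<bar> * r ^ j \<le> c j * r ^ j + g j" for j
    unfolding g_def distrib_right[symmetric] using assms
    by (intro mult_right_mono) (auto simp: poisson_binomial_def c_def intro: abs_triangle_ineq4)
  show sm: "summable (\<lambda>j. \<bar>poisson_binomial \<nu> j\<bar> * r ^ j)"
    by (rule summable_comparison_test'[where N = 0, OF sums_summable[OF s]]) (use le assms in auto)
  show "(\<Sum>j. \<bar>poisson_binomial \<nu> j\<bar> * r ^ j) \<le> (1 + r) * (1 - r) powr - \<nu>"
    using sums_le[OF le summable_sums[OF sm] s] .
qed

lemma powr_minus_even_shift:
  fixes y :: real
  assumes "y > 0"
  shows "y powr - (2 * real N + \<mu>) = y powr - \<mu> * (1 / y\<^sup>2) ^ N"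
proof -
  have "y powr - (2 * real N + \<mu>) = y powr - \<mu> * y powr - real (2 * N)"
    by (simp add: powr_add[symmetric] algebra_simps)
  also have "y powr - real (2 * N) = (1 / y\<^sup>2) ^ N"
    using assms by (simp only: powr_minus powr_realpow) (simp add: power_mult power_divide divide_inverse power_inverse)
  finally show ?thesis .
qed

text \<open>At U = X Y and V = (1 - X) (1 - Y) this is the M-th product of normalised polynomials,
  that is, the coefficient of r^M in the kernel up to the factor exp (- t (\<alpha> + \<beta> + 1) /
  2).\<close>

definition poisson_coeff :: "real \<Rightarrow> real \<Rightarrow> real \<Rightarrow> real \<Rightarrow> nat \<Rightarrow> real" where
  "poisson_coeff \<alpha> \<beta> U V M = (\<Sum>N\<le>M. Gamma (2 * real N + \<alpha> + \<beta> + 2) * poisson_binomial (2 * real N + \<alpha> + \<beta> + 2) (M - N) *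
       bessel_product_coeff \<alpha> \<beta> U V N)"

text \<open>The double series over N and j = M - N is summed in both orders. Taking absolute values
  turns (1 + r)^2 into (1 - r)^2, so the domination used here asks for 4 r < (1 - r)^2; r < 1/10 is
  a convenient sufficient bound.\<close>

lemma poisson_coeff_sums_small:
  assumes ab: "\<alpha> \<ge> -1/2" "\<beta> \<ge> -1/2" and UV: "U \<ge> 0" "V \<ge> 0"
    and k: "\<And>z. 0 \<le> z \<Longrightarrow> z < 1 \<Longrightarrow> summable (\<lambda>N. kernel_coeff \<alpha> \<beta> U V N * z ^ N)"
    and r: "0 < r" "r < 1 / 10"
  shows "(\<lambda>M. poisson_coeff \<alpha> \<beta> U V M * r ^ M) sums
    ((1 - r) * (1 + r) powr - (\<alpha> + \<beta> + 2) * (\<Sum>N. kernel_coeff \<alpha> \<beta> U V N * (4 * r / (1 + r)\<^sup>2) ^ N))"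
proof -
  define \<mu> where "\<mu> = \<alpha> + \<beta> + 2"
  have mu: "\<mu> > 0" using ab by (simp add: \<mu>_def)
  define G where "G N = Gamma (2 * real N + \<mu>) * bessel_product_coeff \<alpha> \<beta> U V N * r ^ N" for N
  have kG: "kernel_coeff \<alpha> \<beta> U V N * (4 * r * x) ^ N = G N * x ^ N" for N x
    by (simp add: kernel_coeff_def G_def \<mu>_def power_mult_distrib add_ac)
  have G0: "G N \<ge> 0" for N
    unfolding G_def using ab UV r mu
    by (intro mult_nonneg_nonneg bessel_product_coeff_nonneg Gamma_real_nonneg) auto
  define f where "f = (\<lambda>(N, j). G N * (poisson_binomial (2 * real N + \<mu>) j * r ^ j))"
  define gn where "gn N = G N * (\<Sum>j. \<bar>poisson_binomial (2 * real N + \<mu>) j\<bar> * r ^ j)" for N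
  have nf: "norm (f (N, j)) = G N * (\<bar>poisson_binomial (2 * real N + \<mu>) j\<bar> * r ^ j)" for N j
    using G0[of N] r by (simp add: f_def abs_mult)
  have hn: "((\<lambda>j. norm (f (N, j))) has_sum gn N) UNIV" for N
    unfolding nf gn_def
    using poisson_binomial_abs_sums(1)[of r "2 * real N + \<mu>"] r mu G0[of N]
    by (intro sums_nonneg_imp_has_sum sums_mult summable_sums) auto
  have "summable gn"
  proof (rule summable_comparison_test'[where N = 0])
    have z: "4 * r * (1 / (1 - r)\<^sup>2) < 1"
    proof -
      have "(9/10)\<^sup>2 \<le> (1 - r)\<^sup>2" using r by (intro power_mono) auto
      then have "4 * r < (1 - r)\<^sup>2" using r by (simp add: power2_eq_square)
      then show ?thesis using r by (simp add: field_simps)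
    qed
    have "summable (\<lambda>N. kernel_coeff \<alpha> \<beta> U V N * (4 * r * (1 / (1 - r)\<^sup>2)) ^ N)"
      using z r by (intro k) auto
    then show "summable (\<lambda>N. (1 + r) * (1 - r) powr - \<mu> * (G N * (1 / (1 - r)\<^sup>2) ^ N))"
      unfolding kG by (rule summable_mult)
    fix N
    have "gn N \<le> G N * ((1 + r) * (1 - r) powr - (2 * real N + \<mu>))"
      unfolding gn_def using r mu G0 by (intro mult_left_mono poisson_binomial_abs_sums) auto
    also have "\<dots> = (1 + r) * (1 - r) powr - \<mu> * (G N * (1 / (1 - r)\<^sup>2) ^ N)"
      using r by (subst powr_minus_even_shift) auto
    finally show "norm (gn N) \<le> (1 + r) * (1 - r) powr - \<mu> * (G N * (1 / (1 - r)\<^sup>2) ^ N)"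
      using has_sum_nonneg[OF hn[of N]] by simp
  qed
  moreover have "gn N \<ge> 0" for N using has_sum_nonneg[OF hn[of N]] by simp
  ultimately have "gn summable_on UNIV" by (rule summable_nonneg_imp_summable_on)
  then have "(\<lambda>p. norm (f p)) summable_on (Sigma UNIV (\<lambda>_. UNIV))"
    by (rule summable_on_SigmaI[OF hn]) auto
  then have "f summable_on (Sigma UNIV (\<lambda>_. UNIV))" by (rule abs_summable_summable)
  then obtain S where S: "(f has_sum S) (Sigma UNIV (\<lambda>_. UNIV))" by (auto simp: summable_on_def)
  have "((\<lambda>j. f (N, j)) has_sum (G N * ((1 - r) * (1 + r) powr - (2 * real N + \<mu>)))) UNIV" for N
  proof (rule norm_summable_imp_has_sum)
    show "summable (\<lambda>j. norm (f (N, j)))"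
      unfolding nf using r mu by (intro summable_mult poisson_binomial_abs_sums) auto
    show "(\<lambda>j. f (N, j)) sums (G N * ((1 - r) * (1 + r) powr - (2 * real N + \<mu>)))"
      unfolding f_def prod.case using r by (intro sums_mult poisson_binomial_sums) auto
  qed
  from has_sum_imp_sums[OF has_sum_SigmaD[OF S this]]
  have "(\<lambda>N. G N * ((1 - r) * (1 + r) powr - (2 * real N + \<mu>))) sums S" by simp
  also have "(\<lambda>N. G N * ((1 - r) * (1 + r) powr - (2 * real N + \<mu>))) =
     (\<lambda>N. (1 - r) * (1 + r) powr - \<mu> * (kernel_coeff \<alpha> \<beta> U V N * (4 * r * (1 / (1 + r)\<^sup>2)) ^ N))"
    unfolding kG using r by (subst powr_minus_even_shift) auto
  finally have S1: "(\<lambda>N. (1 - r) * (1 + r) powr - \<mu> * (kernel_coeff \<alpha> \<beta> U V N * (4 * r * (1 / (1 + r)\<^sup>2)) ^ N)) sums S" .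
  have z: "4 * r * (1 / (1 + r)\<^sup>2) < 1"
  proof -
    have "0 < (1 - r)\<^sup>2" using r by simp
    then have "4 * r < (1 + r)\<^sup>2" by (simp add: power2_eq_square algebra_simps)
    then show ?thesis using r by (simp add: field_simps)
  qed
  have Sval: "S = (1 - r) * (1 + r) powr - \<mu> * (\<Sum>N. kernel_coeff \<alpha> \<beta> U V N * (4 * r * (1 / (1 + r)\<^sup>2)) ^ N)"
    using z r by (intro sums_unique2[OF S1] sums_mult summable_sums k) auto
  have "(f has_sum S) (Sigma UNIV (\<lambda>_. UNIV)) \<longleftrightarrow>
     ((\<lambda>(M, N). f (N, M - N)) has_sum S) (Sigma UNIV (\<lambda>M. {..M}))"
    by (rule has_sum_reindex_bij_witness[where i = "\<lambda>(M, N). (N, M - N)" and j = "\<lambda>(N, j). (N + j, N)"]) auto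
  with S have S2: "((\<lambda>(M, N). f (N, M - N)) has_sum S) (Sigma UNIV (\<lambda>M. {..M}))" by simp
  have "((\<lambda>N. (\<lambda>(M, N). f (N, M - N)) (M, N)) has_sum (poisson_coeff \<alpha> \<beta> U V M * r ^ M)) {..M}" for M
  proof (rule has_sum_finiteI)
    show "poisson_coeff \<alpha> \<beta> U V M * r ^ M = (\<Sum>N\<le>M. (\<lambda>(M, N). f (N, M - N)) (M, N))"
      unfolding poisson_coeff_def sum_distrib_right
    proof (intro sum.cong refl)
      fix N assume "N \<in> {..M}"
      then have "r ^ M = r ^ N * r ^ (M - N)" by (simp add: power_add[symmetric])
      then show "Gamma (2 * real N + \<alpha> + \<beta> + 2) * poisson_binomial (2 * real N + \<alpha> + \<beta> + 2) (M - N) *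
        bessel_product_coeff \<alpha> \<beta> U V N * r ^ M = (\<lambda>(M, N). f (N, M - N)) (M, N)"
        by (simp add: f_def G_def \<mu>_def add_ac)
    qed
  qed simp
  from has_sum_imp_sums[OF has_sum_SigmaD[OF S2 this]] show ?thesis
    unfolding Sval \<mu>_def by simp
qed

text \<open>The double series behind the previous lemma converges absolutely only for small \<open>r\<close>.
  The identity extends to \<open>0 < r < 1\<close> by analytic continuation inside the star-shaped
  region where \<open>\<bar>4 z / (1 + z)\<^sup>2\<bar> < 1\<close>.\<close>

lemma poisson_coeff_suminf:
  assumes ab: "\<alpha> \<ge> -1/2" "\<beta> \<ge> -1/2" and UV: "U \<ge> 0" "V \<ge> 0"
    and k: "\<And>z. 0 \<le> z \<Longrightarrow> z < 1 \<Longrightarrow> summable (\<lambda>N. kernel_coeff \<alpha> \<beta> U V N * z ^ N)"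
    and Q: "\<And>r. 0 \<le> r \<Longrightarrow> r < 1 \<Longrightarrow> summable (\<lambda>M. \<bar>poisson_coeff \<alpha> \<beta> U V M\<bar> * r ^ M)"
    and r: "0 < r" "r < 1"
  shows "(\<Sum>M. poisson_coeff \<alpha> \<beta> U V M * r ^ M) =
    (1 - r) * (1 + r) powr - (\<alpha> + \<beta> + 2) * (\<Sum>N. kernel_coeff \<alpha> \<beta> U V N * (4 * r / (1 + r)\<^sup>2) ^ N)"
proof -
  define \<mu> where "\<mu> = \<alpha> + \<beta> + 2"
  define q where "q = poisson_coeff \<alpha> \<beta> U V"
  define \<kappa> where "\<kappa> = kernel_coeff \<alpha> \<beta> U V"
  have k0: "\<kappa> N \<ge> 0" for N unfolding \<kappa>_def using ab UV by (intro kernel_coeff_nonneg)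
  define L where "L z = (\<Sum>M. of_real (q M) * z ^ M)" for z :: complex
  define P where "P z = (\<Sum>N. of_real (\<kappa> N) * z ^ N)" for z :: complex
  define R where "R z = (1 - z) * (1 + z) powr (- of_real \<mu>) * P (4 * z / (1 + z)\<^sup>2)" for z
  define D where "D = {z::complex. norm z < 1 \<and> 4 * norm z < (norm (1 + z))\<^sup>2}"
  have Lsum: "(\<lambda>M. of_real (q M) * z ^ M) sums L z" if "norm z < 1" for z
  proof -
    have "summable (\<lambda>M. norm (of_real (q M) * z ^ M))"
      using Q[of "norm z"] that by (simp add: norm_mult norm_power q_def)
    then show ?thesis unfolding L_def by (rule summable_sums[OF summable_norm_cancel])
  qed
  have Psum: "(\<lambda>N. of_real (\<kappa> N) * z ^ N) sums P z" if "norm z < 1" for z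
  proof -
    have "summable (\<lambda>N. norm (of_real (\<kappa> N) * z ^ N))"
      using k[of "norm z"] that k0 by (simp add: norm_mult norm_power \<kappa>_def)
    then show ?thesis unfolding P_def by (rule summable_sums[OF summable_norm_cancel])
  qed
  have L_hol: "L holomorphic_on ball 0 1"
    by (rule power_series_holomorphic[where a = "\<lambda>n. of_real (q n)"]) (use Lsum in auto)
  have P_hol: "P holomorphic_on ball 0 1"
    by (rule power_series_holomorphic[where a = "\<lambda>n. of_real (\<kappa> n)"]) (use Psum in auto)
  have D1: "1 + z \<noteq> 0" "norm (4 * z / (1 + z)\<^sup>2) < 1" "1 + z \<notin> \<real>\<^sub>\<le>\<^sub>0" if "z \<in> D" for z
  proof -
    have "norm z < 1" using that by (simp add: D_def)
    then have re: "Re (1 + z) > 0" using abs_Re_le_cmod[of z] by simp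
    then show nz: "1 + z \<noteq> 0" by (metis less_irrefl zero_complex.sel(1))
    then show "norm (4 * z / (1 + z)\<^sup>2) < 1"
      using \<open>z \<in> D\<close> by (simp add: D_def norm_divide norm_mult norm_power)
    show "1 + z \<notin> \<real>\<^sub>\<le>\<^sub>0" using re by (auto simp: complex_nonpos_Reals_iff)
  qed
  have "(P \<circ> (\<lambda>z. 4 * z / (1 + z)\<^sup>2)) holomorphic_on D"
  proof (rule holomorphic_on_compose_gen[OF _ P_hol])
    show "(\<lambda>z. 4 * z / (1 + z)\<^sup>2) holomorphic_on D"
      using D1(1) by (intro holomorphic_intros) auto
    show "(\<lambda>z. 4 * z / (1 + z)\<^sup>2) ` D \<subseteq> ball 0 1" using D1(2) by auto
  qed
  then have P_hol': "(\<lambda>z. P (4 * z / (1 + z)\<^sup>2)) holomorphic_on D" by (simp add: o_def)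
  have R_hol: "R holomorphic_on D"
    unfolding R_def using D1(3) by (intro holomorphic_intros P_hol') auto
  have hol: "(\<lambda>z. L z - R z) holomorphic_on D"
    by (intro holomorphic_intros R_hol holomorphic_on_subset[OF L_hol]) (auto simp: D_def)
  have "D = {z. norm z < 1} \<inter> {z. 4 * norm z < (norm (1 + z))\<^sup>2}" by (auto simp: D_def)
  then have D_open: "open D"
    by (auto intro!: open_Int open_Collect_less continuous_intros)
  have D_conn: "connected D"
  proof (rule starlike_imp_connected)
    have "closed_segment 0 z \<subseteq> D" if z: "z \<in> D" for z
    proof
      fix w assume "w \<in> closed_segment 0 z"
      then obtain u where u: "0 \<le> u" "u \<le> 1" "w = of_real u * z"
        by (auto simp: closed_segment_def scaleR_conv_of_real)
      have n2: "(norm (1 + of_real v * z))\<^sup>2 = 1 + 2 * v * Re z + v\<^sup>2 * (norm z)\<^sup>2" for v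
        unfolding cmod_power2 by (simp add: power2_eq_square algebra_simps)
      have nw: "norm w = u * norm z" using u by (simp add: norm_mult)
      have z1: "norm z < 1" "4 * norm z < 1 + 2 * Re z + (norm z)\<^sup>2"
        using z n2[of 1] by (auto simp: D_def)
      have nz2: "(norm z)\<^sup>2 \<le> 1" using z1(1) by (simp add: power_le_one)
      \<comment> \<open>The squared norm of 1 + u z exceeds u times that of 1 + z by (1 - u) (1 - u
        |z|^2), which is nonnegative in the unit disc.\<close>
      have "4 * norm w < (norm (1 + w))\<^sup>2"
      proof (cases "u = 0")
        case True
        then show ?thesis using u by simp
      next
        case False
        then have "u * (4 * norm z) < u * (1 + 2 * Re z + (norm z)\<^sup>2)"
          using u z1(2) by (intro mult_strict_left_mono) auto
        moreover have "(1 - u) * (1 - u * (norm z)\<^sup>2) \<ge> 0"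
          using u nz2 by (intro mult_nonneg_nonneg) (auto simp: mult_le_one)
        moreover have "(norm (1 + w))\<^sup>2 = 1 + 2 * u * Re z + u\<^sup>2 * (norm z)\<^sup>2"
          unfolding u(3) by (rule n2)
        ultimately show ?thesis unfolding nw by (simp add: power2_eq_square algebra_simps)
      qed
      moreover have "norm w < 1"
        using mult_left_le_one_le[OF norm_ge_zero[of z] u(1,2)] z1(1) unfolding nw by linarith
      ultimately show "w \<in> D" by (simp add: D_def)
    qed
    moreover have "(0::complex) \<in> D" by (simp add: D_def)
    ultimately show "starlike D" by (auto simp: starlike_def)
  qed
  have Lr: "L (of_real x) = of_real (\<Sum>M. q M * x ^ M)" if "0 \<le> x" "x < 1" for x
  proof -
    have "summable (\<lambda>M. norm (q M * x ^ M))"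
      using Q[OF that] that by (simp add: abs_mult q_def)
    then have "summable (\<lambda>M. q M * x ^ M)" by (rule summable_norm_cancel)
    then have "(\<lambda>M. of_real (q M * x ^ M)) sums (of_real (\<Sum>M. q M * x ^ M) :: complex)"
      by (intro sums_of_real summable_sums)
    then show ?thesis unfolding L_def by (simp add: sums_iff)
  qed
  have x_le: "4 * x / (1 + x)\<^sup>2 < 1" "4 * x / (1 + x)\<^sup>2 \<ge> 0" if "0 \<le> x" "x < 1" for x :: real
  proof -
    have "0 < (1 - x)\<^sup>2" using that by simp
    then have "4 * x < (1 + x)\<^sup>2" by (simp add: power2_eq_square algebra_simps)
    then show "4 * x / (1 + x)\<^sup>2 < 1" using that by (simp add: field_simps)
  qed (use that in simp)
  have Rr: "R (of_real x) = of_real ((1 - x) * (1 + x) powr - \<mu> * (\<Sum>N. \<kappa> N * (4 * x / (1 + x)\<^sup>2) ^ N))"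
    if x: "0 \<le> x" "x < 1" for x
  proof -
    have "summable (\<lambda>N. \<kappa> N * (4 * x / (1 + x)\<^sup>2) ^ N)"
      using x_le[OF x] unfolding \<kappa>_def by (intro k)
    then have "(\<lambda>N. of_real (\<kappa> N * (4 * x / (1 + x)\<^sup>2) ^ N)) sums (of_real (\<Sum>N. \<kappa> N * (4 * x / (1 + x)\<^sup>2) ^ N) :: complex)"
      by (intro sums_of_real summable_sums)
    then have "P (of_real (4 * x / (1 + x)\<^sup>2)) = of_real (\<Sum>N. \<kappa> N * (4 * x / (1 + x)\<^sup>2) ^ N)"
      unfolding P_def by (simp add: sums_iff)
    moreover have "(1 + of_real x :: complex) powr (- of_real \<mu>) = of_real ((1 + x) powr - \<mu>)"
      using x powr_of_real[of "1 + x" "- \<mu>"] by simp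
    ultimately show ?thesis unfolding R_def by simp
  qed
  \<comment> \<open>The two sides agree on (0, 1/10), which accumulates at the point 0 of
    \<open>D\<close>; every r in (0, 1) lies in \<open>D\<close> because (1 - r)^2 > 0.\<close>
  have "L (of_real r) - R (of_real r) = 0"
  proof (rule analytic_continuation[OF hol D_open D_conn])
    show "of_real ` {0<..<1/10} \<subseteq> D"
    proof safe
      fix x :: real assume x: "x \<in> {0<..<1/10}"
      then have "0 < (1 - x)\<^sup>2" by simp
      then have "4 * x < (1 + x)\<^sup>2" by (simp add: power2_eq_square algebra_simps)
      moreover have "norm (1 + of_real x :: complex) = \<bar>1 + x\<bar>"
        by (metis norm_of_real of_real_1 of_real_add)
      ultimately show "complex_of_real x \<in> D" using x by (simp add: D_def)
    qed
    show "(0::complex) \<in> D" by (simp add: D_def)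
    show "(0::complex) islimpt of_real ` {0<..<1/10}"
      unfolding islimpt_approachable
    proof (intro allI impI)
      fix e :: real assume e: "e > 0"
      define x where "x = min (e / 2) (1 / 20)"
      have "x \<in> {0<..<1/10}" "x < e" using e by (auto simp: x_def)
      then show "\<exists>x'\<in>of_real ` {0<..<1/10}. x' \<noteq> (0::complex) \<and> dist x' 0 < e"
        by (intro bexI[of _ "of_real x"]) auto
    qed
    show "L z - R z = 0" if "z \<in> of_real ` {0<..<1/10}" for z
    proof -
      from that obtain x where x: "z = of_real x" "0 < x" "x < 1 / 10" by auto
      have "(\<Sum>M. q M * x ^ M) = (1 - x) * (1 + x) powr - \<mu> * (\<Sum>N. \<kappa> N * (4 * x / (1 + x)\<^sup>2) ^ N)"
        using poisson_coeff_sums_small[OF ab UV k x(2,3)] unfolding q_def \<kappa>_def \<mu>_def by (simp add: sums_iff)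
      then show ?thesis using Lr[of x] Rr[of x] x by simp
    qed
    show "of_real r \<in> D"
    proof -
      have "0 < (1 - r)\<^sup>2" using r by simp
      then have "4 * r < (1 + r)\<^sup>2" by (simp add: power2_eq_square algebra_simps)
      moreover have "norm (1 + of_real r :: complex) = \<bar>1 + r\<bar>"
        by (metis norm_of_real of_real_1 of_real_add)
      ultimately show ?thesis using r by (simp add: D_def)
    qed
  qed
  then have "complex_of_real (\<Sum>M. q M * r ^ M) = of_real ((1 - r) * (1 + r) powr - \<mu> * (\<Sum>N. \<kappa> N * (4 * r / (1 + r)\<^sup>2) ^ N))"
    using Lr[of r] Rr[of r] r by simp
  then show ?thesis unfolding of_real_eq_iff q_def \<kappa>_def \<mu>_def .
qed

section \<open>The kernel estimates\<close>

text \<open>With r = exp (-t) and \<lambda> \<ge> 0, which removes the absolute value in the kernel: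
  4 r / (1 + r)^2 = 1 / cosh^2 (t / 2), (1 - r) / (1 + r) = tanh (t / 2), and exp (- t \<lambda> /
  2) (1 + r) powr - \<lambda> = (2 cosh (t / 2)) powr - \<lambda>. One factor of (1 + r) powr
  -(\<lambda> + 1) goes into tanh.\<close>

lemma poisson_jacobi_kernel_eq:
  assumes ab: "\<alpha> \<ge> -1/2" "\<beta> \<ge> -1/2" and t: "t > 0"
    and \<theta>: "\<theta> \<in> {0..pi}" and \<phi>: "\<phi> \<in> {0..pi}"
  shows "poisson_jacobi_kernel \<alpha> \<beta> t \<theta> \<phi> = tanh (t / 2) * (2 * cosh (t / 2)) powr - (\<alpha> + \<beta> + 1) *
    (\<Sum>N. kernel_coeff \<alpha> \<beta> ((sin (\<theta> / 2) * sin (\<phi> / 2) / cosh (t / 2))\<^sup>2) ((cos (\<theta> / 2) * cos (\<phi> / 2) / cosh (t / 2))\<^sup>2) N)"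
proof -
  define lam where "lam = \<alpha> + \<beta> + 1"
  have lam: "lam \<ge> 0" using ab by (simp add: lam_def)
  define r where "r = exp (- t)"
  have r: "0 < r" "r < 1" using t by (simp_all add: r_def)
  define c where "c = cosh (t / 2)"
  have c: "c > 0" by (simp add: c_def)
  define X Y where "X = (1 - cos \<theta>) / 2" and "Y = (1 - cos \<phi>) / 2"
  define x y where "x = sin (\<theta> / 2) * sin (\<phi> / 2)" and "y = cos (\<theta> / 2) * cos (\<phi> / 2)"
  have XY: "X \<in> {0..1}" "Y \<in> {0..1}"
    using cos_ge_minus_one[of \<theta>] cos_le_one[of \<theta>] cos_ge_minus_one[of \<phi>] cos_le_one[of \<phi>]
    by (auto simp: X_def Y_def simp del: cos_ge_minus_one cos_le_one)
  have half: "(1 - cos u) / 2 = (sin (u / 2))\<^sup>2" "1 - (1 - cos u) / 2 = (cos (u / 2))\<^sup>2" for u :: real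
    using cos_double_sin[of "u / 2"] cos_double_cos[of "u / 2"] by simp_all
  have U: "X * Y = x\<^sup>2" and V: "(1 - X) * (1 - Y) = y\<^sup>2"
    unfolding X_def Y_def half(2) unfolding half(1) x_def y_def by (simp_all only: power_mult_distrib)
  have xy0: "x \<ge> 0" "y \<ge> 0"
    using \<theta> \<phi> unfolding x_def y_def by (auto intro!: mult_nonneg_nonneg sin_ge_zero cos_ge_zero)
  have xy1: "x + y \<le> 1"
    using cos_diff[of "\<theta> / 2" "\<phi> / 2"] cos_le_one[of "\<theta> / 2 - \<phi> / 2"] by (simp add: x_def y_def add.commute)
  have pc: "jacobi_weight n \<alpha> \<beta> * (poly (shifted_jacobi n \<alpha> \<beta>) X * poly (shifted_jacobi n \<alpha> \<beta>) Y) =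
     poisson_coeff \<alpha> \<beta> (x\<^sup>2) (y\<^sup>2) n" for n
    unfolding jacobi_weight_mult_shifted_jacobi[OF ab] U V poisson_coeff_def ..
  obtain K where Ks: "\<And>\<xi> \<eta>. \<xi> \<ge> 0 \<Longrightarrow> \<eta> \<ge> 0 \<Longrightarrow> \<xi> + \<eta> < 1 \<Longrightarrow> summable (kernel_coeff \<alpha> \<beta> (\<xi>\<^sup>2) (\<eta>\<^sup>2))"
    by (rule kernel_coeff_sum_bounds[OF ab]) (rule that; assumption)
  \<comment> \<open>Since x + y = cos ((\<theta> - \<phi>) / 2) is at most 1, the arguments scaled
    by sqrt z have a sum below 1, where the double series is already known to converge.\<close>
  have ks: "summable (\<lambda>N. kernel_coeff \<alpha> \<beta> (x\<^sup>2) (y\<^sup>2) N * z ^ N)" if z: "0 \<le> z" "z < 1" for z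
  proof -
    have "sqrt z * (x + y) \<le> sqrt z * 1" using z xy1 by (intro mult_left_mono) auto
    then have "sqrt z * x + sqrt z * y < 1" using z by (simp add: distrib_left) (smt (verit) real_sqrt_lt_1_iff)
    then have "summable (kernel_coeff \<alpha> \<beta> ((sqrt z * x)\<^sup>2) ((sqrt z * y)\<^sup>2))"
      using z xy0 by (intro Ks) auto
    also have "kernel_coeff \<alpha> \<beta> ((sqrt z * x)\<^sup>2) ((sqrt z * y)\<^sup>2) = (\<lambda>N. kernel_coeff \<alpha> \<beta> (x\<^sup>2) (y\<^sup>2) N * z ^ N)"
      using z by (intro ext) (simp add: power_mult_distrib kernel_coeff_scale)
    finally show ?thesis .
  qed
  have qs: "summable (\<lambda>M. \<bar>poisson_coeff \<alpha> \<beta> (x\<^sup>2) (y\<^sup>2) M\<bar> * s ^ M)" if "0 \<le> s" "s < 1" for s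
    using summable_jacobi_weight[OF ab XY that] unfolding pc .
  have summand: "exp (- t * \<bar>real n + (\<alpha> + \<beta> + 1) / 2\<bar>) * trig_jacobi n \<alpha> \<beta> \<theta> * trig_jacobi n \<alpha> \<beta> \<phi> =
     exp (- (t / 2) * lam) * (poisson_coeff \<alpha> \<beta> (x\<^sup>2) (y\<^sup>2) n * r ^ n)" for n
  proof -
    have "\<bar>real n + (\<alpha> + \<beta> + 1) / 2\<bar> = real n + lam / 2" using lam by (simp add: lam_def)
    then have "exp (- t * \<bar>real n + (\<alpha> + \<beta> + 1) / 2\<bar>) = exp (- (t / 2) * lam) * r ^ n"
      by (simp add: r_def exp_of_nat_mult[symmetric] exp_add[symmetric] algebra_simps)
    moreover have "trig_jacobi n \<alpha> \<beta> \<theta> * trig_jacobi n \<alpha> \<beta> \<phi> = poisson_coeff \<alpha> \<beta> (x\<^sup>2) (y\<^sup>2) n"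
      unfolding trig_jacobi_mult[OF ab] pc[symmetric] X_def Y_def ..
    ultimately show ?thesis by (simp add: mult.assoc)
  qed
  have "summable (\<lambda>n. norm (poisson_coeff \<alpha> \<beta> (x\<^sup>2) (y\<^sup>2) n * r ^ n))"
    using qs[of r] r by (simp add: abs_mult)
  then have "poisson_jacobi_kernel \<alpha> \<beta> t \<theta> \<phi> = exp (- (t / 2) * lam) * (\<Sum>n. poisson_coeff \<alpha> \<beta> (x\<^sup>2) (y\<^sup>2) n * r ^ n)"
    unfolding poisson_jacobi_kernel_def summand by (intro suminf_mult) (rule summable_norm_cancel)
  also have "(\<Sum>n. poisson_coeff \<alpha> \<beta> (x\<^sup>2) (y\<^sup>2) n * r ^ n) =
     (1 - r) * (1 + r) powr - (\<alpha> + \<beta> + 2) * (\<Sum>N. kernel_coeff \<alpha> \<beta> (x\<^sup>2) (y\<^sup>2) N * (4 * r / (1 + r)\<^sup>2) ^ N)"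
    by (rule poisson_coeff_suminf[OF ab _ _ ks qs r]) auto
  also have "4 * r / (1 + r)\<^sup>2 = 1 / c\<^sup>2"
  proof -
    have "2 * c = exp (t / 2) * (1 + r)"
      by (simp add: c_def cosh_field_def r_def distrib_left exp_add[symmetric])
    then have "(2 * c)\<^sup>2 = (exp (t / 2) * (1 + r))\<^sup>2" by simp
    also have "\<dots> = (exp (t / 2))\<^sup>2 * (1 + r)\<^sup>2" by (rule power_mult_distrib)
    also have "(exp (t / 2))\<^sup>2 = exp t"
      unfolding power2_eq_square exp_add[symmetric] by simp
    finally have "4 * c\<^sup>2 * r = (exp t * r) * (1 + r)\<^sup>2" by (simp add: power_mult_distrib)
    also have "exp t * r = 1" by (simp add: r_def exp_minus)
    finally show ?thesis using r c by (simp add: field_simps)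
  qed
  also have "(\<Sum>N. kernel_coeff \<alpha> \<beta> (x\<^sup>2) (y\<^sup>2) N * (1 / c\<^sup>2) ^ N) = (\<Sum>N. kernel_coeff \<alpha> \<beta> ((x / c)\<^sup>2) ((y / c)\<^sup>2) N)"
    unfolding kernel_coeff_scale[symmetric] by (simp add: power_divide)
  also have "exp (- (t / 2) * lam) * ((1 - r) * (1 + r) powr - (\<alpha> + \<beta> + 2) * (\<Sum>N. kernel_coeff \<alpha> \<beta> ((x / c)\<^sup>2) ((y / c)\<^sup>2) N))
     = ((1 - r) / (1 + r)) * (exp (- (t / 2) * lam) * (1 + r) powr - lam) * (\<Sum>N. kernel_coeff \<alpha> \<beta> ((x / c)\<^sup>2) ((y / c)\<^sup>2) N)"
  proof -
    have "(1 + r) powr - (\<alpha> + \<beta> + 2) = (1 + r) powr (- lam + - 1)" by (simp add: lam_def)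
    also have "\<dots> = (1 + r) powr - lam / (1 + r)" using r unfolding powr_add by (simp add: powr_minus_divide)
    finally show ?thesis by simp
  qed
  also have "(1 - r) / (1 + r) = tanh (t / 2)" by (simp add: tanh_real_altdef r_def)
  also have "exp (- (t / 2) * lam) * (1 + r) powr - lam = (2 * c) powr - lam"
  proof -
    have "2 * c = exp (t / 2) * (1 + r)"
      by (simp add: c_def cosh_field_def r_def distrib_left exp_add[symmetric])
    then have "(2 * c) powr - lam = exp (t / 2) powr - lam * (1 + r) powr - lam"
      using r by (simp add: powr_mult)
    then show ?thesis by (simp add: powr_def mult.commute)
  qed
  finally show ?thesis by (simp add: x_def y_def c_def lam_def)
qed

section \<open>Elementary bounds for powers, trigonometric and hyperbolic functions\<close>

lemma powr_quotient_mono: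
  fixes a b :: real
  assumes "a \<ge> 0" "b \<ge> 0" "0 < p1" "p1 \<le> s1" "0 < p2" "p2 \<le> s2" "0 < p3" "p3 \<le> s3"
  shows "s1 powr - a * s2 powr - b / s3 \<le> p1 powr - a * p2 powr - b / p3"
  using assms by (intro frac_le mult_mono powr_mono2') auto

lemma powr_quotient_scale:
  fixes a b :: real
  assumes "B > 0" "p1 > 0" "p2 > 0" "p3 > 0"
  shows "(B * p1) powr - a * (B * p2) powr - b / (B * p3) = B powr - (a + b + 1) * (p1 powr - a * p2 powr - b / p3)"
proof -
  have "B powr - (a + b + 1) = B powr (- a + - b + - 1)" by simp
  also have "\<dots> = B powr - a * B powr - b / B" using assms unfolding powr_add by (simp add: powr_minus_divide)
  finally show ?thesis using assms by (simp add: powr_mult)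
qed

lemma half_le_sin:
  fixes w :: real
  assumes "0 \<le> w" "w \<le> pi / 3"
  shows "w / 2 \<le> sin w"
proof -
  have "sin 0 - 0 / 2 \<le> sin w - w / 2"
  proof (rule DERIV_nonneg_imp_nondecreasing[of 0 w "\<lambda>x. sin x - x / 2"])
    fix x assume x: "0 \<le> x" "x \<le> w"
    then have "cos (pi / 3) \<le> cos x" using assms by (intro cos_monotone_0_pi_le) auto
    then have "cos x - 1 / 2 \<ge> 0" by (simp add: cos_60)
    moreover have "((\<lambda>x. sin x - x / 2) has_real_derivative (cos x - 1 / 2)) (at x)"
      by (auto intro!: derivative_eq_intros)
    ultimately show "\<exists>y. ((\<lambda>x. sin x - x / 2) has_real_derivative y) (at x) \<and> 0 \<le> y" by blast
  qed (use assms in auto)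
  then show ?thesis by simp
qed

lemma one_minus_cos_bounds:
  fixes u :: real
  assumes "\<bar>u\<bar> \<le> pi / 2"
  shows "u\<^sup>2 / 8 \<le> 1 - cos u" "1 - cos u \<le> u\<^sup>2 / 2"
proof -
  define w where "w = \<bar>u\<bar> / 2"
  have w: "0 \<le> w" "w \<le> pi / 3" using assms by (auto simp: w_def)
  have "cos u = cos (2 * w)" by (simp add: w_def)
  then have e: "1 - cos u = 2 * (sin w)\<^sup>2" by (simp add: cos_double_sin)
  have "(w / 2)\<^sup>2 \<le> (sin w)\<^sup>2" using half_le_sin[OF w] w by (intro power_mono) auto
  then show "u\<^sup>2 / 8 \<le> 1 - cos u" unfolding e by (simp add: w_def power_divide)
  have "(sin w)\<^sup>2 \<le> w\<^sup>2" using abs_sin_x_le_abs_x[of w] by (simp add: abs_le_square_iff)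
  then show "1 - cos u \<le> u\<^sup>2 / 2" unfolding e by (simp add: w_def power_divide)
qed

text \<open>The product is at most each of the cosines, so 1 minus it is at least the mean of the
  two one-variable quantities, whence 16 = 2 * 8. The upper bound is (1 - cos u) (1 - cos v) \<ge>
  0.\<close>

lemma one_minus_cos_mult_cos_bounds:
  fixes u v :: real
  assumes "\<bar>u\<bar> \<le> pi / 2" "\<bar>v\<bar> \<le> pi / 2"
  shows "(u\<^sup>2 + v\<^sup>2) / 16 \<le> 1 - cos u * cos v" "1 - cos u * cos v \<le> (u\<^sup>2 + v\<^sup>2) / 2"
proof -
  have c: "0 \<le> cos u" "0 \<le> cos v" using assms by (auto intro!: cos_ge_zero)
  have "cos u * cos v \<le> cos u" "cos u * cos v \<le> cos v"
    using c by (simp_all add: mult_left_le mult_left_le_one_le)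
  then show "(u\<^sup>2 + v\<^sup>2) / 16 \<le> 1 - cos u * cos v"
    using one_minus_cos_bounds(1)[OF assms(1)] one_minus_cos_bounds(1)[OF assms(2)] by simp
  have "0 \<le> (1 - cos u) * (1 - cos v)" by (intro mult_nonneg_nonneg) auto
  then show "1 - cos u * cos v \<le> (u\<^sup>2 + v\<^sup>2) / 2"
    using one_minus_cos_bounds(2)[OF assms(1)] one_minus_cos_bounds(2)[OF assms(2)] by (simp add: algebra_simps)
qed

lemma sinh_bounds:
  fixes v :: real
  assumes "v \<ge> 0"
  shows "v \<le> sinh v" "sinh v \<le> v * cosh v"
proof -
  have "sinh 0 - 0 \<le> sinh v - v"
  proof (rule DERIV_nonneg_imp_nondecreasing[of 0 v "\<lambda>x. sinh x - x"])
    fix x :: real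
    have "((\<lambda>x. sinh x - x) has_real_derivative (cosh x - 1)) (at x)"
      by (auto intro!: derivative_eq_intros)
    then show "\<exists>y. ((\<lambda>x. sinh x - x) has_real_derivative y) (at x) \<and> 0 \<le> y"
      using cosh_real_ge_1[of x] by (intro exI[of _ "cosh x - 1"]) simp
  qed (rule assms)
  then show "v \<le> sinh v" by simp
  have "0 * cosh 0 - sinh 0 \<le> v * cosh v - sinh v"
  proof (rule DERIV_nonneg_imp_nondecreasing[of 0 v "\<lambda>x. x * cosh x - sinh x"])
    fix x :: real assume "0 \<le> x"
    moreover have "((\<lambda>x. x * cosh x - sinh x) has_real_derivative (x * sinh x)) (at x)"
      by (auto intro!: derivative_eq_intros)
    ultimately show "\<exists>y. ((\<lambda>x. x * cosh x - sinh x) has_real_derivative y) (at x) \<and> 0 \<le> y"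
      by (intro exI[of _ "x * sinh x"]) simp
  qed (rule assms)
  then show "sinh v \<le> v * cosh v" by simp
qed

lemma cosh_minus_one_bounds:
  fixes t :: real
  assumes "t \<ge> 0"
  shows "t\<^sup>2 / 8 \<le> cosh (t / 2) - 1" "cosh (t / 2) - 1 \<le> t\<^sup>2 / 8 * (cosh (t / 2))\<^sup>2"
proof -
  define v where "v = t / 4"
  have v: "v \<ge> 0" using assms by (simp add: v_def)
  have "cosh (2 * v) - 1 = 2 * (sinh v)\<^sup>2" by (simp add: cosh_double_cosh sinh_square_eq)
  then have e: "cosh (t / 2) - 1 = 2 * (sinh v)\<^sup>2" by (simp add: v_def)
  have "v\<^sup>2 \<le> (sinh v)\<^sup>2" using sinh_bounds(1)[OF v] v by (intro power_mono)
  then show "t\<^sup>2 / 8 \<le> cosh (t / 2) - 1" unfolding e by (simp add: v_def power_divide)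
  have "cosh v \<le> cosh (t / 2)" using assms by (subst cosh_real_nonneg_le_iff) (auto simp: v_def)
  then have "sinh v \<le> v * cosh (t / 2)"
    using sinh_bounds(2)[OF v] v by (meson mult_left_mono order_trans)
  then have "(sinh v)\<^sup>2 \<le> (v * cosh (t / 2))\<^sup>2" using v by (intro power_mono) auto
  then show "cosh (t / 2) - 1 \<le> t\<^sup>2 / 8 * (cosh (t / 2))\<^sup>2"
    unfolding e by (simp add: v_def power_divide power_mult_distrib)
qed

text \<open>With c = cosh (t / 2), 1 - A / c is ((c - 1) + (1 - A)) / c: a time part of size t^2 and
  an angular part of size d. The constants 1/64 and 1/8 are those of the half-angle bounds and serve
  all three angular distances; \<open>B\<close> absorbs cosh (T / 2).\<close>

lemma one_minus_divide_cosh_bounds: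
  fixes t T A d :: real
  assumes t: "0 < t" "t \<le> T" and A: "0 \<le> A" "A \<le> 1" and d: "d / 64 \<le> 1 - A" "1 - A \<le> d / 8"
  defines "B \<equiv> 64 * (cosh (T / 2))\<^sup>2"
  shows "(1 / B) * (t\<^sup>2 + d) \<le> 1 - A / cosh (t / 2)" "1 - A / cosh (t / 2) \<le> B * (t\<^sup>2 + d)"
proof -
  define c where "c = cosh (t / 2)"
  define cT where "cT = cosh (T / 2)"
  have c1: "1 \<le> c" unfolding c_def by (rule cosh_real_ge_1)
  have ccT: "c \<le> cT" using t unfolding c_def cT_def by (subst cosh_real_nonneg_le_iff) auto
  have d0: "d \<ge> 0" using d by simp
  have td: "t\<^sup>2 + d \<ge> 0" using d0 by simp
  have e: "1 - A / c = ((c - 1) + (1 - A)) / c" using c1 by (simp add: field_simps)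
  have "(1 / B) * (t\<^sup>2 + d) \<le> (t\<^sup>2 + d) / 64 / cT"
  proof -
    have "cT \<le> cT\<^sup>2" using c1 ccT by (simp add: power2_eq_square)
    then show ?thesis using td c1 ccT unfolding B_def cT_def[symmetric] by (simp add: frac_le)
  qed
  also have "\<dots> \<le> ((c - 1) + (1 - A)) / c"
  proof (rule frac_le)
    have "t\<^sup>2 / 64 \<le> t\<^sup>2 / 8" by simp
    then have "t\<^sup>2 / 64 \<le> c - 1" using cosh_minus_one_bounds(1)[of t] t unfolding c_def by linarith
    then show "(t\<^sup>2 + d) / 64 \<le> (c - 1) + (1 - A)" using d(1) by (simp add: add_divide_distrib)
  qed (use c1 ccT A in auto)
  finally show "(1 / B) * (t\<^sup>2 + d) \<le> 1 - A / cosh (t / 2)" using e by (simp add: c_def)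
  have "((c - 1) + (1 - A)) / c \<le> (c - 1) + (1 - A)"
    using divide_left_mono[of 1 c "(c - 1) + (1 - A)"] c1 A by simp
  also have "\<dots> \<le> t\<^sup>2 / 8 * c\<^sup>2 + d / 8"
    using cosh_minus_one_bounds(2)[of t] t d(2) by (simp add: c_def)
  also have "\<dots> \<le> t\<^sup>2 * B + d * B"
  proof (rule add_mono)
    have c2: "c\<^sup>2 \<le> cT\<^sup>2" using c1 ccT by (intro power_mono) auto
    have "t\<^sup>2 / 8 * c\<^sup>2 \<le> t\<^sup>2 * cT\<^sup>2" using c2 by (intro mult_mono) auto
    also have "\<dots> \<le> t\<^sup>2 * B" unfolding B_def cT_def by (intro mult_left_mono) auto
    finally show "t\<^sup>2 / 8 * c\<^sup>2 \<le> t\<^sup>2 * B" .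
    have "1 \<le> cT\<^sup>2" using c1 ccT by (simp add: one_le_power)
    then have "1 / 8 \<le> B" unfolding B_def cT_def by linarith
    then show "d / 8 \<le> d * B" using mult_left_mono[of "1/8" B d] d0 by simp
  qed
  finally show "1 - A / cosh (t / 2) \<le> B * (t\<^sup>2 + d)" using e by (simp add: c_def algebra_simps)
qed

section \<open>Two-sided estimates of the kernel for short and long times\<close>

lemma kernel_sum_bounds:
  assumes ab: "\<alpha> \<ge> -1/2" "\<beta> \<ge> -1/2"
  obtains K where "K > 0"
    "\<And>\<theta> \<phi> t. \<theta> \<in> {0..pi} \<Longrightarrow> \<phi> \<in> {0..pi} \<Longrightarrow> t > 0 \<Longrightarrow>
      poisson_jacobi_kernel \<alpha> \<beta> t \<theta> \<phi> \<le> K * (tanh (t / 2) * (2 * cosh (t / 2)) powr - (\<alpha> + \<beta> + 1) *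
        ((1 - cos (\<theta> / 2) * cos (\<phi> / 2) / cosh (t / 2)) powr - (\<alpha> + 1/2) *
         (1 - sin (\<theta> / 2) * sin (\<phi> / 2) / cosh (t / 2)) powr - (\<beta> + 1/2) /
         (1 - cos ((\<theta> - \<phi>) / 2) / cosh (t / 2))))"
    "\<And>\<theta> \<phi> t. \<theta> \<in> {0..pi} \<Longrightarrow> \<phi> \<in> {0..pi} \<Longrightarrow> t > 0 \<Longrightarrow>
      tanh (t / 2) * (2 * cosh (t / 2)) powr - (\<alpha> + \<beta> + 1) *
        ((1 - cos (\<theta> / 2) * cos (\<phi> / 2) / cosh (t / 2)) powr - (\<alpha> + 1/2) *
         (1 - sin (\<theta> / 2) * sin (\<phi> / 2) / cosh (t / 2)) powr - (\<beta> + 1/2) /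
         (1 - cos ((\<theta> - \<phi>) / 2) / cosh (t / 2))) \<le> K * poisson_jacobi_kernel \<alpha> \<beta> t \<theta> \<phi>"
proof -
  obtain K where K: "K > 0"
    "\<And>\<xi> \<eta>. \<xi> \<ge> 0 \<Longrightarrow> \<eta> \<ge> 0 \<Longrightarrow> \<xi> + \<eta> < 1 \<Longrightarrow> (\<Sum>N. kernel_coeff \<alpha> \<beta> (\<xi>\<^sup>2) (\<eta>\<^sup>2) N) \<le>
       K * ((1 - \<eta>) powr - (\<alpha> + 1/2) * (1 - \<xi>) powr - (\<beta> + 1/2) / (1 - \<xi> - \<eta>))"
    "\<And>\<xi> \<eta>. \<xi> \<ge> 0 \<Longrightarrow> \<eta> \<ge> 0 \<Longrightarrow> \<xi> + \<eta> < 1 \<Longrightarrow>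
       (1 - \<eta>) powr - (\<alpha> + 1/2) * (1 - \<xi>) powr - (\<beta> + 1/2) / (1 - \<xi> - \<eta>) \<le>
       K * (\<Sum>N. kernel_coeff \<alpha> \<beta> (\<xi>\<^sup>2) (\<eta>\<^sup>2) N)"
    by (rule kernel_coeff_sum_bounds[OF ab]) (rule that; assumption)
  \<comment> \<open>By the addition formula \<xi> + \<eta> = cos ((\<theta> - \<phi>) / 2) / cosh (t
    / 2), which is below 1 because cosh (t / 2) > 1 for t > 0.\<close>
  have xe: "sin (\<theta> / 2) * sin (\<phi> / 2) / cosh (t / 2) \<ge> 0 \<and> cos (\<theta> / 2) * cos (\<phi> / 2) / cosh (t / 2) \<ge> 0 \<and>
     sin (\<theta> / 2) * sin (\<phi> / 2) / cosh (t / 2) + cos (\<theta> / 2) * cos (\<phi> / 2) / cosh (t / 2) < 1 \<and>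
     1 - cos ((\<theta> - \<phi>) / 2) / cosh (t / 2) = 1 - sin (\<theta> / 2) * sin (\<phi> / 2) / cosh (t / 2) - cos (\<theta> / 2) * cos (\<phi> / 2) / cosh (t / 2)"
    if "\<theta> \<in> {0..pi}" "\<phi> \<in> {0..pi}" "t > 0" for \<theta> \<phi> t :: real
  proof (intro conjI)
    have c: "cosh (t / 2) > 1" using cosh_real_ge_1[of "t/2"] cosh_real_one_iff[of "t/2"] \<open>t > 0\<close> by linarith
    have e: "cos ((\<theta> - \<phi>) / 2) = sin (\<theta> / 2) * sin (\<phi> / 2) + cos (\<theta> / 2) * cos (\<phi> / 2)"
      unfolding diff_divide_distrib cos_diff by simp
    show "sin (\<theta> / 2) * sin (\<phi> / 2) / cosh (t / 2) \<ge> 0" "cos (\<theta> / 2) * cos (\<phi> / 2) / cosh (t / 2) \<ge> 0"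
      using that by (auto intro!: divide_nonneg_pos mult_nonneg_nonneg sin_ge_zero cos_ge_zero)
    show "1 - cos ((\<theta> - \<phi>) / 2) / cosh (t / 2) = 1 - sin (\<theta> / 2) * sin (\<phi> / 2) / cosh (t / 2) - cos (\<theta> / 2) * cos (\<phi> / 2) / cosh (t / 2)"
      unfolding e by (simp add: add_divide_distrib)
    have "cos ((\<theta> - \<phi>) / 2) < cosh (t / 2)" using c cos_le_one[of "(\<theta> - \<phi>) / 2"] by linarith
    then show "sin (\<theta> / 2) * sin (\<phi> / 2) / cosh (t / 2) + cos (\<theta> / 2) * cos (\<phi> / 2) / cosh (t / 2) < 1"
      unfolding e add_divide_distrib[symmetric] by simp
  qed
  have pre: "tanh (t / 2) * (2 * cosh (t / 2)) powr - (\<alpha> + \<beta> + 1) \<ge> 0" if "t > 0" for t :: real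
    using that by (intro mult_nonneg_nonneg) auto
  show ?thesis
  proof (rule that[of K])
    fix \<theta> \<phi> t :: real assume *: "\<theta> \<in> {0..pi}" "\<phi> \<in> {0..pi}" "t > 0"
    note x = xe[OF *]
    show "poisson_jacobi_kernel \<alpha> \<beta> t \<theta> \<phi> \<le> K * (tanh (t / 2) * (2 * cosh (t / 2)) powr - (\<alpha> + \<beta> + 1) *
        ((1 - cos (\<theta> / 2) * cos (\<phi> / 2) / cosh (t / 2)) powr - (\<alpha> + 1/2) *
         (1 - sin (\<theta> / 2) * sin (\<phi> / 2) / cosh (t / 2)) powr - (\<beta> + 1/2) /
         (1 - cos ((\<theta> - \<phi>) / 2) / cosh (t / 2))))"
      unfolding poisson_jacobi_kernel_eq[OF ab *(3,1,2)] mult.left_commute[of K]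
        x[THEN conjunct2, THEN conjunct2, THEN conjunct2]
      by (rule mult_left_mono[OF K(2) pre]) (use x * in auto)
    show "tanh (t / 2) * (2 * cosh (t / 2)) powr - (\<alpha> + \<beta> + 1) *
        ((1 - cos (\<theta> / 2) * cos (\<phi> / 2) / cosh (t / 2)) powr - (\<alpha> + 1/2) *
         (1 - sin (\<theta> / 2) * sin (\<phi> / 2) / cosh (t / 2)) powr - (\<beta> + 1/2) /
         (1 - cos ((\<theta> - \<phi>) / 2) / cosh (t / 2))) \<le> K * poisson_jacobi_kernel \<alpha> \<beta> t \<theta> \<phi>"
      unfolding poisson_jacobi_kernel_eq[OF ab *(3,1,2)] mult.left_commute[of K]
        x[THEN conjunct2, THEN conjunct2, THEN conjunct2]
      by (rule mult_left_mono[OF K(3) pre]) (use x * in auto)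
  qed (rule K(1))
qed

text \<open>The prefactor is comparable to t, and each of the three bases to t^2 plus its angular
  distance, all with the same constant \<open>B\<close>. By homogeneity the quotient of powers then
  changes at most by the factor B powr (\<alpha> + \<beta> + 2).\<close>

lemma poisson_jacobi_kernel_small_time:
  fixes \<alpha> \<beta> T :: real
  assumes ab: "\<alpha> \<ge> -1/2" "\<beta> \<ge> -1/2" and T: "T > 0"
  obtains C where "C > 0"
    "\<And>\<theta> \<phi> t. \<theta> \<in> {0..pi} \<Longrightarrow> \<phi> \<in> {0..pi} \<Longrightarrow> 0 < t \<Longrightarrow> t \<le> T \<Longrightarrow>
      poisson_jacobi_kernel \<alpha> \<beta> t \<theta> \<phi> \<le> C * (t * ((t\<^sup>2 + (\<theta>\<^sup>2 + \<phi>\<^sup>2)) powr - (\<alpha> + 1/2) *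
        (t\<^sup>2 + ((pi - \<theta>)\<^sup>2 + (pi - \<phi>)\<^sup>2)) powr - (\<beta> + 1/2) / (t\<^sup>2 + (\<theta> - \<phi>)\<^sup>2)))"
    "\<And>\<theta> \<phi> t. \<theta> \<in> {0..pi} \<Longrightarrow> \<phi> \<in> {0..pi} \<Longrightarrow> 0 < t \<Longrightarrow> t \<le> T \<Longrightarrow>
      t * ((t\<^sup>2 + (\<theta>\<^sup>2 + \<phi>\<^sup>2)) powr - (\<alpha> + 1/2) *
        (t\<^sup>2 + ((pi - \<theta>)\<^sup>2 + (pi - \<phi>)\<^sup>2)) powr - (\<beta> + 1/2) / (t\<^sup>2 + (\<theta> - \<phi>)\<^sup>2)) \<le>
      C * poisson_jacobi_kernel \<alpha> \<beta> t \<theta> \<phi>"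
proof -
  define a b where "a = \<alpha> + 1/2" and "b = \<beta> + 1/2"
  have a: "a \<ge> 0" and b: "b \<ge> 0" using ab by (auto simp: a_def b_def)
  define lam where "lam = \<alpha> + \<beta> + 1"
  have lam: "lam \<ge> 0" using ab by (simp add: lam_def)
  define cT where "cT = cosh (T / 2)"
  have cT: "cT \<ge> 1" unfolding cT_def by (rule cosh_real_ge_1)
  define B where "B = 64 * cT\<^sup>2"
  have B: "B > 0" using cT by (simp add: B_def)
  define E where "E = B powr (a + b + 1)"
  have E: "E > 0" using B by (simp add: E_def)
  \<comment> \<open>With this choice \<open>F\<close> times the lower bound
    \<open>t / 2 / cT * (2 * cT) powr - lam\<close> of \<open>P t\<close> is exactly t.\<close>
  define F where "F = 2 * cT * (2 * cT) powr lam"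
  have F: "F > 0" using cT by (simp add: F_def)
  define Q where "Q \<theta> \<phi> t = (1 - cos (\<theta> / 2) * cos (\<phi> / 2) / cosh (t / 2)) powr - a *
         (1 - sin (\<theta> / 2) * sin (\<phi> / 2) / cosh (t / 2)) powr - b /
         (1 - cos ((\<theta> - \<phi>) / 2) / cosh (t / 2))" for \<theta> \<phi> t :: real
  define D where "D \<theta> \<phi> t = (t\<^sup>2 + (\<theta>\<^sup>2 + \<phi>\<^sup>2)) powr - a *
        (t\<^sup>2 + ((pi - \<theta>)\<^sup>2 + (pi - \<phi>)\<^sup>2)) powr - b / (t\<^sup>2 + (\<theta> - \<phi>)\<^sup>2)" for \<theta> \<phi> t :: real
  define P where "P t = tanh (t / 2) * (2 * cosh (t / 2)) powr - lam" for t :: real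
  obtain K where K: "K > 0"
    "\<And>\<theta> \<phi> t. \<theta> \<in> {0..pi} \<Longrightarrow> \<phi> \<in> {0..pi} \<Longrightarrow> t > 0 \<Longrightarrow> poisson_jacobi_kernel \<alpha> \<beta> t \<theta> \<phi> \<le> K * (P t * Q \<theta> \<phi> t)"
    "\<And>\<theta> \<phi> t. \<theta> \<in> {0..pi} \<Longrightarrow> \<phi> \<in> {0..pi} \<Longrightarrow> t > 0 \<Longrightarrow> P t * Q \<theta> \<phi> t \<le> K * poisson_jacobi_kernel \<alpha> \<beta> t \<theta> \<phi>"
    unfolding P_def Q_def a_def b_def lam_def by (rule kernel_sum_bounds[OF ab]) (rule that[unfolded P_def Q_def a_def b_def lam_def]; assumption)
  have P: "P t \<le> F * t" "t \<le> F * P t" "P t \<ge> 0" if t: "0 < t" "t \<le> T" for t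
  proof -
    have c1: "1 \<le> cosh (t / 2)" by (rule cosh_real_ge_1)
    have ccT: "cosh (t / 2) \<le> cT" using t unfolding cT_def by (subst cosh_real_nonneg_le_iff) auto
    have "sinh (t / 2) \<le> t / 2 * cosh (t / 2)" using t by (intro sinh_bounds) auto
    then have th: "tanh (t / 2) \<le> t / 2" using c1 by (simp add: tanh_def divide_le_eq)
    have "t / 2 / cT \<le> sinh (t / 2) / cosh (t / 2)"
      using sinh_bounds(1)[of "t / 2"] t c1 ccT by (intro frac_le) auto
    then have th2: "t / 2 / cT \<le> tanh (t / 2)" by (simp add: tanh_def)
    have pw: "(2 * cosh (t / 2)) powr - lam \<le> 1"
      using powr_mono[of "- lam" 0 "2 * cosh (t / 2)"] lam c1 by simp
    have pw2: "(2 * cT) powr - lam \<le> (2 * cosh (t / 2)) powr - lam"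
      using lam c1 ccT by (intro powr_mono2') auto
    have "P t \<le> t / 2 * 1" unfolding P_def using th pw t by (intro mult_mono) auto
    also have "\<dots> \<le> F * t"
    proof -
      have "(2 * cT) powr lam \<ge> 1" using lam cT by (intro ge_one_powr_ge_zero) auto
      then have "1 / 2 * 1 \<le> 2 * cT * (2 * cT) powr lam" using cT by (intro mult_mono) auto
      then show ?thesis using t mult_right_mono[of "1/2" F t] by (simp add: F_def)
    qed
    finally show "P t \<le> F * t" .
    have "t / 2 / cT * (2 * cT) powr - lam \<le> P t"
      unfolding P_def using th2 pw2 t cT by (intro mult_mono) auto
    then have "F * (t / 2 / cT * (2 * cT) powr - lam) \<le> F * P t" using F by (intro mult_left_mono) auto
    moreover have "F * (t / 2 / cT * (2 * cT) powr - lam) = t"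
      using cT by (simp add: F_def powr_minus)
    ultimately show "t \<le> F * P t" by simp
    show "P t \<ge> 0" unfolding P_def using t by (intro mult_nonneg_nonneg) auto
  qed
  have Q: "Q \<theta> \<phi> t \<le> E * D \<theta> \<phi> t \<and> D \<theta> \<phi> t \<le> E * Q \<theta> \<phi> t"
    if \<theta>: "\<theta> \<in> {0..pi}" and \<phi>: "\<phi> \<in> {0..pi}" and t: "0 < t" "t \<le> T" for \<theta> \<phi> t
  proof -
    have y: "0 \<le> cos (\<theta> / 2) * cos (\<phi> / 2)" "cos (\<theta> / 2) * cos (\<phi> / 2) \<le> 1"
      using \<theta> \<phi> by (auto intro!: mult_nonneg_nonneg cos_ge_zero mult_le_one)
    have x: "0 \<le> sin (\<theta> / 2) * sin (\<phi> / 2)" "sin (\<theta> / 2) * sin (\<phi> / 2) \<le> 1"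
      using \<theta> \<phi> by (auto intro!: mult_nonneg_nonneg sin_ge_zero mult_le_one)
    have z: "0 \<le> cos ((\<theta> - \<phi>) / 2)" using \<theta> \<phi> by (intro cos_ge_zero) auto
    have d1: "(\<theta>\<^sup>2 + \<phi>\<^sup>2) / 64 \<le> 1 - cos (\<theta> / 2) * cos (\<phi> / 2)" "1 - cos (\<theta> / 2) * cos (\<phi> / 2) \<le> (\<theta>\<^sup>2 + \<phi>\<^sup>2) / 8"
      using one_minus_cos_mult_cos_bounds[of "\<theta> / 2" "\<phi> / 2"] \<theta> \<phi> by (simp_all add: power_divide add_divide_distrib)
    \<comment> \<open>The reflection u -> pi - u exchanges sine and cosine of the half-angle and
      carries the cosine bounds near 0 over to sine bounds near pi.\<close>
    have s: "sin (u / 2) = cos ((pi - u) / 2)" for u :: real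
      unfolding diff_divide_distrib cos_diff by simp
    have d2: "((pi - \<theta>)\<^sup>2 + (pi - \<phi>)\<^sup>2) / 64 \<le> 1 - sin (\<theta> / 2) * sin (\<phi> / 2)"
       "1 - sin (\<theta> / 2) * sin (\<phi> / 2) \<le> ((pi - \<theta>)\<^sup>2 + (pi - \<phi>)\<^sup>2) / 8"
      unfolding s using one_minus_cos_mult_cos_bounds[of "(pi - \<theta>) / 2" "(pi - \<phi>) / 2"] \<theta> \<phi>
      by (simp_all add: power_divide add_divide_distrib)
    have d3: "(\<theta> - \<phi>)\<^sup>2 / 64 \<le> 1 - cos ((\<theta> - \<phi>) / 2)" "1 - cos ((\<theta> - \<phi>) / 2) \<le> (\<theta> - \<phi>)\<^sup>2 / 8"
    proof -
      have "\<bar>(\<theta> - \<phi>) / 2\<bar> \<le> pi / 2" using \<theta> \<phi> by auto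
      from one_minus_cos_bounds[OF this]
      have "(\<theta> - \<phi>)\<^sup>2 / 32 \<le> 1 - cos ((\<theta> - \<phi>) / 2)" "1 - cos ((\<theta> - \<phi>) / 2) \<le> (\<theta> - \<phi>)\<^sup>2 / 8"
        by (simp_all add: power_divide)
      moreover have "(\<theta> - \<phi>)\<^sup>2 / 64 \<le> (\<theta> - \<phi>)\<^sup>2 / 32" by simp
      ultimately show "(\<theta> - \<phi>)\<^sup>2 / 64 \<le> 1 - cos ((\<theta> - \<phi>) / 2)" "1 - cos ((\<theta> - \<phi>) / 2) \<le> (\<theta> - \<phi>)\<^sup>2 / 8"
        by linarith+
    qed
    note b1 = one_minus_divide_cosh_bounds[OF t y d1, folded cT_def, folded B_def]
    note b2 = one_minus_divide_cosh_bounds[OF t x d2, folded cT_def, folded B_def]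
    note b3 = one_minus_divide_cosh_bounds[OF t z cos_le_one d3, folded cT_def, folded B_def]
    have pos: "t\<^sup>2 + (\<theta>\<^sup>2 + \<phi>\<^sup>2) > 0" "t\<^sup>2 + ((pi - \<theta>)\<^sup>2 + (pi - \<phi>)\<^sup>2) > 0" "t\<^sup>2 + (\<theta> - \<phi>)\<^sup>2 > 0"
      using t by (auto intro!: add_pos_nonneg)
    have Bi: "1 / B > 0" using B by simp
    have EB: "E * B powr - (a + b + 1) = 1" unfolding E_def powr_minus using B by simp
    have "Q \<theta> \<phi> t \<le> (1 / B) powr - (a + b + 1) * D \<theta> \<phi> t"
      unfolding Q_def D_def powr_quotient_scale[OF Bi pos, symmetric]
      by (rule powr_quotient_mono[OF a b _ b1(1) _ b2(1) _ b3(1)]) (use Bi pos in \<open>auto intro!: mult_pos_pos\<close>)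
    also have "(1 / B) powr - (a + b + 1) = E"
      using B powr_divide[of 1 B "- (a + b + 1)"] EB by (simp add: divide_eq_eq)
    finally have 1: "Q \<theta> \<phi> t \<le> E * D \<theta> \<phi> t" .
    have "B powr - (a + b + 1) * D \<theta> \<phi> t \<le> Q \<theta> \<phi> t"
      unfolding Q_def D_def powr_quotient_scale[OF B pos, symmetric]
      by (rule powr_quotient_mono[OF a b _ b1(2) _ b2(2) _ b3(2)])
         (use order_less_le_trans[OF mult_pos_pos[OF Bi pos(1)] b1(1)] order_less_le_trans[OF mult_pos_pos[OF Bi pos(2)] b2(1)]
           order_less_le_trans[OF mult_pos_pos[OF Bi pos(3)] b3(1)] in auto)
    then have "E * (B powr - (a + b + 1) * D \<theta> \<phi> t) \<le> E * Q \<theta> \<phi> t" using E by (intro mult_left_mono) auto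
    then show ?thesis using 1 EB by (simp add: mult.assoc[symmetric])
  qed
  have D0: "D \<theta> \<phi> t \<ge> 0" for \<theta> \<phi> t unfolding D_def by simp
  have Q0: "Q \<theta> \<phi> t \<ge> 0" if "\<theta> \<in> {0..pi}" "\<phi> \<in> {0..pi}" "0 < t" "t \<le> T" for \<theta> \<phi> t
    using order_trans[OF D0 Q[OF that, THEN conjunct2]] E by (simp add: zero_le_mult_iff)
  have main: "poisson_jacobi_kernel \<alpha> \<beta> t \<theta> \<phi> \<le> K * F * E * (t * D \<theta> \<phi> t)"
    "t * D \<theta> \<phi> t \<le> K * F * E * poisson_jacobi_kernel \<alpha> \<beta> t \<theta> \<phi>"
    if *: "\<theta> \<in> {0..pi}" "\<phi> \<in> {0..pi}" "0 < t" "t \<le> T" for \<theta> \<phi> t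
  proof -
    have "P t * Q \<theta> \<phi> t \<le> (F * t) * (E * D \<theta> \<phi> t)"
      using P[OF *(3,4)] Q[OF *] Q0[OF *] F *(3) by (intro mult_mono) auto
    then have "K * (P t * Q \<theta> \<phi> t) \<le> K * ((F * t) * (E * D \<theta> \<phi> t))" using K(1) by (intro mult_left_mono) auto
    with K(2)[OF *(1,2,3)] show "poisson_jacobi_kernel \<alpha> \<beta> t \<theta> \<phi> \<le> K * F * E * (t * D \<theta> \<phi> t)"
      by (simp add: mult_ac)
    have "t * D \<theta> \<phi> t \<le> (F * P t) * (E * Q \<theta> \<phi> t)"
      using P[OF *(3,4)] Q[OF *] D0 F *(3) by (intro mult_mono) auto
    also have "\<dots> = F * E * (P t * Q \<theta> \<phi> t)" by simp
    also have "\<dots> \<le> F * E * (K * poisson_jacobi_kernel \<alpha> \<beta> t \<theta> \<phi>)"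
      using K(3)[OF *(1,2,3)] F E by (intro mult_left_mono) auto
    finally show "t * D \<theta> \<phi> t \<le> K * F * E * poisson_jacobi_kernel \<alpha> \<beta> t \<theta> \<phi>" by (simp add: mult_ac)
  qed
  show ?thesis
    by (rule that[of "K * F * E"]) (use main K(1) F E in \<open>auto simp: D_def a_def b_def\<close>)
qed

text \<open>For t \<ge> T every base 1 - A / cosh (t / 2) lies between a positive constant
  \<open>\<delta>\<close> and 1, so the angles contribute only constants. The decay is that of the
  prefactor: 2 cosh (t / 2) lies between exp (t / 2) and 2 exp (t / 2), and tanh (t / 2) between
  tanh (T / 2) and 1.\<close>

lemma poisson_jacobi_kernel_large_time:
  fixes \<alpha> \<beta> T :: real
  assumes ab: "\<alpha> \<ge> -1/2" "\<beta> \<ge> -1/2" and T: "T > 0"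
  obtains C where "C > 0"
    "\<And>\<theta> \<phi> t. \<theta> \<in> {0..pi} \<Longrightarrow> \<phi> \<in> {0..pi} \<Longrightarrow> t \<ge> T \<Longrightarrow>
      poisson_jacobi_kernel \<alpha> \<beta> t \<theta> \<phi> \<le> C * exp (- t * ((\<alpha> + \<beta> + 1) / 2))"
    "\<And>\<theta> \<phi> t. \<theta> \<in> {0..pi} \<Longrightarrow> \<phi> \<in> {0..pi} \<Longrightarrow> t \<ge> T \<Longrightarrow>
      exp (- t * ((\<alpha> + \<beta> + 1) / 2)) \<le> C * poisson_jacobi_kernel \<alpha> \<beta> t \<theta> \<phi>"
proof -
  define a b where "a = \<alpha> + 1/2" and "b = \<beta> + 1/2"
  have a: "a \<ge> 0" and b: "b \<ge> 0" using ab by (auto simp: a_def b_def)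
  define lam where "lam = \<alpha> + \<beta> + 1"
  have lam: "lam \<ge> 0" using ab by (simp add: lam_def)
  define \<delta> where "\<delta> = 1 - 1 / cosh (T / 2)"
  have cT: "cosh (T / 2) > 1" using cosh_real_ge_1[of "T/2"] cosh_real_one_iff[of "T/2"] T by linarith
  have \<delta>: "\<delta> > 0" using cT by (simp add: \<delta>_def)
  define M where "M = \<delta> powr - a * \<delta> powr - b / \<delta>"
  have M: "M > 0" using \<delta> by (simp add: M_def)
  define Q where "Q \<theta> \<phi> t = (1 - cos (\<theta> / 2) * cos (\<phi> / 2) / cosh (t / 2)) powr - a *
         (1 - sin (\<theta> / 2) * sin (\<phi> / 2) / cosh (t / 2)) powr - b /
         (1 - cos ((\<theta> - \<phi>) / 2) / cosh (t / 2))" for \<theta> \<phi> t :: real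
  define P where "P t = tanh (t / 2) * (2 * cosh (t / 2)) powr - lam" for t :: real
  obtain K where K: "K > 0"
    "\<And>\<theta> \<phi> t. \<theta> \<in> {0..pi} \<Longrightarrow> \<phi> \<in> {0..pi} \<Longrightarrow> t > 0 \<Longrightarrow> poisson_jacobi_kernel \<alpha> \<beta> t \<theta> \<phi> \<le> K * (P t * Q \<theta> \<phi> t)"
    "\<And>\<theta> \<phi> t. \<theta> \<in> {0..pi} \<Longrightarrow> \<phi> \<in> {0..pi} \<Longrightarrow> t > 0 \<Longrightarrow> P t * Q \<theta> \<phi> t \<le> K * poisson_jacobi_kernel \<alpha> \<beta> t \<theta> \<phi>"
    unfolding P_def Q_def a_def b_def lam_def by (rule kernel_sum_bounds[OF ab]) (rule that[unfolded P_def Q_def a_def b_def lam_def]; assumption)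
  define L where "L = 2 powr lam / tanh (T / 2)"
  have L: "L > 0" using T by (simp add: L_def)
  have P: "P t \<le> exp (- t * (lam / 2))" "exp (- t * (lam / 2)) \<le> L * P t" if t: "t \<ge> T" for t
  proof -
    have c1: "exp (t / 2) \<le> 2 * cosh (t / 2)" "2 * cosh (t / 2) \<le> 2 * exp (t / 2)"
      using t T by (auto simp: cosh_field_def)
    have ex: "exp (t / 2) powr - lam = exp (- t * (lam / 2))" by (simp add: powr_def)
    have pw: "(2 * cosh (t / 2)) powr - lam \<le> exp (- t * (lam / 2))"
      unfolding ex[symmetric] using lam c1 by (intro powr_mono2') auto
    have "(2 * exp (t / 2)) powr - lam \<le> (2 * cosh (t / 2)) powr - lam"
      using lam c1 by (intro powr_mono2') auto
    then have pw2: "2 powr - lam * exp (- t * (lam / 2)) \<le> (2 * cosh (t / 2)) powr - lam"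
      unfolding ex[symmetric] by (simp add: powr_mult)
    have th: "tanh (t / 2) \<le> 1" using tanh_real_lt_1[of "t / 2"] by simp
    have th2: "tanh (T / 2) \<le> tanh (t / 2)" "tanh (T / 2) > 0" using t T by auto
    have "P t \<le> 1 * exp (- t * (lam / 2))"
      unfolding P_def using th pw t T by (intro mult_mono) auto
    then show "P t \<le> exp (- t * (lam / 2))" by simp
    have "tanh (T / 2) * (2 powr - lam * exp (- t * (lam / 2))) \<le> P t"
      unfolding P_def using th2 pw2 by (intro mult_mono) auto
    then have "L * (tanh (T / 2) * (2 powr - lam * exp (- t * (lam / 2)))) \<le> L * P t"
      using L by (intro mult_left_mono) auto
    moreover have "L * (tanh (T / 2) * (2 powr - lam * exp (- t * (lam / 2)))) = exp (- t * (lam / 2))"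
      using th2(2) by (simp add: L_def powr_minus)
    ultimately show "exp (- t * (lam / 2)) \<le> L * P t" by (simp only:)
  qed
  have Q: "Q \<theta> \<phi> t \<le> M \<and> 1 \<le> Q \<theta> \<phi> t"
    if \<theta>: "\<theta> \<in> {0..pi}" and \<phi>: "\<phi> \<in> {0..pi}" and t: "t \<ge> T" for \<theta> \<phi> t
  proof -
    have y: "0 \<le> cos (\<theta> / 2) * cos (\<phi> / 2)" "cos (\<theta> / 2) * cos (\<phi> / 2) \<le> 1"
      using \<theta> \<phi> by (auto intro!: mult_nonneg_nonneg cos_ge_zero mult_le_one)
    have x: "0 \<le> sin (\<theta> / 2) * sin (\<phi> / 2)" "sin (\<theta> / 2) * sin (\<phi> / 2) \<le> 1"
      using \<theta> \<phi> by (auto intro!: mult_nonneg_nonneg sin_ge_zero mult_le_one)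
    have z: "0 \<le> cos ((\<theta> - \<phi>) / 2)" using \<theta> \<phi> by (intro cos_ge_zero) auto
    have ct: "cosh (T / 2) \<le> cosh (t / 2)" using t T by (subst cosh_real_nonneg_le_iff) auto
    have s: "\<delta> \<le> 1 - A / cosh (t / 2)" "1 - A / cosh (t / 2) \<le> 1" "0 < 1 - A / cosh (t / 2)"
      if "0 \<le> A" "A \<le> 1" for A
    proof -
      have "A / cosh (t / 2) \<le> 1 / cosh (T / 2)" using that ct by (intro frac_le) auto
      then show "\<delta> \<le> 1 - A / cosh (t / 2)" by (simp add: \<delta>_def)
      then show "0 < 1 - A / cosh (t / 2)" using \<delta> by linarith
      show "1 - A / cosh (t / 2) \<le> 1" using that by simp
    qed
    have "Q \<theta> \<phi> t \<le> M"
      unfolding Q_def M_def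
      by (rule powr_quotient_mono[OF a b \<delta> s(1)[OF y] \<delta> s(1)[OF x] \<delta> s(1)[OF z cos_le_one]])
    moreover have "1 powr - a * 1 powr - b / 1 \<le> Q \<theta> \<phi> t"
      unfolding Q_def
      by (rule powr_quotient_mono[OF a b s(3)[OF y] s(2)[OF y] s(3)[OF x] s(2)[OF x] s(3)[OF z cos_le_one] s(2)[OF z cos_le_one]])
    ultimately show ?thesis by simp
  qed
  have main: "poisson_jacobi_kernel \<alpha> \<beta> t \<theta> \<phi> \<le> (K * M + L * K) * exp (- t * (lam / 2))"
    "exp (- t * (lam / 2)) \<le> (K * M + L * K) * poisson_jacobi_kernel \<alpha> \<beta> t \<theta> \<phi>"
    if *: "\<theta> \<in> {0..pi}" "\<phi> \<in> {0..pi}" "t \<ge> T" for \<theta> \<phi> t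
  proof -
    have t: "t > 0" using * T by simp
    have P0: "P t \<ge> 0" unfolding P_def using t by (intro mult_nonneg_nonneg) auto
    have "P t * Q \<theta> \<phi> t \<le> exp (- t * (lam / 2)) * M"
      using P(1)[OF *(3)] Q[OF *] P0 by (intro mult_mono) auto
    then have "K * (P t * Q \<theta> \<phi> t) \<le> K * (exp (- t * (lam / 2)) * M)" using K(1) by (intro mult_left_mono) auto
    with K(2)[OF *(1,2) t] have 1: "poisson_jacobi_kernel \<alpha> \<beta> t \<theta> \<phi> \<le> K * M * exp (- t * (lam / 2))"
      by (simp add: mult_ac)
    also have "\<dots> \<le> (K * M + L * K) * exp (- t * (lam / 2))" using K(1) L by (intro mult_right_mono) auto
    finally show "poisson_jacobi_kernel \<alpha> \<beta> t \<theta> \<phi> \<le> (K * M + L * K) * exp (- t * (lam / 2))" .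
    have "P t * 1 \<le> P t * Q \<theta> \<phi> t" using Q[OF *] P0 by (intro mult_left_mono) auto
    with K(3)[OF *(1,2) t] have 2: "P t \<le> K * poisson_jacobi_kernel \<alpha> \<beta> t \<theta> \<phi>" by simp
    then have "L * P t \<le> L * (K * poisson_jacobi_kernel \<alpha> \<beta> t \<theta> \<phi>)" using L by (intro mult_left_mono) auto
    with P(2)[OF *(3)] have "exp (- t * (lam / 2)) \<le> L * K * poisson_jacobi_kernel \<alpha> \<beta> t \<theta> \<phi>" by simp
    also have "\<dots> \<le> (K * M + L * K) * poisson_jacobi_kernel \<alpha> \<beta> t \<theta> \<phi>"
      using order_trans[OF P0 2] K(1) M by (intro mult_right_mono) (auto simp: zero_le_mult_iff)
    finally show "exp (- t * (lam / 2)) \<le> (K * M + L * K) * poisson_jacobi_kernel \<alpha> \<beta> t \<theta> \<phi>" .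
  qed
  show ?thesis
    by (rule that[of "K * M + L * K"]) (use main K(1) M L in \<open>auto simp: lam_def add_pos_pos\<close>)
qed

theorem theorem5p2:
  fixes \<alpha> \<beta> T :: real
  assumes "\<alpha> \<ge> -1/2" and "\<beta> \<ge> -1/2" and "T > 0"
  shows "(\<exists>C>0. \<forall>\<theta>\<in>{0..pi}. \<forall>\<phi>\<in>{0..pi}. \<forall>t. 0 < t \<and> t \<le> T \<longrightarrow>
           (let Y = (t\<^sup>2 + \<theta>\<^sup>2 + \<phi>\<^sup>2) powr (- \<alpha> - 1/2) *
                    (t\<^sup>2 + (pi - \<theta>)\<^sup>2 + (pi - \<phi>)\<^sup>2) powr (- \<beta> - 1/2) *
                    (t / (t\<^sup>2 + (\<theta> - \<phi>)\<^sup>2))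
            in inverse C * Y \<le> poisson_jacobi_kernel \<alpha> \<beta> t \<theta> \<phi> \<and>
               poisson_jacobi_kernel \<alpha> \<beta> t \<theta> \<phi> \<le> C * Y)) \<and>
         (\<exists>C>0. \<forall>\<theta>\<in>{0..pi}. \<forall>\<phi>\<in>{0..pi}. \<forall>t\<ge>T.
           (let Y = exp (- t * ((\<alpha> + \<beta> + 1) / 2))
            in inverse C * Y \<le> poisson_jacobi_kernel \<alpha> \<beta> t \<theta> \<phi> \<and>
               poisson_jacobi_kernel \<alpha> \<beta> t \<theta> \<phi> \<le> C * Y))"
proof (intro conjI)
  have inv: "inverse C * Y \<le> H" if "C > 0" "Y \<le> C * H" for C Y H :: real
    using that by (simp add: field_simps)
  obtain C where C: "C > 0"
    "\<And>\<theta> \<phi> t. \<theta> \<in> {0..pi} \<Longrightarrow> \<phi> \<in> {0..pi} \<Longrightarrow> 0 < t \<Longrightarrow> t \<le> T \<Longrightarrow>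
      poisson_jacobi_kernel \<alpha> \<beta> t \<theta> \<phi> \<le> C * (t * ((t\<^sup>2 + (\<theta>\<^sup>2 + \<phi>\<^sup>2)) powr - (\<alpha> + 1/2) *
        (t\<^sup>2 + ((pi - \<theta>)\<^sup>2 + (pi - \<phi>)\<^sup>2)) powr - (\<beta> + 1/2) / (t\<^sup>2 + (\<theta> - \<phi>)\<^sup>2)))"
    "\<And>\<theta> \<phi> t. \<theta> \<in> {0..pi} \<Longrightarrow> \<phi> \<in> {0..pi} \<Longrightarrow> 0 < t \<Longrightarrow> t \<le> T \<Longrightarrow>
      t * ((t\<^sup>2 + (\<theta>\<^sup>2 + \<phi>\<^sup>2)) powr - (\<alpha> + 1/2) *
        (t\<^sup>2 + ((pi - \<theta>)\<^sup>2 + (pi - \<phi>)\<^sup>2)) powr - (\<beta> + 1/2) / (t\<^sup>2 + (\<theta> - \<phi>)\<^sup>2)) \<le>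
      C * poisson_jacobi_kernel \<alpha> \<beta> t \<theta> \<phi>"
    by (rule poisson_jacobi_kernel_small_time[OF assms]) (rule that; assumption)
  have Y: "(t\<^sup>2 + \<theta>\<^sup>2 + \<phi>\<^sup>2) powr (- \<alpha> - 1/2) * (t\<^sup>2 + (pi - \<theta>)\<^sup>2 + (pi - \<phi>)\<^sup>2) powr (- \<beta> - 1/2) *
      (t / (t\<^sup>2 + (\<theta> - \<phi>)\<^sup>2)) = t * ((t\<^sup>2 + (\<theta>\<^sup>2 + \<phi>\<^sup>2)) powr - (\<alpha> + 1/2) *
        (t\<^sup>2 + ((pi - \<theta>)\<^sup>2 + (pi - \<phi>)\<^sup>2)) powr - (\<beta> + 1/2) / (t\<^sup>2 + (\<theta> - \<phi>)\<^sup>2))" for t \<theta> \<phi> :: real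
    by (simp add: add.assoc)
  show "\<exists>C>0. \<forall>\<theta>\<in>{0..pi}. \<forall>\<phi>\<in>{0..pi}. \<forall>t. 0 < t \<and> t \<le> T \<longrightarrow>
           (let Y = (t\<^sup>2 + \<theta>\<^sup>2 + \<phi>\<^sup>2) powr (- \<alpha> - 1/2) *
                    (t\<^sup>2 + (pi - \<theta>)\<^sup>2 + (pi - \<phi>)\<^sup>2) powr (- \<beta> - 1/2) *
                    (t / (t\<^sup>2 + (\<theta> - \<phi>)\<^sup>2))
            in inverse C * Y \<le> poisson_jacobi_kernel \<alpha> \<beta> t \<theta> \<phi> \<and>
               poisson_jacobi_kernel \<alpha> \<beta> t \<theta> \<phi> \<le> C * Y)"
    unfolding Let_def Y using C inv[OF C(1) C(3)] by blast
  obtain C' where C': "C' > 0"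
    "\<And>\<theta> \<phi> t. \<theta> \<in> {0..pi} \<Longrightarrow> \<phi> \<in> {0..pi} \<Longrightarrow> t \<ge> T \<Longrightarrow>
      poisson_jacobi_kernel \<alpha> \<beta> t \<theta> \<phi> \<le> C' * exp (- t * ((\<alpha> + \<beta> + 1) / 2))"
    "\<And>\<theta> \<phi> t. \<theta> \<in> {0..pi} \<Longrightarrow> \<phi> \<in> {0..pi} \<Longrightarrow> t \<ge> T \<Longrightarrow>
      exp (- t * ((\<alpha> + \<beta> + 1) / 2)) \<le> C' * poisson_jacobi_kernel \<alpha> \<beta> t \<theta> \<phi>"
    by (rule poisson_jacobi_kernel_large_time[OF assms]) (rule that; assumption)
  show "\<exists>C>0. \<forall>\<theta>\<in>{0..pi}. \<forall>\<phi>\<in>{0..pi}. \<forall>t\<ge>T.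
           (let Y = exp (- t * ((\<alpha> + \<beta> + 1) / 2))
            in inverse C * Y \<le> poisson_jacobi_kernel \<alpha> \<beta> t \<theta> \<phi> \<and>
               poisson_jacobi_kernel \<alpha> \<beta> t \<theta> \<phi> \<le> C * Y)"
    unfolding Let_def using C' inv[OF C'(1) C'(3)] by blast
qed

end
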